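(* Let $N\in\mathbb{N}$, $\alpha\in(0,2)$. Let $D_0,D_1\subset\mathbb{R}^N$ be open sets such that $0\in D_1$, $\overline{D}_1\subset D_0$, and $D_0\setminus\overline{D}_1$ satisfies a uniform exterior cone condition, and let $f:(D_0\setminus\overline{D}_1)\times[0,1]\to\mathbb{R}$. Let $b_0,b_1$ be continuous and bounded functions on $\mathbb{R}^N$ such that $b_1\equiv1$ on $\partial D_1$, $b_0\equiv0$ on $\partial D_0$, and $b_0$ and $b_1$ have starshaped superlevel sets. Consider the problem $$(P_b)\qquad -(-\Delta)^{\alpha/2}u=f(x,u)\ \text{ in } D_0\setminus\overline{D}_1,\qquad u=b_0\ \text{ in }\mathbb{R}^N\setminus D_0,\qquad u=b_1\ \text{ in }\overline{D}_1 .$$ Consider the following conditions on $f$: - (F0) $f$ is a bounded Borel function on $(D_0\setminus\overline{D}_1)\times[0,1]$; - (F1) $t^{\alpha}f(tx,u)\ge f(x,u)$ for every $t\ge1$ and $(x,u)\in(D_0\setminus\overline{D}_1)\times[0,1]$ such that $tx\in D_0\setminus\overline{D}_1$; - (F2) there exists $C>0$ such that $|f(x,u_1)-f(x,u_2)|\le C|u_1-u_2|$ for all $x\in D_0\setminus\overline{D}_1$ and $u_1,u_2\in[0,1]$; - (F3) $f(x,u_1)\le f(x,u_2)$ for all $x\in D_0\setminus\overline{D}_1$ and $u_1,u_2\in[0,1]$ with $u_1<u_2$. For a function $u$ put $U(\ell)=\{x\in\mathbb{R}^N: u(x)\ge\ell\}$. Then: (i) Assume $D_0$ and $D_1$ are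 bounded starshaped sets and $f$ satisfies (F0), (F1), (F2), (F3). If $u$ is a solution of $(P_b)$ such that $0\le u\le1$ on $D_0\setminus\overline{D}_1$, then the superlevel sets $U(\ell)$ are starshaped for all $\ell\in(0,1)$. (ii) Assume $D_0$ and $D_1$ are bounded, strictly starshaped sets and $f$ satisfies (F0), (F1), (F2). If $u$ is a solution of $(P_b)$ such that $0<u<1$ on $D_0\setminus\overline{D}_1$, then the superlevel sets $U(\ell)$ are strictly starshaped for all $\ell\in(0,1)$. (iii) Assume $D_0=\mathbb{R}^N$, $D_1$ is a bounded starshaped set, and $f$ satisfies (F0), (F1), (F2), (F3). If $u$ is a solution of $(P_b)$ such that $0\le u\le1$ on $D_0\setminus\overline{D}_1$, then the superlevel sets $U(\ell)$ are starshaped for all $\ell\in(0,1)$.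
   Context: Let $\mathcal{L}^1_\alpha$ be the space of Borel functions $u:\mathbb{R}^N\to\mathbb{R}\cup\{\infty\}$ with $\int_{\mathbb{R}^N}\frac{|u(x)|}{(1+|x|)^{N+\alpha}}\,dx<\infty$. For $u\in\mathcal{L}^1_\alpha$ and $x\in\mathbb{R}^N$, the fractional Laplacian is $$(-\Delta)^{\alpha/2}u(x)=c_{N,\alpha}\lim_{\varepsilon\downarrow0}\int_{|x-y|>\varepsilon}\frac{u(x)-u(y)}{|x-y|^{N+\alpha}}\,dy$$ whenever the limit exists, with $c_{N,\alpha}=2^{\alpha-2}\pi^{-N/2}\alpha(2-\alpha)\Gamma(\frac{N+\alpha}{2})/\Gamma(2-\frac{\alpha}{2})$. It exists everywhere for functions in $C_c^2(\mathbb{R}^N)$. For $u\in\mathcal{L}^1_\alpha$ the distribution $(-\Delta)^{\alpha/2}u$ is defined by $\langle(-\Delta)^{\alpha/2}u,\varphi\rangle=\int_{\mathbb{R}^N}u\,(-\Delta)^{\alpha/2}\varphi\,dx$ for $\varphi\in C_c^\infty(\mathbb{R}^N)$. A solution of $(P_b)$ is a function $u$ that is continuous and bounded on $\mathbb{R}^N$, with $u=b_0$ in $\mathbb{R}^N\setminus D_0$, $u=b_1$ in $\overline{D}_1$, and $-(-\Delta)^{\alpha/2}u=f(x,u)$ as distributions in $D_0\setminus\overline{D}_1$, i.e. $\langle-(-\Delta)^{\alpha/2}u,\varphi\rangle=\int f(x,u(x))\varphi(x)\,dx$ for all $\varphi\in C_c^\infty(D_0\setminus\overline{D}_1)$. A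 set $A\subset\mathbb{R}^N$ is starshaped (with respect to $0$) if $sA\subseteq A$ for every $s\in[0,1]$ (so the empty set is starshaped). It is strictly starshaped if $0$ is in the interior of $A$ and any ray starting from $0$ intersects the boundary of $A$ in only one point. The superlevel sets of a function $b:\mathbb{R}^N\to\mathbb{R}$ are the sets $\{x\in\mathbb{R}^N:b(x)\ge\ell\}$, $\ell\in\mathbb{R}$. *)

theory Defs
  imports "HOL-Analysis.Analysis"
begin

subsection \<open>Starshaped sets and superlevel sets\<close>

definition starshaped :: "'a::real_vector set \<Rightarrow> bool" where
  "starshaped A \<longleftrightarrow> (\<forall>s\<in>{0..1}. (\<lambda>x. s *\<^sub>R x) ` A \<subseteq> A)"

definition strictly_starshaped :: "'a::real_normed_vector set \<Rightarrow> bool" where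
  "strictly_starshaped A \<longleftrightarrow>
     0 \<in> interior A \<and> (\<forall>v. v \<noteq> 0 \<longrightarrow> (\<exists>!y. y \<in> {t *\<^sub>R v |t. 0 \<le> t} \<and> y \<in> frontier A))"

definition superlevel :: "('a \<Rightarrow> real) \<Rightarrow> real \<Rightarrow> 'a set" where
  "superlevel u l = {x. l \<le> u x}"

subsection \<open>Uniform exterior cone condition\<close>

definition finite_cone :: "'a::real_inner \<Rightarrow> 'a \<Rightarrow> real \<Rightarrow> real \<Rightarrow> 'a set" where
  "finite_cone x0 v \<theta> h = {y. cos \<theta> * norm (y - x0) \<le> (y - x0) \<bullet> v \<and> (y - x0) \<bullet> v \<le> h}"

text \<open>
  As in Gilbarg and Trudinger: at each boundary point the closure of the set meets some closed
  right circular cone exactly in its vertex, and all these cones are congruent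
  (same half-angle and same height; only the axis \<open>v\<close> varies).
\<close>

definition uniform_exterior_cone :: "'a::real_inner set \<Rightarrow> bool" where
  "uniform_exterior_cone D \<longleftrightarrow>
     (\<exists>\<theta>\<in>{0<..<pi/2}. \<exists>h>0. \<forall>x0\<in>frontier D. \<exists>v. norm v = 1 \<and>
        closure D \<inter> finite_cone x0 v \<theta> h = {x0})"

subsection \<open>Test functions\<close>

text \<open>All iterated directional derivatives up to order \<open>k\<close> exist and are continuous.\<close>

primrec Ck :: "nat \<Rightarrow> ('a::real_normed_vector \<Rightarrow> real) \<Rightarrow> bool" where
  "Ck 0 \<phi> \<longleftrightarrow> continuous_on UNIV \<phi>"
| "Ck (Suc k) \<phi> \<longleftrightarrow>
     (\<forall>x. \<phi> differentiable (at x)) \<and> (\<forall>v. Ck k (\<lambda>x. frechet_derivative \<phi> (at x) v))"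

definition test_functions :: "'a::real_normed_vector set \<Rightarrow> ('a \<Rightarrow> real) set" where
  "test_functions D =
     {\<phi>. (\<forall>k. Ck k \<phi>) \<and> compact (closure {x. \<phi> x \<noteq> 0}) \<and> closure {x. \<phi> x \<noteq> 0} \<subseteq> D}"

subsection \<open>The fractional Laplacian\<close>

definition frac_const :: "nat \<Rightarrow> real \<Rightarrow> real" where
  "frac_const N \<alpha> =
     2 powr (\<alpha> - 2) * pi powr (- real N / 2) * \<alpha> * (2 - \<alpha>)
       * Gamma ((real N + \<alpha>) / 2) / Gamma (2 - \<alpha> / 2)"

text \<open>
  The value is meaningful only where the integrals and the limit exist (\<open>Lim\<close> and the Bochner
  integral are total); below it is applied only to test functions, for which they do everywhere.
\<close>

definition frac_laplacian :: "real \<Rightarrow> (real^'n \<Rightarrow> real) \<Rightarrow> real^'n \<Rightarrow> real" where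
  "frac_laplacian \<alpha> u x =
     frac_const CARD('n) \<alpha> *
       Lim (at_right 0)
         (\<lambda>\<epsilon>. LINT y:{y. \<epsilon> < norm (x - y)}|lborel.
            (u x - u y) / norm (x - y) powr (real CARD('n) + \<alpha>))"

text \<open>The action of the distribution \<open>(-\<Delta>)\<^sup>\<alpha>\<^sup>/\<^sup>2 u\<close> on the test function \<open>\<phi>\<close>.\<close>

definition frac_laplacian_distr :: "real \<Rightarrow> (real^'n \<Rightarrow> real) \<Rightarrow> (real^'n \<Rightarrow> real) \<Rightarrow> real" where
  "frac_laplacian_distr \<alpha> u \<phi> = (LINT x|lborel. u x * frac_laplacian \<alpha> \<phi> x)"

subsection \<open>Solutions\<close>

text \<open>
  Bounded continuous functions belong to the weighted space with weight
  \<open>(1 + \<bar>x\<bar>)\<^sup>-\<^sup>N\<^sup>-\<^sup>\<alpha>\<close>, so the distributional fractional Laplacian of a solution is defined.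
  The nonlinearity \<open>f\<close> is total here, but only its values on \<open>D0 - closure D1\<close> enter.
\<close>

definition solution ::
  "real \<Rightarrow> (real^'n) set \<Rightarrow> (real^'n) set \<Rightarrow> (real^'n \<Rightarrow> real \<Rightarrow> real) \<Rightarrow>
   (real^'n \<Rightarrow> real) \<Rightarrow> (real^'n \<Rightarrow> real) \<Rightarrow> (real^'n \<Rightarrow> real) \<Rightarrow> bool" where
  "solution \<alpha> D0 D1 f b0 b1 u \<longleftrightarrow>
     continuous_on UNIV u \<and> bounded (range u) \<and>
     (\<forall>x\<in>- D0. u x = b0 x) \<and> (\<forall>x\<in>closure D1. u x = b1 x) \<and>
     (\<forall>\<phi>\<in>test_functions (D0 - closure D1).
        - frac_laplacian_distr \<alpha> u \<phi> = (LINT x:D0 - closure D1|lborel. f x (u x) * \<phi> x))"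

subsection \<open>Conditions on the nonlinearity on \<open>\<Omega> \<times> [0,1]\<close>\<close>

definition F0 :: "'a::real_normed_vector set \<Rightarrow> ('a \<Rightarrow> real \<Rightarrow> real) \<Rightarrow> bool" where
  "F0 \<Omega> f \<longleftrightarrow>
     (\<lambda>(x, v). f x v) \<in> borel_measurable (restrict_space borel (\<Omega> \<times> {0..1})) \<and>
     bounded ((\<lambda>(x, v). f x v) ` (\<Omega> \<times> {0..1}))"

definition F1 :: "real \<Rightarrow> 'a::real_normed_vector set \<Rightarrow> ('a \<Rightarrow> real \<Rightarrow> real) \<Rightarrow> bool" where
  "F1 \<alpha> \<Omega> f \<longleftrightarrow>
     (\<forall>t\<ge>1. \<forall>x\<in>\<Omega>. \<forall>v\<in>{0..1}. t *\<^sub>R x \<in> \<Omega> \<longrightarrow> t powr \<alpha> * f (t *\<^sub>R x) v \<ge> f x v)"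

definition F2 :: "'a set \<Rightarrow> ('a \<Rightarrow> real \<Rightarrow> real) \<Rightarrow> bool" where
  "F2 \<Omega> f \<longleftrightarrow>
     (\<exists>C>0. \<forall>x\<in>\<Omega>. \<forall>v1\<in>{0..1}. \<forall>v2\<in>{0..1}. \<bar>f x v1 - f x v2\<bar> \<le> C * \<bar>v1 - v2\<bar>)"

definition F3 :: "'a set \<Rightarrow> ('a \<Rightarrow> real \<Rightarrow> real) \<Rightarrow> bool" where
  "F3 \<Omega> f \<longleftrightarrow>
     (\<forall>x\<in>\<Omega>. \<forall>v1\<in>{0..1}. \<forall>v2\<in>{0..1}. v1 < v2 \<longrightarrow> f x v1 \<le> f x v2)"

end

theory Submission
  imports Defs "HOL-Computational_Algebra.Polynomial"
begin

text \<open>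
  For \<open>t \<ge> 1\<close> the difference \<open>v\<^sub>t x = u (t x) - u x\<close> is nonpositive unless both \<open>x\<close> and \<open>t x\<close> lie in
  the ring, and there (F1) gives \<open>- (-\<Delta>)\<^sup>\<alpha>\<^sup>/\<^sup>2 v\<^sub>t \<ge> f (x, u (t x)) - f (x, u x)\<close>. What is needed is
  \<open>v\<^sub>t \<le> 0\<close>, with strict inequality in part (ii). Both follow from a maximum principle for continuous
  distributional subsolutions: if \<open>v \<le> M\<close> and \<open>v x1 \<ge> M - \<eta>\<close>, then the integral of \<open>M - v\<close> against
  \<open>\<bar>y - x1\<bar>\<^sup>-\<^sup>N\<^sup>-\<^sup>\<alpha>\<close> away from \<open>x1\<close> is at most a constant times \<open>\<eta>\<close>. To prove it, \<open>v\<close> is tested only with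
  explicit smooth bumps, which amounts to mollifying \<open>v\<close>; no regularity theory is required.
\<close>

subsection \<open>Smooth bump functions\<close>

text \<open>Where (F1) comes from: the fractional Laplacian of \<open>u (t x)\<close> is
  \<open>t powr \<alpha>\<close> times that of \<open>u\<close> at \<open>t x\<close>, so the
  dilated equation has right-hand side \<open>t powr \<alpha> * f (t x) (u (t x))\<close>, and (F1)
  compares it with \<open>f x (u (t x))\<close>. Two obstacles shape the argument. The Laplacian of
  \<open>u\<close> is only a distribution and cannot be evaluated at a maximum; kernels truncated at
  radius \<delta> give absolutely convergent integrals for every bounded measurable function, and
  the limit \<delta> to 0 is taken on the smooth bumps only. Secondly, the supremum of the
  difference need not be attained, and near-maximum points may escape to infinity; hence an estimate
  linear in the defect \<eta>, with a constant independent of the function, applied after rescaling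
  the near-maximum point to the unit sphere. Under (F3) the error term \<open>A\<close> is zero and
  survives this rescaling. Under (F2) alone it is not zero, but compactness supplies an exact
  touching point, the Lipschitz error is a multiple of \<eta>, and \<eta> can be sent to 0.\<close>

definition flat_exp :: "real poly \<Rightarrow> real \<Rightarrow> real" where
  "flat_exp p s = (if 0 < s then poly p (1/s) * exp (- (1/s)) else 0)"

lemma poly_times_exp_uminus_tendsto_0: "((\<lambda>x. poly p x * exp (- x)) \<longlongrightarrow> 0) at_top"
  for p :: "real poly"
proof -
  have "((\<lambda>x. \<Sum>i\<le>degree p. coeff p i * (x ^ i / exp x)) \<longlongrightarrow> (\<Sum>i\<le>degree p. coeff p i * 0)) at_top"
    by (intro tendsto_intros tendsto_power_div_exp_0)
  then show ?thesis
    by (simp add: poly_altdef sum_distrib_left exp_minus divide_inverse mult_ac)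
qed

lemma flat_exp_at_right_0: "((\<lambda>s. poly p (1/s) * exp (- (1/s))) \<longlongrightarrow> 0) (at_right 0)"
  for p :: "real poly"
proof -
  have "filterlim (\<lambda>s. 1/s::real) at_top (at_right 0)"
    using filterlim_inverse_at_top_right by (simp add: inverse_eq_divide)
  then show ?thesis
    by (rule filterlim_compose[OF poly_times_exp_uminus_tendsto_0])
qed

text \<open>With X = 1/s the chain rule gives X^2 (p - p') evaluated at 1/s, so the family is closed
  under differentiation. Only s = 0 needs a limit: for h > 0 the difference quotient there is
  \<open>flat_exp\<close> of X p, which tends to 0.\<close>

lemma has_real_derivative_flat_exp:
  "(flat_exp p has_real_derivative flat_exp ((p - pderiv p) * [:0, 0, 1:]) s) (at s)"
proof -
  consider "s > 0" | "s < 0" | "s = 0" by linarith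
  then show ?thesis
  proof cases
    case 1
    have "((\<lambda>s. poly p (1/s) * exp (- (1/s))) has_real_derivative
        flat_exp ((p - pderiv p) * [:0, 0, 1:]) s) (at s)"
      using 1 by (auto intro!: derivative_eq_intros simp: flat_exp_def field_simps power2_eq_square)
    then show ?thesis
      by (rule has_field_derivative_transform_within_open[where S="{0<..}"])
         (use 1 in \<open>auto simp: flat_exp_def\<close>)
  next
    case 2
    have "((\<lambda>s. 0) has_real_derivative flat_exp ((p - pderiv p) * [:0, 0, 1:]) s) (at s)"
      using 2 by (auto simp: flat_exp_def)
    then show ?thesis
      by (rule has_field_derivative_transform_within_open[where S="{..<0}"])
         (use 2 in \<open>auto simp: flat_exp_def\<close>)
  next
    case 3
    have "((\<lambda>h. flat_exp p h / h) \<longlongrightarrow> 0) (at_left 0)"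
      by (rule tendsto_eventually) (auto simp: eventually_at_left_field flat_exp_def intro!: exI[of _ "-1"])
    moreover have "((\<lambda>h. flat_exp p h / h) \<longlongrightarrow> 0) (at_right 0)"
      by (rule Lim_transform_eventually[OF flat_exp_at_right_0[of "p * [:0,1:]"]])
         (auto simp: eventually_at_right_field flat_exp_def intro!: exI[of _ 1])
    ultimately have "((\<lambda>h. flat_exp p h / h) \<longlongrightarrow> 0) (at 0)"
      using filterlim_split_at by blast
    then show ?thesis
      using 3 by (simp add: has_field_derivative_iff flat_exp_def)
  qed
qed

lemma continuous_on_flat_exp: "continuous_on A (flat_exp p)"
  by (meson DERIV_continuous_on DERIV_subset has_real_derivative_flat_exp subset_UNIV)

text \<open>The bound is stated for \<open>s \<le> 1\<close> because the arguments occurring below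
  have the form 1 minus a square.\<close>

lemma flat_exp_bounded_above: "\<exists>C>0. \<forall>s\<le>1. \<bar>flat_exp p s\<bar> \<le> C"
proof -
  have "compact (flat_exp p ` {0..1})"
    by (intro compact_continuous_image continuous_on_flat_exp compact_Icc)
  then obtain C where C: "\<And>s. s \<in> {0..1} \<Longrightarrow> \<bar>flat_exp p s\<bar> \<le> C"
    by (metis bounded_iff compact_imp_bounded imageI real_norm_def)
  have "\<bar>flat_exp p s\<bar> \<le> max C 1" if "s \<le> 1" for s
    using C[of s] that by (cases "s \<ge> 0") (auto simp: flat_exp_def)
  then show ?thesis
    by (intro exI[of _ "max C 1"]) auto
qed

text \<open>The standard mollifier exp(-1/(1 - |.|^2)), with \<open>1\<close> read as the constant
  polynomial. It is left unnormalised so that translations and dilations act only on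
  \<open>x0\<close> and \<open>r\<close>, without extra factors.\<close>

definition bump :: "'a::real_inner \<Rightarrow> real \<Rightarrow> 'a \<Rightarrow> real" where
  "bump x0 r y = flat_exp 1 (1 - (norm (y - x0) / r)\<^sup>2)"

lemma bump_nonneg [simp]: "0 \<le> bump x0 r y"
  by (simp add: bump_def flat_exp_def)

lemma bump_le_1: "bump x0 r y \<le> 1"
  by (simp add: bump_def flat_exp_def)

lemma bump_le_center: "bump x0 r y \<le> exp (-1)"
proof (cases "0 < 1 - (norm (y - x0) / r)\<^sup>2")
  case True
  then have "1 \<le> 1 / (1 - (norm (y - x0) / r)\<^sup>2)"
    by (simp add: field_simps)
  with True show ?thesis
    by (simp add: bump_def flat_exp_def)
qed (simp add: bump_def flat_exp_def)

lemma bump_center [simp]: "bump x0 r x0 = exp (-1)"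
  by (simp add: bump_def flat_exp_def)

lemma bump_pos_iff: "0 < bump x0 r y \<longleftrightarrow> norm (y - x0) < r" if "0 < r"
proof -
  have "(norm (y - x0) / r)\<^sup>2 < 1 \<longleftrightarrow> norm (y - x0) < r"
    using that by (simp add: power_less_one_iff abs_square_less_1)
  then show ?thesis
    by (simp add: bump_def flat_exp_def)
qed

lemma bump_eq_0: "bump x0 r y = 0" if "0 < r" "r \<le> norm (y - x0)"
  using bump_pos_iff[OF that(1), of x0 y] bump_nonneg[of x0 r y] that(2) by linarith

lemma bump_scaleR: "bump x0 r y = bump (t *\<^sub>R x0) (t * r) (t *\<^sub>R y)" if "t > 0"
  using that by (simp add: bump_def flip: scaleR_diff_right)

lemma continuous_on_bump: "continuous_on A (bump x0 r)"
proof -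
  have "continuous_on A (\<lambda>y. 1 - (norm (y - x0) * inverse r)\<^sup>2)"
    by (intro continuous_intros continuous_on_mult_right)
  then show ?thesis
    unfolding bump_def divide_inverse
    by (rule continuous_on_compose2[OF continuous_on_flat_exp[of UNIV]]) auto
qed

text \<open>Closed under directional derivatives, so all its members are smooth.\<close>

inductive bump_class :: "'a::real_inner \<Rightarrow> real \<Rightarrow> ('a \<Rightarrow> real) \<Rightarrow> bool" for x0 r where
  flat: "bump_class x0 r (\<lambda>y. flat_exp p (1 - (norm (y - x0) / r)\<^sup>2))"
| inner: "bump_class x0 r F \<Longrightarrow> bump_class x0 r (\<lambda>y. ((y - x0) \<bullet> v) * F y)"
| scale: "bump_class x0 r F \<Longrightarrow> bump_class x0 r (\<lambda>y. c * F y)"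
| add: "bump_class x0 r F \<Longrightarrow> bump_class x0 r G \<Longrightarrow> bump_class x0 r (\<lambda>y. F y + G y)"

text \<open>The induction has to deliver membership of every directional derivative along with the
  derivative itself, since \<open>Ck\<close> recurses through directional derivatives.\<close>

lemma bump_class_has_derivative:
  assumes "bump_class x0 r F"
  shows "\<exists>F'. (\<forall>y. (F has_derivative F' y) (at y)) \<and> (\<forall>w. bump_class x0 r (\<lambda>y. F' y w))"
  using assms
proof induction
  case (flat p)
  let ?q = "(p - pderiv p) * [:0, 0, 1:]"
  have q: "((\<lambda>y. 1 - (norm (y - x0) / r)\<^sup>2) has_derivative (\<lambda>w. - 2 / r\<^sup>2 * ((y - x0) \<bullet> w))) (at y)" for y
  proof -
    have "((\<lambda>y. 1 - ((y - x0) \<bullet> (y - x0)) * inverse (r\<^sup>2)) has_derivative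
        (\<lambda>w. 0 - ((y - x0) \<bullet> w + w \<bullet> (y - x0)) * inverse (r\<^sup>2))) (at y)"
      by (rule derivative_eq_intros refl | simp)+
    then show ?thesis
      by (simp add: power_divide power2_norm_eq_inner divide_inverse inner_commute
          power_mult_distrib power_inverse mult_ac)
  qed
  have "((\<lambda>y. flat_exp p (1 - (norm (y - x0) / r)\<^sup>2)) has_derivative
      (\<lambda>w. flat_exp ?q (1 - (norm (y - x0) / r)\<^sup>2) * (- 2 / r\<^sup>2 * ((y - x0) \<bullet> w)))) (at y)" for y
    using has_derivative_compose[OF q[of y], of "flat_exp p",
        OF has_real_derivative_flat_exp[unfolded has_field_derivative_def]] by simp
  moreover have "bump_class x0 r (\<lambda>y. flat_exp ?q (1 - (norm (y - x0) / r)\<^sup>2) * (- 2 / r\<^sup>2 * ((y - x0) \<bullet> w)))" for w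
  proof -
    have "bump_class x0 r (\<lambda>y. (- 2 / r\<^sup>2) * (((y - x0) \<bullet> w) * flat_exp ?q (1 - (norm (y - x0) / r)\<^sup>2)))"
      by (intro bump_class.intros)
    then show ?thesis by (simp only: mult_ac)
  qed
  ultimately show ?case
    by (intro exI[of _ "\<lambda>y w. flat_exp ?q (1 - (norm (y - x0) / r)\<^sup>2) * (- 2 / r\<^sup>2 * ((y - x0) \<bullet> w))"]) auto
next
  case (inner F v)
  then obtain F' where F': "\<And>y. (F has_derivative F' y) (at y)" "\<And>w. bump_class x0 r (\<lambda>y. F' y w)"
    by blast
  have "((\<lambda>y. ((y - x0) \<bullet> v) * F y) has_derivative (\<lambda>w. ((y - x0) \<bullet> v) * F' y w + (w \<bullet> v) * F y)) (at y)" for y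
    by (rule derivative_eq_intros F' refl | simp)+
  moreover have "bump_class x0 r (\<lambda>y. ((y - x0) \<bullet> v) * F' y w + (w \<bullet> v) * F y)" for w
    by (intro bump_class.intros F' inner)
  ultimately show ?case
    by (intro exI[of _ "\<lambda>y w. ((y - x0) \<bullet> v) * F' y w + (w \<bullet> v) * F y"]) auto
next
  case (scale F c)
  then obtain F' where F': "\<And>y. (F has_derivative F' y) (at y)" "\<And>w. bump_class x0 r (\<lambda>y. F' y w)"
    by blast
  then show ?case
    by (intro exI[of _ "\<lambda>y w. c * F' y w"])
       (auto intro!: bump_class.intros has_derivative_mult_right)
next
  case (add F G)
  then obtain F' G' where "\<And>y. (F has_derivative F' y) (at y)" "\<And>w. bump_class x0 r (\<lambda>y. F' y w)"
    "\<And>y. (G has_derivative G' y) (at y)" "\<And>w. bump_class x0 r (\<lambda>y. G' y w)"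
    by blast
  then show ?case
    by (intro exI[of _ "\<lambda>y w. F' y w + G' y w"])
       (auto intro!: bump_class.intros has_derivative_add)
qed

lemma Ck_bump_class: "bump_class x0 r F \<Longrightarrow> Ck k F"
proof (induction k arbitrary: F)
  case 0
  then show ?case
    using bump_class_has_derivative has_derivative_continuous
    by (fastforce intro!: continuous_at_imp_continuous_on)
next
  case (Suc k)
  then obtain F' where F': "\<And>y. (F has_derivative F' y) (at y)" "\<And>w. bump_class x0 r (\<lambda>y. F' y w)"
    using bump_class_has_derivative by blast
  then have "frechet_derivative F (at y) = F' y" for y
    by (metis frechet_derivative_at)
  with F' Suc.IH show ?case
    by (auto simp: differentiable_def)
qed

text \<open>The support is the closure of the open ball on which the bump is positive, which is why
  the closed ball must lie in \<open>D\<close>.\<close>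

lemma bump_test_function:
  fixes x0 :: "'a::euclidean_space"
  assumes "0 < r" "cball x0 r \<subseteq> D"
  shows "bump x0 r \<in> test_functions D"
proof -
  have "{y. bump x0 r y \<noteq> 0} = ball x0 r"
    using bump_pos_iff[OF assms(1), of x0] bump_nonneg[of x0 r]
    by (force simp: dist_norm norm_minus_commute less_le)
  moreover have "bump_class x0 r (bump x0 r)"
    unfolding bump_def by (rule bump_class.flat)
  ultimately show ?thesis
    using assms Ck_bump_class by (auto simp: test_functions_def)
qed

section \<open>Second differences of bumps\<close>

lemma symmetric_difference_le_of_second_derivative_bound:
  fixes F :: "real \<Rightarrow> real"
  assumes "\<And>s. (F has_real_derivative F' s) (at s)" "\<And>s. (F' has_real_derivative F'' s) (at s)"
    and "\<And>s. \<bar>F'' s\<bar> \<le> K"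
  shows "\<bar>F 1 + F (-1) - 2 * F 0\<bar> \<le> 2 * K"
proof -
  \<comment> \<open>The mean value theorem is used twice: for \<open>F s + F (-s)\<close> on [0, 1],
    then for \<open>F'\<close> on [-z, z], an interval of length at most 2.\<close>
  have "\<exists>z. 0 < z \<and> z < 1 \<and> (F 1 + F (-1)) - (F 0 + F (-0)) = (1 - 0) * (F' z - F' (-z))"
    by (rule MVT2[of 0 1 "\<lambda>s. F s + F (-s)" "\<lambda>s. F' s - F' (-s)"])
       (auto intro!: derivative_eq_intros assms DERIV_chain2[of F "F' (- s)" "\<lambda>s. -s" s for s])
  then obtain z where z: "0 < z" "z < 1" "F 1 + F (-1) - 2 * F 0 = F' z - F' (-z)"
    by auto
  obtain w where w: "F' z - F' (-z) = (z - (-z)) * F'' w"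
    using MVT2[of "-z" z F' F''] z assms by force
  have "\<bar>2 * z * F'' w\<bar> \<le> 2 * K"
    using mult_mono[of "2*z" 2 "\<bar>F'' w\<bar>" K] z assms(3)[of w] by (simp add: abs_mult)
  then show ?thesis
    using z w by simp
qed

text \<open>Along the line \<open>x + s z\<close> the bump is \<open>flat_exp 1\<close> of a
  quadratic \<open>q\<close>, so its second derivative in \<open>s\<close> is explicit;
  \<open>p1\<close> and \<open>p2\<close> are the polynomials of the first two derivatives of
  \<open>flat_exp 1\<close>. The bound is uniform in \<open>x\<close>, as needed under the integral
  sign.\<close>

lemma bump_symmetric_difference_bound:
  assumes "0 < r"
  shows "\<exists>C>0. \<forall>x z::'a::real_inner. \<bar>bump x0 r (x + z) + bump x0 r (x - z) - 2 * bump x0 r x\<bar> \<le> C * (norm z)\<^sup>2"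
proof -
  define p1 :: "real poly" where "p1 = (1 - pderiv 1) * [:0, 0, 1:]"
  define p2 where "p2 = (p1 - pderiv p1) * [:0, 0, 1:]"
  obtain C1 C2 where C: "C1 > 0" "C2 > 0" "\<And>s. s \<le> 1 \<Longrightarrow> \<bar>flat_exp p1 s\<bar> \<le> C1"
      "\<And>s. s \<le> 1 \<Longrightarrow> \<bar>flat_exp p2 s\<bar> \<le> C2"
    using flat_exp_bounded_above by metis
  define K where "K = C2 * 4 / r\<^sup>2 + C1 * 2 / r\<^sup>2"
  have "\<bar>bump x0 r (x + z) + bump x0 r (x - z) - 2 * bump x0 r x\<bar> \<le> 2 * K * (norm z)\<^sup>2" for x z :: 'a
  proof -
    define q where "q s = 1 - (norm (x + s *\<^sub>R z - x0) / r)\<^sup>2" for s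
    define q' where "q' s = - 2 / r\<^sup>2 * ((x + s *\<^sub>R z - x0) \<bullet> z)" for s
    have q: "(q has_real_derivative q' s) (at s)" for s
    proof -
      have "q = (\<lambda>s. 1 - ((x - x0) \<bullet> (x - x0) + 2 * s * ((x - x0) \<bullet> z) + s\<^sup>2 * (z \<bullet> z)) / r\<^sup>2)"
        unfolding q_def power_divide power2_norm_eq_inner
        by (auto simp: algebra_simps inner_commute power2_eq_square)
      then show ?thesis
        using assms by (auto intro!: derivative_eq_intros simp: q'_def algebra_simps divide_simps)
    qed
    have q': "(q' has_real_derivative - 2 / r\<^sup>2 * (z \<bullet> z)) (at s)" for s
    proof -
      have "q' s = - 2 / r\<^sup>2 * ((x - x0) \<bullet> z) + s * (- 2 / r\<^sup>2 * (z \<bullet> z))" for s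
        unfolding q'_def by (simp add: inner_add_left inner_diff_left distrib_left diff_divide_distrib add_divide_distrib right_diff_distrib mult_ac)
      from ext[of q', OF this] show ?thesis
        by (simp only:) (rule derivative_eq_intros refl | simp)+
    qed
    have d1: "((\<lambda>s. flat_exp 1 (q s)) has_real_derivative flat_exp p1 (q s) * q' s) (at s)" for s
      unfolding p1_def by (rule DERIV_chain2[OF has_real_derivative_flat_exp q])
    have d2: "((\<lambda>s. flat_exp p1 (q s) * q' s) has_real_derivative
        flat_exp p2 (q s) * (q' s)\<^sup>2 + flat_exp p1 (q s) * (- 2 / r\<^sup>2 * (z \<bullet> z))) (at s)" for s
      unfolding p2_def
      by (rule derivative_eq_intros DERIV_chain2[OF has_real_derivative_flat_exp q] q' refl
          | simp add: power2_eq_square)+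
    have le: "\<bar>flat_exp p2 (q s) * (q' s)\<^sup>2 + flat_exp p1 (q s) * (- 2 / r\<^sup>2 * (z \<bullet> z))\<bar> \<le> K * (norm z)\<^sup>2" for s
    proof -
      have q1: "q s \<le> 1" by (simp add: q_def)
      \<comment> \<open>By itself \<open>q'\<close> is unbounded in \<open>s\<close>. Where the
        factor \<open>flat_exp p2 (q s)\<close> does not vanish, the point lies within
        \<open>r\<close> of \<open>x0\<close>, and Cauchy-Schwarz bounds \<open>q'\<close> by 2 |z|
        / r.\<close>
      have "\<bar>flat_exp p2 (q s) * (q' s)\<^sup>2\<bar> \<le> C2 * 4 / r\<^sup>2 * (norm z)\<^sup>2"
      proof (cases "0 < q s")
        case True
        then have "(norm (x + s *\<^sub>R z - x0) / r)\<^sup>2 < 1"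
          by (simp add: q_def)
        then have "(norm (x + s *\<^sub>R z - x0))\<^sup>2 < r\<^sup>2"
          using assms by (simp add: power_divide divide_simps)
        then have n: "(norm (x + s *\<^sub>R z - x0))\<^sup>2 \<le> r\<^sup>2"
          by (rule less_imp_le)
        have "(q' s)\<^sup>2 = 4 / r^4 * ((x + s *\<^sub>R z - x0) \<bullet> z)\<^sup>2"
          by (simp add: q'_def power_divide power_mult_distrib flip: power_mult)
        also have "\<dots> \<le> 4 / r^4 * ((norm (x + s *\<^sub>R z - x0))\<^sup>2 * (norm z)\<^sup>2)"
          by (intro mult_left_mono) (simp_all add: Cauchy_Schwarz_ineq power2_norm_eq_inner)
        also have "\<dots> \<le> 4 / r^4 * (r\<^sup>2 * (norm z)\<^sup>2)"
          using n by (intro mult_left_mono mult_right_mono) simp_all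
        also have "\<dots> = 4 / r\<^sup>2 * (norm z)\<^sup>2"
          using assms by (simp add: field_simps power2_eq_square power4_eq_xxxx)
        finally have "\<bar>flat_exp p2 (q s)\<bar> * (q' s)\<^sup>2 \<le> C2 * (4 / r\<^sup>2 * (norm z)\<^sup>2)"
          using C q1 by (intro mult_mono) auto
        then show ?thesis by (simp add: abs_mult)
      next
        case False
        then show ?thesis using C by (simp add: flat_exp_def)
      qed
      moreover have "\<bar>flat_exp p1 (q s) * (- 2 / r\<^sup>2 * (z \<bullet> z))\<bar> \<le> C1 * 2 / r\<^sup>2 * (norm z)\<^sup>2"
        using mult_right_mono[OF C(3)[OF q1], of "z \<bullet> z"] assms
        by (simp add: abs_mult power2_norm_eq_inner field_simps)
      ultimately show ?thesis
        unfolding K_def distrib_right by linarith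
    qed
    have eq: "flat_exp 1 (q s) = bump x0 r (x + s *\<^sub>R z)" for s
      by (simp add: q_def bump_def)
    show ?thesis
      using symmetric_difference_le_of_second_derivative_bound[OF d1 d2 le] by (simp add: eq mult.assoc)
  qed
  moreover have "0 < 2 * K"
    using C assms by (simp add: K_def add_pos_pos)
  ultimately show ?thesis by blast
qed

subsection \<open>The kernel\<close>

lemma lborel_integral_affine:
  fixes f :: "'a::euclidean_space \<Rightarrow> real"
  assumes "c \<noteq> 0" and [measurable]: "f \<in> borel_measurable borel"
  shows "integral\<^sup>L lborel f = \<bar>c\<bar> ^ DIM('a) * (\<integral>x. f (t + c *\<^sub>R x) \<partial>lborel)"
  by (subst lborel_affine[OF assms(1), of t]) (simp add: integral_density integral_distr)

lemma lborel_integrable_affine: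
  fixes f :: "'a::euclidean_space \<Rightarrow> real"
  assumes "c \<noteq> 0" "integrable lborel f"
  shows "integrable lborel (\<lambda>x. f (t + c *\<^sub>R x))"
proof -
  have [measurable]: "f \<in> borel_measurable borel"
    using assms(2) by auto
  have "integrable (density (distr lborel borel (\<lambda>x. t + c *\<^sub>R x)) (\<lambda>_. \<bar>c\<bar>^DIM('a))) f"
    using assms(2) by (subst (asm) lborel_affine[OF assms(1), of t])
  then show ?thesis
    using assms(1) by (simp add: integrable_density integrable_distr_eq)
qed

lemma lborel_integral_translate:
  fixes f :: "'a::euclidean_space \<Rightarrow> real"
  assumes "f \<in> borel_measurable borel"
  shows "(\<integral>x. f (t + x) \<partial>lborel) = integral\<^sup>L lborel f"
  using lborel_integral_affine[of 1 f t] assms by simp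

lemma lborel_integrable_translate:
  fixes f :: "'a::euclidean_space \<Rightarrow> real"
  assumes "integrable lborel f"
  shows "integrable lborel (\<lambda>x. f (t + x))"
  using lborel_integrable_affine[of 1 f t] assms by simp

lemma lborel_integral_uminus:
  fixes f :: "'a::euclidean_space \<Rightarrow> real"
  assumes "f \<in> borel_measurable borel"
  shows "(\<integral>x. f (- x) \<partial>lborel) = integral\<^sup>L lborel f"
  using lborel_integral_affine[of "-1" f 0] assms by simp

lemma lborel_integrable_uminus:
  fixes f :: "'a::euclidean_space \<Rightarrow> real"
  assumes "integrable lborel f"
  shows "integrable lborel (\<lambda>x. f (- x))"
  using lborel_integrable_affine[of "-1" f 0] assms by simp

text \<open>At \<open>z = 0\<close> the value is 0, by the conventions for \<open>powr\<close> and
  for division.\<close>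

definition kern :: "real \<Rightarrow> 'a::euclidean_space \<Rightarrow> real" where
  "kern \<alpha> z = 1 / norm z powr (real DIM('a) + \<alpha>)"

lemma kern_nonneg [simp]: "0 \<le> kern \<alpha> z"
  by (simp add: kern_def)

lemma kern_pos: "z \<noteq> 0 \<Longrightarrow> 0 < kern \<alpha> z"
  by (simp add: kern_def)

lemma kern_uminus [simp]: "kern \<alpha> (- z) = kern \<alpha> z"
  by (simp add: kern_def)

lemma kern_measurable [measurable]: "kern \<alpha> \<in> borel_measurable borel"
  unfolding kern_def by measurable

text \<open>The two factors play separate roles: \<open>t ^ DIM('a)\<close> cancels against the
  Jacobian of a dilation, while \<open>t powr \<alpha>\<close> remains as the order of the
  operator.\<close>

lemma kern_scaleR: "0 < t \<Longrightarrow> kern \<alpha> (t *\<^sub>R z) = kern \<alpha> z / (t ^ DIM('a) * t powr \<alpha>)"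
  for z :: "'a::euclidean_space"
  by (simp add: kern_def powr_mult powr_add powr_realpow)

lemma kern_antimono: "0 < norm z \<Longrightarrow> norm z \<le> norm w \<Longrightarrow> 0 < \<alpha> \<Longrightarrow> kern \<alpha> w \<le> kern \<alpha> z"
  for z w :: "'a::euclidean_space"
  unfolding kern_def by (intro divide_left_mono powr_mono2 mult_pos_pos) auto

lemma kern_eq: "z \<noteq> 0 \<Longrightarrow> kern \<alpha> z = 1 / (norm z ^ DIM('a) * norm z powr \<alpha>)"
  for z :: "'a::euclidean_space"
  by (simp add: kern_def powr_add powr_realpow)

section \<open>Integrability of the kernel by dyadic shells\<close>

lemma powr_of_power: "0 < x \<Longrightarrow> (x ^ k) powr s = (x powr s) ^ k" for x s :: real
  by (subst powr_power) (simp_all add: powr_powr flip: powr_realpow)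

lemma real_dyadic_interval:
  fixes x :: real
  assumes "1 \<le> x"
  shows "\<exists>k::nat. 2 ^ k \<le> x \<and> x < 2 ^ Suc k"
proof -
  define n where "n = (LEAST n. x < 2 ^ n)"
  have n: "x < 2 ^ n"
    unfolding n_def using real_arch_pow[of 2 x] by (auto intro: LeastI_ex)
  with assms obtain k where k: "n = Suc k"
    by (cases n) auto
  then have "\<not> x < 2 ^ k"
    unfolding n_def using not_less_Least by (metis lessI)
  with n k show ?thesis by (intro exI[of _ k]) simp
qed

text \<open>On the shell 2^k \<le> |z| < 2^(k+1) the integrand is at most \<open>a k\<close>, and on
  the reciprocal shell near 0 at most \<open>b k\<close>. Enlarging shells to balls costs only
  constants: the k-th terms integrate to multiples of \<open>q ^ k\<close> and \<open>p ^ k\<close>.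
  The series converge because \<alpha> > 0 at infinity and \<alpha> < 2 at the origin.\<close>

lemma integrable_min_sq_kern:
  assumes "0 < \<alpha>" "\<alpha> < 2"
  shows "integrable lborel (\<lambda>z::'a::euclidean_space. min 1 ((norm z)\<^sup>2) * kern \<alpha> z)"
proof -
  let ?d = "DIM('a)"
  define V where "V = unit_ball_vol (real ?d)"
  have V: "0 \<le> V" by (simp add: V_def)
  define p q where "p = 2 powr - (2 - \<alpha>)" and "q = 2 powr - \<alpha>"
  have pq: "0 \<le> p" "p < 1" "0 \<le> q" "q < 1"
    using assms by (auto simp: p_def q_def powr_less_one)
  define a where "a k = q ^ k / (2 ^ k) ^ ?d" for k :: nat
  define b where "b k = p ^ k * (2 ^ Suc k) ^ ?d" for k :: nat
  have ab: "0 \<le> a k" "0 \<le> b k" for k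
    using pq by (auto simp: a_def b_def)
  let ?g = "\<lambda>k z::'a. ennreal (a k) * indicator (cball 0 (2 ^ Suc k)) z
     + ennreal (b k) * indicator (cball 0 (1 / 2 ^ k)) z"
  have le: "ennreal (min 1 ((norm z)\<^sup>2) * kern \<alpha> z) \<le> (\<Sum>k. ?g k z)" for z :: 'a
  proof -
    have "\<exists>k. ennreal (min 1 ((norm z)\<^sup>2) * kern \<alpha> z) \<le> ?g k z"
    proof -
      consider "z = 0" | "1 \<le> norm z" | "z \<noteq> 0" "norm z < 1" by fastforce
      then show ?thesis
      proof cases
        case 2
        then obtain k where k: "2 ^ k \<le> norm z" "norm z < 2 ^ Suc k"
          using real_dyadic_interval by blast
        have "(2 powr \<alpha>) ^ k = (2 ^ k) powr \<alpha>"
          by (simp add: powr_of_power)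
        also have "\<dots> \<le> norm z powr \<alpha>"
          using k assms by (intro powr_mono2) auto
        finally have "(2 ^ k) ^ ?d * (2 powr \<alpha>) ^ k \<le> norm z ^ ?d * norm z powr \<alpha>"
          using k by (intro mult_mono power_mono) auto
        moreover have "0 < norm z" using 2 by linarith
        ultimately have "kern \<alpha> z \<le> 1 / ((2 ^ k) ^ ?d * (2 powr \<alpha>) ^ k)"
          by (subst kern_eq) (auto intro!: divide_left_mono mult_pos_pos)
        also have "\<dots> = a k"
          by (simp add: a_def q_def powr_minus field_simps)
        finally have "min 1 ((norm z)\<^sup>2) * kern \<alpha> z \<le> 1 * a k"
          by (intro mult_mono) (auto simp: ab)
        with k show ?thesis
          by (intro exI[of _ k]) (simp add: ennreal_leI add_increasing2)
      next
        case 3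
        then obtain k where k: "2 ^ k \<le> 1 / norm z" "1 / norm z < 2 ^ Suc k"
          using real_dyadic_interval[of "1 / norm z"] by auto
        have kz: "norm z \<le> 1 / 2 ^ k"
          using k 3 by (simp add: field_simps)
        have "(norm z)\<^sup>2 * kern \<alpha> z = norm z powr (2 - \<alpha>) * (1 / norm z) ^ ?d"
          using 3 by (simp add: kern_eq powr_diff power_divide flip: powr_numeral)
        also have "\<dots> \<le> (1 / 2 ^ k) powr (2 - \<alpha>) * (2 ^ Suc k) ^ ?d"
          using k kz assms by (intro mult_mono powr_mono2 power_mono) auto
        also have "(1 / 2 ^ k) powr (2 - \<alpha>) = p ^ k"
          unfolding p_def powr_minus power_inverse
          by (simp add: powr_divide powr_of_power inverse_eq_divide)
        finally have "min 1 ((norm z)\<^sup>2) * kern \<alpha> z \<le> b k"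
          unfolding b_def by (smt (verit) kern_nonneg mult_right_mono min_le_iff_disj)
        with kz show ?thesis
          by (intro exI[of _ k]) (simp add: ennreal_leI add_increasing)
      qed auto
    qed
    then obtain k where "ennreal (min 1 ((norm z)\<^sup>2) * kern \<alpha> z) \<le> ?g k z" by blast
    also have "?g k z \<le> (\<Sum>k. ?g k z)"
      using sum_le_suminf[of "\<lambda>k. ?g k z" "{k}"] by simp
    finally show ?thesis .
  qed
  have [measurable]: "cball (0::'a) s \<in> sets borel" for s
    by (simp add: borel_closed)
  have "(\<integral>\<^sup>+z. ennreal (min 1 ((norm z)\<^sup>2) * kern \<alpha> (z::'a)) \<partial>lborel) \<le> (\<integral>\<^sup>+z. (\<Sum>k. ?g k z) \<partial>lborel)"
    by (intro nn_integral_mono le)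
  also have "\<dots> = (\<Sum>k. \<integral>\<^sup>+z. ?g k z \<partial>lborel)"
  proof (rule nn_integral_suminf)
    show "?g k \<in> borel_measurable lborel" for k
      by measurable
  qed
  also have "\<dots> = (\<Sum>k. ennreal (V * 2 ^ ?d * (q ^ k + p ^ k)))"
  proof (rule suminf_cong)
    fix k
    have "(\<integral>\<^sup>+z. ?g k z \<partial>lborel) = ennreal (a k) * emeasure lborel (cball (0::'a) (2 ^ Suc k))
        + ennreal (b k) * emeasure lborel (cball (0::'a) (1 / 2 ^ k))"
      by (subst nn_integral_add) (auto simp: nn_integral_cmult_indicator)
    also have "\<dots> = ennreal (a k * (V * (2 ^ Suc k) ^ ?d) + b k * (V * (1 / 2 ^ k) ^ ?d))"
      using ab V by (subst ennreal_plus) (auto simp: emeasure_cball V_def ennreal_mult)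
    also have "a k * (V * (2 ^ Suc k) ^ ?d) + b k * (V * (1 / 2 ^ k) ^ ?d) = V * 2 ^ ?d * (q ^ k + p ^ k)"
      by (simp add: a_def b_def power_mult_distrib power_divide field_simps)
    finally show "(\<integral>\<^sup>+z. ?g k z \<partial>lborel) = ennreal (V * 2 ^ ?d * (q ^ k + p ^ k))" .
  qed
  also have "\<dots> < \<infinity>"
  proof -
    have "summable (\<lambda>k. V * 2 ^ ?d * (q ^ k + p ^ k))"
      using pq by (intro summable_mult summable_add summable_geometric) auto
    then show ?thesis
      using V pq by (simp add: ennreal_suminf_neq_top less_top)
  qed
  finally show ?thesis
    by (intro integrableI_bounded) auto
qed

subsection \<open>The truncated fractional Laplacian\<close>

definition tkern :: "real \<Rightarrow> real \<Rightarrow> 'a::euclidean_space \<Rightarrow> real" where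
  "tkern \<alpha> \<delta> z = indicator {z. \<delta> < norm z} z * kern \<alpha> z"

text \<open>The sign is that of the negative operator -(-Laplacian)^(\<alpha>/2), so the truncation
  is nonpositive at a global maximum of a bounded measurable function. The normalising constant is
  omitted; it returns in \<open>frac_laplacian_bump\<close>.\<close>

definition trunc_lap :: "real \<Rightarrow> real \<Rightarrow> ('a::euclidean_space \<Rightarrow> real) \<Rightarrow> 'a \<Rightarrow> real" where
  "trunc_lap \<alpha> \<delta> v x = (\<integral>z. tkern \<alpha> \<delta> z * (v (x + z) - v x) \<partial>lborel)"

lemma tkern_nonneg [simp]: "0 \<le> tkern \<alpha> \<delta> z"
  by (simp add: tkern_def)

lemma tkern_uminus [simp]: "tkern \<alpha> \<delta> (- z) = tkern \<alpha> \<delta> z"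
  by (simp add: tkern_def indicator_def)

lemma tkern_measurable [measurable]: "tkern \<alpha> \<delta> \<in> borel_measurable borel"
  unfolding tkern_def by measurable

lemma tkern_scaleR: "0 < t \<Longrightarrow> tkern \<alpha> (t * \<delta>) (t *\<^sub>R z) = tkern \<alpha> \<delta> z / (t ^ DIM('a) * t powr \<alpha>)"
  for z :: "'a::euclidean_space"
  by (simp add: tkern_def kern_scaleR indicator_def)

lemma integrable_tkern:
  assumes "0 < \<alpha>" "\<alpha> < 2" "0 < \<delta>"
  shows "integrable lborel (tkern \<alpha> \<delta> :: 'a::euclidean_space \<Rightarrow> real)"
proof (rule Bochner_Integration.integrable_bound)
  show "integrable lborel (\<lambda>z::'a. 1 / min 1 (\<delta>\<^sup>2) * (min 1 ((norm z)\<^sup>2) * kern \<alpha> z))"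
    by (intro integrable_mult_right integrable_min_sq_kern assms)
  have "tkern \<alpha> \<delta> z \<le> 1 / min 1 (\<delta>\<^sup>2) * (min 1 ((norm z)\<^sup>2) * kern \<alpha> z)" for z :: 'a
  proof (cases "\<delta> < norm z")
    case True
    then have "min 1 (\<delta>\<^sup>2) \<le> min 1 ((norm z)\<^sup>2)"
      using assms(3) by (intro min.mono power_mono) auto
    then have "1 \<le> 1 / min 1 (\<delta>\<^sup>2) * min 1 ((norm z)\<^sup>2)"
      using assms(3) by (simp add: field_simps)
    then have "1 * kern \<alpha> z \<le> 1 / min 1 (\<delta>\<^sup>2) * min 1 ((norm z)\<^sup>2) * kern \<alpha> z"
      by (intro mult_right_mono) auto
    with True show ?thesis by (simp add: tkern_def)
  qed (auto simp: tkern_def)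
  then show "AE z in lborel. norm (tkern \<alpha> \<delta> (z::'a)) \<le> norm (1 / min 1 (\<delta>\<^sup>2) * (min 1 ((norm z)\<^sup>2) * kern \<alpha> z))"
    by (intro AE_I2) (smt (verit) real_norm_def tkern_nonneg)
qed auto

section \<open>Integration against bounded weights\<close>

lemma abs_mult_le_of_abs_le: "\<bar>b\<bar> \<le> B \<Longrightarrow> \<bar>a * b\<bar> \<le> B * \<bar>a\<bar>" for a b B :: real
  by (metis abs_ge_zero abs_mult mult.commute mult_right_mono)

lemma integrable_mult_bounded:
  fixes f g :: "'a \<Rightarrow> real"
  assumes "integrable M f" "g \<in> borel_measurable M" "\<And>x. \<bar>g x\<bar> \<le> B"
  shows "integrable M (\<lambda>x. f x * g x)"
proof (rule Bochner_Integration.integrable_bound[of M "\<lambda>x. B * f x"])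
  show "AE x in M. norm (f x * g x) \<le> norm (B * f x)"
  proof (intro AE_I2)
    fix x
    have "\<bar>f x\<bar> * \<bar>g x\<bar> \<le> \<bar>f x\<bar> * \<bar>B\<bar>"
      using assms(3)[of x] by (intro mult_left_mono) auto
    then show "norm (f x * g x) \<le> norm (B * f x)"
      by (simp add: abs_mult mult.commute)
  qed
qed (use assms in auto)

lemma bump_measurable [measurable]: "bump x0 r \<in> borel_measurable borel"
  for x0 :: "'a::euclidean_space"
  by (intro borel_measurable_continuous_onI continuous_on_bump)

lemma integrable_bump: "integrable lborel (bump x0 r :: 'a::euclidean_space \<Rightarrow> real)" if "0 < r"
proof (rule Bochner_Integration.integrable_bound[of _ "\<lambda>y. indicator (cball x0 r) y"])
  show "integrable lborel (indicator (cball x0 r) :: 'a \<Rightarrow> real)"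
    by (rule integrable_real_indicator) (use emeasure_lborel_cball_finite in \<open>auto simp: borel_closed\<close>)
  show "bump x0 r \<in> borel_measurable lborel"
    by simp
  show "AE y in lborel. norm (bump x0 r y) \<le> norm (indicator (cball x0 r) y :: real)"
    using bump_eq_0[OF that, of _ x0] bump_le_1[of x0 r]
    by (intro AE_I2) (auto simp: indicator_def dist_norm norm_minus_commute)
qed

text \<open>Interchange with a factor coupling both variables: the product of two integrable
  functions dominates, and boundedness of \<open>g\<close> is all that is asked of the
  coupling.\<close>

lemma Fubini_bounded_weight:
  fixes f :: "'a::euclidean_space \<Rightarrow> real" and k :: "'b::euclidean_space \<Rightarrow> real"
  assumes f: "integrable lborel f" and k: "integrable lborel k"
    and g [measurable]: "(\<lambda>(x, z). g x z) \<in> borel_measurable (borel \<Otimes>\<^sub>M borel)"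
    and B: "\<And>x z. \<bar>g x z\<bar> \<le> B"
  shows "(\<integral>x. f x * (\<integral>z. k z * g x z \<partial>lborel) \<partial>lborel) = (\<integral>z. k z * (\<integral>x. f x * g x z \<partial>lborel) \<partial>lborel)"
proof -
  have [measurable]: "f \<in> borel_measurable borel" "k \<in> borel_measurable borel"
    using f k by auto
  have B0: "0 \<le> B" using B[of undefined undefined] by linarith
  have gx: "integrable lborel (\<lambda>z. k z * g x z)" for x
    by (rule integrable_mult_bounded[OF k _ B]) measurable
  have "integrable (lborel \<Otimes>\<^sub>M lborel) (\<lambda>(x, z). f x * (k z * g x z))"
  proof (rule lborel_pair.Fubini_integrable)
    show "AE x in lborel. integrable lborel (\<lambda>z. case (x, z) of (x, z) \<Rightarrow> f x * (k z * g x z))"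
      using gx by simp
    have le: "(\<integral>z. \<bar>k z * g x z\<bar> \<partial>lborel) \<le> (\<integral>z. B * \<bar>k z\<bar> \<partial>lborel)" for x
      using gx[of x] k B by (intro integral_mono abs_mult_le_of_abs_le) auto
    show "integrable lborel (\<lambda>x. \<integral>z. norm (case (x, z) of (x, z) \<Rightarrow> f x * (k z * g x z)) \<partial>lborel)"
    proof (rule Bochner_Integration.integrable_bound)
      show "integrable lborel (\<lambda>x. f x * (\<integral>z. B * \<bar>k z\<bar> \<partial>lborel))"
        using f by simp
      show "AE x in lborel. norm (\<integral>z. norm (case (x, z) of (x, z) \<Rightarrow> f x * (k z * g x z)) \<partial>lborel)
          \<le> norm (f x * (\<integral>z. B * \<bar>k z\<bar> \<partial>lborel))"
      proof (intro AE_I2)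
        fix x
        have "\<bar>f x\<bar> * (\<integral>z. \<bar>k z * g x z\<bar> \<partial>lborel) \<le> \<bar>f x\<bar> * (\<integral>z. B * \<bar>k z\<bar> \<partial>lborel)"
          by (intro mult_left_mono le) simp
        then show "norm (\<integral>z. norm (case (x, z) of (x, z) \<Rightarrow> f x * (k z * g x z)) \<partial>lborel)
            \<le> norm (f x * (\<integral>z. B * \<bar>k z\<bar> \<partial>lborel))"
          using B0 by (simp add: abs_mult)
      qed
    qed measurable
  qed measurable
  from lborel_pair.Fubini_integral[OF this] show ?thesis
    by (simp add: mult.left_commute[of "f _"] flip: integral_mult_right_zero)
qed

section \<open>Scaling, symmetry and duality of the truncated operator\<close>

lemma integrable_trunc_lap_integrand:
  fixes v :: "'a::euclidean_space \<Rightarrow> real"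
  assumes "0 < \<alpha>" "\<alpha> < 2" "0 < \<delta>" and [measurable]: "v \<in> borel_measurable borel" and "\<And>x. \<bar>v x\<bar> \<le> B"
  shows "integrable lborel (\<lambda>z. tkern \<alpha> \<delta> z * (v (x + z) - v x))"
proof (rule integrable_mult_bounded[OF integrable_tkern[OF assms(1-3)]])
  show "\<bar>v (x + z) - v x\<bar> \<le> 2 * B" for z
    using assms(5)[of x] assms(5)[of "x + z"] by linarith
qed measurable

lemma trunc_lap_measurable [measurable]:
  fixes v :: "'a::euclidean_space \<Rightarrow> real"
  assumes [measurable]: "v \<in> borel_measurable borel"
  shows "trunc_lap \<alpha> \<delta> v \<in> borel_measurable borel"
  unfolding trunc_lap_def by measurable

lemma trunc_lap_bounded:
  fixes v :: "'a::euclidean_space \<Rightarrow> real"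
  assumes "0 < \<alpha>" "\<alpha> < 2" "0 < \<delta>" "v \<in> borel_measurable borel" "\<And>x. \<bar>v x\<bar> \<le> B"
  shows "\<bar>trunc_lap \<alpha> \<delta> v x\<bar> \<le> 2 * B * (\<integral>z. tkern \<alpha> \<delta> (z::'a) \<partial>lborel)"
proof -
  have "\<bar>trunc_lap \<alpha> \<delta> v x\<bar> \<le> (\<integral>z. \<bar>tkern \<alpha> \<delta> z * (v (x + z) - v x)\<bar> \<partial>lborel)"
    unfolding trunc_lap_def by (rule integral_abs_bound)
  also have "\<dots> \<le> (\<integral>z. 2 * B * tkern \<alpha> \<delta> (z::'a) \<partial>lborel)"
  proof (rule integral_mono)
    show "\<bar>tkern \<alpha> \<delta> z * (v (x + z) - v x)\<bar> \<le> 2 * B * tkern \<alpha> \<delta> z" for z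
      using mult_left_mono[of "\<bar>v (x + z) - v x\<bar>" "2 * B" "tkern \<alpha> \<delta> z"] assms(5)[of x] assms(5)[of "x + z"]
      by (simp add: abs_mult mult.commute)
  qed (use integrable_trunc_lap_integrand[OF assms] integrable_tkern assms in auto)
  finally show ?thesis by simp
qed

text \<open>Substitute \<open>t z\<close> for \<open>z\<close>; the kernel is homogeneous. The
  truncation radius changes as well, which is harmless because it will tend to 0.\<close>

lemma trunc_lap_scale:
  fixes v :: "'a::euclidean_space \<Rightarrow> real"
  assumes "0 < t" and [measurable]: "v \<in> borel_measurable borel"
  shows "trunc_lap \<alpha> \<delta> (\<lambda>x. v (t *\<^sub>R x)) x = t powr \<alpha> * trunc_lap \<alpha> (t * \<delta>) v (t *\<^sub>R x)"
proof -
  have "trunc_lap \<alpha> (t * \<delta>) v (t *\<^sub>R x) = \<bar>t\<bar> ^ DIM('a) *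
      (\<integral>z. tkern \<alpha> (t * \<delta>) (0 + t *\<^sub>R z) * (v (t *\<^sub>R x + (0 + t *\<^sub>R z)) - v (t *\<^sub>R x)) \<partial>lborel)"
    unfolding trunc_lap_def using assms(1) by (intro lborel_integral_affine) auto
  also have "\<dots> = t ^ DIM('a) * (\<integral>z. (1 / (t ^ DIM('a) * t powr \<alpha>)) *
      (tkern \<alpha> \<delta> z * (v (t *\<^sub>R (x + z)) - v (t *\<^sub>R x))) \<partial>lborel)"
    using assms(1) by (simp add: tkern_scaleR scaleR_add_right)
  also have "\<dots> = trunc_lap \<alpha> \<delta> (\<lambda>x. v (t *\<^sub>R x)) x / t powr \<alpha>"
    using assms(1) unfolding trunc_lap_def integral_mult_right_zero by simp
  finally show ?thesis using assms(1) by simp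
qed

text \<open>Averaging over \<open>z\<close> and \<open>-z\<close> replaces first differences by
  second differences. For smooth functions these are quadratic in \<open>z\<close>, so the
  truncation can be removed without relying on cancellation.\<close>

lemma trunc_lap_symmetric:
  fixes v :: "'a::euclidean_space \<Rightarrow> real"
  assumes "0 < \<alpha>" "\<alpha> < 2" "0 < \<delta>" and [measurable]: "v \<in> borel_measurable borel" and "\<And>x. \<bar>v x\<bar> \<le> B"
  shows "2 * trunc_lap \<alpha> \<delta> v x = (\<integral>z. tkern \<alpha> \<delta> z * (v (x + z) + v (x - z) - 2 * v x) \<partial>lborel)"
proof -
  note int = integrable_trunc_lap_integrand[OF assms(1-3) assms(4,5)]
  have "trunc_lap \<alpha> \<delta> v x = (\<integral>z. tkern \<alpha> \<delta> z * (v (x - z) - v x) \<partial>lborel)"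
    unfolding trunc_lap_def
    by (subst lborel_integral_uminus[symmetric]) simp_all
  then have "2 * trunc_lap \<alpha> \<delta> v x = (\<integral>z. tkern \<alpha> \<delta> z * (v (x + z) - v x) \<partial>lborel)
      + (\<integral>z. tkern \<alpha> \<delta> z * (v (x - z) - v x) \<partial>lborel)"
    by (simp add: trunc_lap_def)
  also have "\<dots> = (\<integral>z. tkern \<alpha> \<delta> z * (v (x + z) - v x) + tkern \<alpha> \<delta> z * (v (x - z) - v x) \<partial>lborel)"
    using int lborel_integrable_uminus[OF int[of x]]
    by (intro Bochner_Integration.integral_add[symmetric]) simp_all
  finally show ?thesis by (simp add: algebra_simps)
qed

text \<open>The truncated operator is convolution with an even integrable kernel minus a constant
  multiple of the identity, hence symmetric with respect to the Lebesgue integral.\<close>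

lemma trunc_lap_duality:
  fixes u \<phi> :: "'a::euclidean_space \<Rightarrow> real"
  assumes "0 < \<alpha>" "\<alpha> < 2" "0 < \<delta>"
    and u [measurable]: "u \<in> borel_measurable borel" and Bu: "\<And>x. \<bar>u x\<bar> \<le> B"
    and \<phi>: "integrable lborel \<phi>" and B\<phi>: "\<And>x. \<bar>\<phi> x\<bar> \<le> B'"
  shows "integrable lborel (trunc_lap \<alpha> \<delta> \<phi>)"
    and "(\<integral>x. u x * trunc_lap \<alpha> \<delta> \<phi> x \<partial>lborel) = (\<integral>x. trunc_lap \<alpha> \<delta> u x * \<phi> x \<partial>lborel)"
proof -
  let ?k = "tkern \<alpha> \<delta> :: 'a \<Rightarrow> real"
  have [measurable]: "\<phi> \<in> borel_measurable borel" using \<phi> by auto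
  note k = integrable_tkern[OF assms(1-3), where 'a='a]
  \<comment> \<open>A general bounded weight \<open>w\<close> serves two purposes:
    \<open>w = 1\<close> gives integrability of the convolution, \<open>w = u\<close> justifies
    Fubini.\<close>
  have *: "integrable (lborel \<Otimes>\<^sub>M lborel) (\<lambda>(z, x). ?k z * (w x * \<phi> (x + z)))"
    if [measurable]: "w \<in> borel_measurable borel" and Bw: "\<And>x. \<bar>w x\<bar> \<le> Bw" for w :: "'a \<Rightarrow> real" and Bw
  proof (rule lborel_pair.Fubini_integrable)
    have int: "integrable lborel (\<lambda>x. \<phi> (x + z) * w x)" for z
      using lborel_integrable_translate[OF \<phi>, of z] Bw by (intro integrable_mult_bounded) (auto simp: add.commute)
    show "AE z in lborel. integrable lborel (\<lambda>x. case (z, x) of (z, x) \<Rightarrow> ?k z * (w x * \<phi> (x + z)))"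
      using int by (simp add: mult.commute)
    have le: "(\<integral>x. \<bar>w x * \<phi> (x + z)\<bar> \<partial>lborel) \<le> Bw * (\<integral>x. \<bar>\<phi> x\<bar> \<partial>lborel)" for z
    proof -
      have "(\<integral>x. \<bar>w x * \<phi> (x + z)\<bar> \<partial>lborel) \<le> (\<integral>x. Bw * \<bar>\<phi> (z + x)\<bar> \<partial>lborel)"
      proof (rule integral_mono)
        show "integrable lborel (\<lambda>x. \<bar>w x * \<phi> (x + z)\<bar>)"
          using int[of z] by (simp add: mult.commute)
        show "integrable lborel (\<lambda>x. Bw * \<bar>\<phi> (z + x)\<bar>)"
          using lborel_integrable_translate[OF \<phi>, of z] by simp
        show "\<bar>w x * \<phi> (x + z)\<bar> \<le> Bw * \<bar>\<phi> (z + x)\<bar>" for x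
          using abs_mult_le_of_abs_le[OF Bw, of "\<phi> (x + z)" x] by (simp add: add.commute mult.commute)
      qed
      then show ?thesis
        using lborel_integral_translate[of "\<lambda>x. \<bar>\<phi> x\<bar>" z] by simp
    qed
    show "integrable lborel (\<lambda>z. \<integral>x. norm (case (z, x) of (z, x) \<Rightarrow> ?k z * (w x * \<phi> (x + z))) \<partial>lborel)"
    proof (rule Bochner_Integration.integrable_bound)
      show "integrable lborel (\<lambda>z. ?k z * (Bw * (\<integral>x. \<bar>\<phi> x\<bar> \<partial>lborel)))"
        using k by simp
      show "AE z in lborel. norm (\<integral>x. norm (case (z, x) of (z, x) \<Rightarrow> ?k z * (w x * \<phi> (x + z))) \<partial>lborel)
          \<le> norm (?k z * (Bw * (\<integral>x. \<bar>\<phi> x\<bar> \<partial>lborel)))"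
      proof (intro AE_I2)
        fix z
        have "?k z * (\<integral>x. \<bar>w x * \<phi> (x + z)\<bar> \<partial>lborel) \<le> ?k z * (Bw * (\<integral>x. \<bar>\<phi> x\<bar> \<partial>lborel))"
          by (intro mult_left_mono le) simp
        then show "norm (\<integral>x. norm (case (z, x) of (z, x) \<Rightarrow> ?k z * (w x * \<phi> (x + z))) \<partial>lborel)
            \<le> norm (?k z * (Bw * (\<integral>x. \<bar>\<phi> x\<bar> \<partial>lborel)))"
          by (simp add: abs_mult[of "?k _"]) (meson abs_ge_self mult_left_mono order_trans tkern_nonneg)
      qed
    qed measurable
  qed measurable
  have split: "trunc_lap \<alpha> \<delta> v x = (\<integral>z. ?k z * v (x + z) \<partial>lborel) - v x * integral\<^sup>L lborel ?k"
    if [measurable]: "v \<in> borel_measurable borel" and "\<And>x. \<bar>v x\<bar> \<le> b" for v b x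
  proof -
    have "integrable lborel (\<lambda>z. ?k z * v (x + z))"
      by (rule integrable_mult_bounded[OF k]) (use that in auto)
    then show ?thesis
      unfolding trunc_lap_def right_diff_distrib using k by simp
  qed
  have int1: "integrable lborel (\<lambda>x. \<integral>z. ?k z * \<phi> (x + z) \<partial>lborel)"
    using lborel_pair.integrable_snd[OF *[of "\<lambda>_. 1" 1]] by simp
  show "integrable lborel (trunc_lap \<alpha> \<delta> \<phi>)"
  proof -
    have "trunc_lap \<alpha> \<delta> \<phi> = (\<lambda>x. (\<integral>z. ?k z * \<phi> (x + z) \<partial>lborel) - \<phi> x * integral\<^sup>L lborel ?k)"
      using split[of \<phi> B'] B\<phi> by auto
    with int1 \<phi> show ?thesis by simp
  qed
  have u\<phi>: "integrable lborel (\<lambda>x. \<phi> x * u x)"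
    by (rule integrable_mult_bounded[OF \<phi> _ Bu]) simp
  have "(\<integral>x. u x * (\<integral>z. ?k z * \<phi> (x + z) \<partial>lborel) \<partial>lborel)
      = (\<integral>x. (\<integral>z. ?k z * (u x * \<phi> (x + z)) \<partial>lborel) \<partial>lborel)"
    by (simp add: mult.left_commute flip: integral_mult_right_zero)
  also have "\<dots> = (\<integral>z. (\<integral>x. ?k z * (u x * \<phi> (x + z)) \<partial>lborel) \<partial>lborel)"
    by (rule lborel_pair.Fubini_integral[OF *[OF u Bu]])
  also have "\<dots> = (\<integral>z. ?k z * (\<integral>x. \<phi> x * u (x - z) \<partial>lborel) \<partial>lborel)"
  proof (intro Bochner_Integration.integral_cong refl)
    fix z :: 'a
    have "(\<integral>x. u (x - z) * \<phi> x \<partial>lborel) = (\<integral>x. u (z + x - z) * \<phi> (z + x) \<partial>lborel)"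
      by (rule lborel_integral_translate[symmetric]) measurable
    then show "(\<integral>x. ?k z * (u x * \<phi> (x + z)) \<partial>lborel) = ?k z * (\<integral>x. \<phi> x * u (x - z) \<partial>lborel)"
      by (simp add: add.commute mult.commute)
  qed
  also have "\<dots> = (\<integral>x. \<phi> x * (\<integral>z. ?k z * u (x - z) \<partial>lborel) \<partial>lborel)"
    by (rule Fubini_bounded_weight[OF \<phi> k _ Bu, symmetric]) measurable
  also have "\<dots> = (\<integral>x. \<phi> x * (\<integral>z. ?k z * u (x + z) \<partial>lborel) \<partial>lborel)"
    by (subst lborel_integral_uminus[symmetric]) simp_all
  finally have eq: "(\<integral>x. u x * (\<integral>z. ?k z * \<phi> (x + z) \<partial>lborel) \<partial>lborel)
      = (\<integral>x. \<phi> x * (\<integral>z. ?k z * u (x + z) \<partial>lborel) \<partial>lborel)" .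
  have int2: "integrable lborel (\<lambda>x. u x * (\<integral>z. ?k z * \<phi> (x + z) \<partial>lborel))"
    using integrable_mult_bounded[OF int1 _ Bu] by (simp add: mult.commute)
  have Bk: "\<bar>\<integral>z. ?k z * u (x + z) \<partial>lborel\<bar> \<le> (\<integral>z. B * ?k z \<partial>lborel)" for x
  proof -
    have "\<bar>\<integral>z. ?k z * u (x + z) \<partial>lborel\<bar> \<le> (\<integral>z. \<bar>?k z * u (x + z)\<bar> \<partial>lborel)"
      by (rule integral_abs_bound)
    also have "\<dots> \<le> (\<integral>z. B * ?k z \<partial>lborel)"
      using k integrable_mult_bounded[OF k, of "\<lambda>z. u (x + z)" B] Bu
        abs_mult_le_of_abs_le[OF Bu, of "?k _"]
      by (intro integral_mono) auto
    finally show ?thesis .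
  qed
  have int3: "integrable lborel (\<lambda>x. \<phi> x * (\<integral>z. ?k z * u (x + z) \<partial>lborel))"
    by (rule integrable_mult_bounded[OF \<phi> _ Bk]) measurable
  show "(\<integral>x. u x * trunc_lap \<alpha> \<delta> \<phi> x \<partial>lborel) = (\<integral>x. trunc_lap \<alpha> \<delta> u x * \<phi> x \<partial>lborel)"
    using split[of \<phi> B'] B\<phi> split[of u B] Bu eq int2 int3
      integrable_mult_left[OF u\<phi>, of "integral\<^sup>L lborel ?k"]
    by (simp add: left_diff_distrib right_diff_distrib mult_ac)
qed

text \<open>The limit of \<open>trunc_lap\<close> on bumps as \<delta> tends to 0, written as an
  absolutely convergent integral; the half comes from averaging over \<open>z\<close> and
  \<open>-z\<close>.\<close>

definition sym_lap :: "real \<Rightarrow> ('a::euclidean_space \<Rightarrow> real) \<Rightarrow> 'a \<Rightarrow> real" where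
  "sym_lap \<alpha> \<phi> x = (\<integral>z. kern \<alpha> z * (\<phi> (x + z) + \<phi> (x - z) - 2 * \<phi> x) \<partial>lborel) / 2"

lemma sym_lap_measurable [measurable]:
  fixes \<phi> :: "'a::euclidean_space \<Rightarrow> real"
  assumes [measurable]: "\<phi> \<in> borel_measurable borel"
  shows "sym_lap \<alpha> \<phi> \<in> borel_measurable borel"
  unfolding sym_lap_def by measurable

section \<open>Removing the truncation on bumps\<close>

lemma bump_symmetric_difference_bound_min:
  assumes "0 < r"
  shows "\<exists>C>0. \<forall>x z::'a::euclidean_space.
    \<bar>bump x0 r (x + z) + bump x0 r (x - z) - 2 * bump x0 r x\<bar> \<le> C * min 1 ((norm z)\<^sup>2)"
proof -
  obtain C where C: "C > 0"
    "\<And>x z::'a. \<bar>bump x0 r (x + z) + bump x0 r (x - z) - 2 * bump x0 r x\<bar> \<le> C * (norm z)\<^sup>2"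
    using bump_symmetric_difference_bound[OF assms] by metis
  have "\<bar>bump x0 r (x + z) + bump x0 r (x - z) - 2 * bump x0 r x\<bar> \<le> (C + 4) * min 1 ((norm z)\<^sup>2)" for x z :: 'a
  proof (cases "1 \<le> (norm z)\<^sup>2")
    case True
    have "\<bar>bump x0 r (x + z) + bump x0 r (x - z) - 2 * bump x0 r x\<bar> \<le> 4"
      using bump_nonneg[of x0 r "x + z"] bump_nonneg[of x0 r "x - z"] bump_nonneg[of x0 r x]
        bump_le_1[of x0 r "x + z"] bump_le_1[of x0 r "x - z"] bump_le_1[of x0 r x]
      unfolding abs_le_iff by linarith
    with True C(1) show ?thesis by simp
  next
    case False
    have "C * (norm z)\<^sup>2 \<le> (C + 4) * (norm z)\<^sup>2"
      by (intro mult_right_mono) auto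
    with False C(2)[of x z] show ?thesis by simp
  qed
  with C(1) show ?thesis
    by (intro exI[of _ "C + 4"]) auto
qed

text \<open>Uniformity in \<delta> is the point: in the maximum principle the truncation radius is
  chosen last, after all constants are fixed.\<close>

lemma trunc_lap_bump_bounded:
  assumes "0 < \<alpha>" "\<alpha> < 2" "0 < r"
  shows "\<exists>K>0. \<forall>\<delta>>0. \<forall>x::'a::euclidean_space. \<bar>trunc_lap \<alpha> \<delta> (bump x0 r) x\<bar> \<le> K"
proof -
  let ?D = "\<lambda>x z::'a. bump x0 r (x + z) + bump x0 r (x - z) - 2 * bump x0 r x"
  obtain C where C: "C > 0" "\<And>x z. \<bar>?D x z\<bar> \<le> C * min 1 ((norm z)\<^sup>2)"
    using bump_symmetric_difference_bound_min[OF assms(3), where 'a='a] by metis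
  note int = integrable_min_sq_kern[OF assms(1,2), where 'a='a]
  define I where "I = (\<integral>z. C * (min 1 ((norm z)\<^sup>2) * kern \<alpha> (z::'a)) \<partial>lborel)"
  have "\<bar>trunc_lap \<alpha> \<delta> (bump x0 r) x\<bar> \<le> I" if "0 < \<delta>" for \<delta> x
  proof -
    have b: "\<bar>bump x0 r (y::'a)\<bar> \<le> 1" for y
      using bump_le_1[of x0 r y] by simp
    have le: "\<bar>tkern \<alpha> \<delta> z * ?D x z\<bar> \<le> C * (min 1 ((norm z)\<^sup>2) * kern \<alpha> z)" for z
    proof -
      have "tkern \<alpha> \<delta> z * \<bar>?D x z\<bar> \<le> kern \<alpha> z * (C * min 1 ((norm z)\<^sup>2))"
        using C by (intro mult_mono) (auto simp: tkern_def indicator_def)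
      then show ?thesis by (simp add: abs_mult mult_ac)
    qed
    have "\<bar>2 * trunc_lap \<alpha> \<delta> (bump x0 r) x\<bar> = \<bar>\<integral>z. tkern \<alpha> \<delta> z * ?D x z \<partial>lborel\<bar>"
      using trunc_lap_symmetric[OF assms(1,2) that bump_measurable b, where x=x] by simp
    also have "\<dots> \<le> (\<integral>z. \<bar>tkern \<alpha> \<delta> z * ?D x z\<bar> \<partial>lborel)"
      by (rule integral_abs_bound)
    also have "\<dots> \<le> I"
      unfolding I_def
    proof (rule integral_mono[OF _ _ le])
      show "integrable lborel (\<lambda>z. \<bar>tkern \<alpha> \<delta> z * ?D x z\<bar>)"
        by (rule Bochner_Integration.integrable_bound[OF integrable_mult_right[OF int, of C]])
           (auto intro!: AE_I2 intro: order_trans[OF le abs_ge_self])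
    qed (use int in auto)
    finally show ?thesis
      by (smt (verit))
  qed
  then have "\<bar>trunc_lap \<alpha> \<delta> (bump x0 r) x\<bar> \<le> \<bar>I\<bar> + 1" if "0 < \<delta>" for \<delta> x
    by (rule order_trans[of _ I]) (use that in auto)
  then show ?thesis
    by (intro exI[of _ "\<bar>I\<bar> + 1"]) auto
qed

text \<open>The error is the part of the symmetrised integral over |z| \<le> \<delta>, small by
  dominated convergence uniformly in \<open>x\<close>. For \<delta> \<le> 1 it vanishes when
  \<open>x\<close> is at distance at least r + 1 from \<open>x0\<close>, since then \<open>x\<close>
  and both shifted points lie outside the bump. The indicator makes the error integrable against
  bounded functions.\<close>

lemma trunc_lap_bump_approx:
  assumes "0 < \<alpha>" "\<alpha> < 2" "0 < r"
  obtains \<omega> where "(\<omega> \<longlongrightarrow> 0) (at_right 0)"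
    "\<And>\<delta> x::'a::euclidean_space. 0 < \<delta> \<Longrightarrow> \<delta> \<le> 1 \<Longrightarrow>
       \<bar>trunc_lap \<alpha> \<delta> (bump x0 r) x - sym_lap \<alpha> (bump x0 r) x\<bar> \<le> \<omega> \<delta> * indicator (ball x0 (r + 1)) x"
proof -
  let ?D = "\<lambda>x z::'a. bump x0 r (x + z) + bump x0 r (x - z) - 2 * bump x0 r x"
  obtain C where C: "C > 0" "\<And>x z. \<bar>?D x z\<bar> \<le> C * min 1 ((norm z)\<^sup>2)"
    using bump_symmetric_difference_bound_min[OF assms(3), where 'a='a] by metis
  note int = integrable_min_sq_kern[OF assms(1,2), where 'a='a]
  define m where "m z = min 1 ((norm z)\<^sup>2) * kern \<alpha> z" for z :: 'a
  have m: "integrable lborel m" "\<And>z. 0 \<le> m z"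
    using int by (auto simp: m_def[abs_def])
  have [measurable]: "m \<in> borel_measurable borel" using m(1) by auto
  define \<omega> where "\<omega> \<delta> = (\<integral>z. C * (indicator (cball 0 \<delta>) z * m z) \<partial>lborel)" for \<delta>
  have [measurable]: "cball (0::'a) s \<in> sets borel" for s
    by (simp add: borel_closed)
  have intm: "integrable lborel (\<lambda>z. C * (indicator (cball 0 \<delta>) z * m z))" for \<delta>
    using integrable_mult_right[OF integrable_real_mult_indicator[OF _ m(1), of "cball 0 \<delta>"], of C]
    by (simp add: mult.commute)
  have \<omega>0: "(\<omega> \<longlongrightarrow> 0) (at_right 0)"
    unfolding tendsto_at_iff_sequentially
  proof (intro allI impI)
    fix X :: "nat \<Rightarrow> real"
    assume X: "\<forall>i. X i \<in> {0<..} - {0}" "X \<longlonglongrightarrow> 0"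
    have "(\<lambda>n. \<omega> (X n)) \<longlonglongrightarrow> (\<integral>z. 0 \<partial>(lborel :: 'a measure))"
      unfolding \<omega>_def
    proof (rule integral_dominated_convergence[where w = "\<lambda>z. C * m z"])
      show "AE z in lborel. (\<lambda>n. C * (indicator (cball 0 (X n)) z * m z)) \<longlonglongrightarrow> 0"
      proof (intro AE_I2)
        fix z :: 'a
        show "(\<lambda>n. C * (indicator (cball 0 (X n)) z * m z)) \<longlonglongrightarrow> 0"
        proof (cases "z = 0")
          case True
          then show ?thesis by (simp add: m_def)
        next
          case False
          then have "\<forall>\<^sub>F n in sequentially. X n < norm z"
            using X(2) by (intro order_tendstoD) auto
          then have "\<forall>\<^sub>F n in sequentially. C * (indicator (cball 0 (X n)) z * m z) = 0"
            by eventually_elim auto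
          then show ?thesis by (rule tendsto_eventually)
        qed
      qed
      show "AE z in lborel. norm (C * (indicator (cball 0 (X n)) z * m z)) \<le> C * m z" for n
        using C(1) m(2) by (intro AE_I2) (auto simp: indicator_def)
    qed (use m in auto)
    then show "(\<omega> \<circ> X) \<longlonglongrightarrow> 0" by (simp add: comp_def)
  qed
  have "\<bar>trunc_lap \<alpha> \<delta> (bump x0 r) x - sym_lap \<alpha> (bump x0 r) x\<bar> \<le> \<omega> \<delta> * indicator (ball x0 (r + 1)) x"
    if \<delta>: "0 < \<delta>" "\<delta> \<le> 1" for \<delta> and x :: 'a
  proof -
    have b: "\<bar>bump x0 r (y::'a)\<bar> \<le> 1" for y
      using bump_le_1[of x0 r y] by simp
    have leD: "\<bar>kern \<alpha> z * ?D x z\<bar> \<le> C * m z" for z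
    proof -
      have "kern \<alpha> z * \<bar>?D x z\<bar> \<le> kern \<alpha> z * (C * min 1 ((norm z)\<^sup>2))"
        using C by (intro mult_left_mono) auto
      then show ?thesis by (simp add: abs_mult m_def mult_ac)
    qed
    have intK: "integrable lborel (\<lambda>z. kern \<alpha> z * ?D x z)"
      by (rule Bochner_Integration.integrable_bound[OF integrable_mult_right[OF m(1), of C]])
         (auto intro!: AE_I2 intro: order_trans[OF leD abs_ge_self])
    let ?E = "\<lambda>z. indicator (cball 0 \<delta>) z * (kern \<alpha> z * ?D x z)"
    have intE: "integrable lborel ?E"
      using integrable_real_mult_indicator[OF _ intK, of "cball 0 \<delta>"] by (simp add: mult.commute)
    have intT: "integrable lborel (\<lambda>z. tkern \<alpha> \<delta> z * ?D x z)"
    proof -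
      have "integrable lborel (\<lambda>z. kern \<alpha> z * ?D x z - ?E z)"
        using intE intK by simp
      also have "(\<lambda>z. kern \<alpha> z * ?D x z - ?E z) = (\<lambda>z. tkern \<alpha> \<delta> z * ?D x z)"
        by (auto simp: tkern_def indicator_def fun_eq_iff)
      finally show ?thesis .
    qed
    have "2 * (sym_lap \<alpha> (bump x0 r) x - trunc_lap \<alpha> \<delta> (bump x0 r) x)
        = (\<integral>z. kern \<alpha> z * ?D x z \<partial>lborel) - (\<integral>z. tkern \<alpha> \<delta> z * ?D x z \<partial>lborel)"
      using trunc_lap_symmetric[OF assms(1,2) \<delta>(1) bump_measurable b, where x=x] by (simp add: sym_lap_def)
    also have "\<dots> = (\<integral>z. kern \<alpha> z * ?D x z - tkern \<alpha> \<delta> z * ?D x z \<partial>lborel)"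
      by (rule Bochner_Integration.integral_diff[OF intK intT, symmetric])
    also have "\<dots> = (\<integral>z. ?E z \<partial>lborel)"
      by (intro Bochner_Integration.integral_cong) (auto simp: tkern_def indicator_def)
    finally have eq: "2 * (sym_lap \<alpha> (bump x0 r) x - trunc_lap \<alpha> \<delta> (bump x0 r) x) = (\<integral>z. ?E z \<partial>lborel)" .
    show ?thesis
    proof (cases "x \<in> ball x0 (r + 1)")
      case True
      have "\<bar>\<integral>z. ?E z \<partial>lborel\<bar> \<le> (\<integral>z. \<bar>?E z\<bar> \<partial>lborel)"
        by (rule integral_abs_bound)
      also have "\<dots> \<le> \<omega> \<delta>"
        unfolding \<omega>_def using intE intm leD
        by (intro integral_mono) (auto simp: indicator_def)
      finally have "\<bar>2 * (sym_lap \<alpha> (bump x0 r) x - trunc_lap \<alpha> \<delta> (bump x0 r) x)\<bar> \<le> \<omega> \<delta>"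
        using eq by simp
      with True show ?thesis by simp
    next
      case False
      have "?E z = 0" for z
      proof (cases "z \<in> cball 0 \<delta>")
        case True
        have n: "r + 1 \<le> norm (x - x0)" "norm z \<le> 1"
          using False True \<delta> by (auto simp: dist_norm norm_minus_commute)
        have "r \<le> norm (x + z - x0)" "r \<le> norm (x - z - x0)" "r \<le> norm (x - x0)"
          using n norm_triangle_ineq2[of "x - x0" "-z"] norm_triangle_ineq2[of "x - x0" z]
          by (simp_all add: algebra_simps)
        then show ?thesis
          by (simp add: bump_eq_0[OF assms(3)])
      qed simp
      then have "(\<integral>z. ?E z \<partial>lborel) = 0" by (simp only: Bochner_Integration.integral_zero)
      with eq False show ?thesis by simp
    qed
  qed
  with \<omega>0 show ?thesis by (rule that)
qed

text \<open>Up to the normalising constant, the value of the distribution -(-Laplacian)^(\<alpha>/2)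
  \<open>v\<close> on one bump. Putting the truncation on \<open>v\<close> rather than on the bump
  makes dilations, differences and mollification easy to follow; as a relation in \<open>l\<close>
  it includes existence of the limit.\<close>

definition weak_lap :: "real \<Rightarrow> ('a::euclidean_space \<Rightarrow> real) \<Rightarrow> 'a \<Rightarrow> real \<Rightarrow> real \<Rightarrow> bool" where
  "weak_lap \<alpha> v x0 r l \<longleftrightarrow>
     ((\<lambda>\<delta>. \<integral>x. trunc_lap \<alpha> \<delta> v x * bump x0 r x \<partial>lborel) \<longlongrightarrow> l) (at_right 0)"

lemma integrable_trunc_lap_bump:
  fixes v :: "'a::euclidean_space \<Rightarrow> real"
  assumes "0 < \<alpha>" "\<alpha> < 2" "0 < \<delta>" "0 < r" "v \<in> borel_measurable borel" "\<And>x. \<bar>v x\<bar> \<le> B"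
  shows "integrable lborel (\<lambda>x. trunc_lap \<alpha> \<delta> v x * bump x0 r x)"
  using integrable_mult_bounded[OF integrable_bump[OF assms(4), of x0] _ trunc_lap_bounded[OF assms(1-3,5,6)]]
    trunc_lap_measurable[OF assms(5)] by (simp add: mult.commute)

text \<open>Duality moves the truncated operator onto the bump, where it converges uniformly on a
  fixed ball and is already equal to its limit outside it.\<close>

lemma weak_lap_sym_lap:
  fixes u :: "'a::euclidean_space \<Rightarrow> real"
  assumes "0 < \<alpha>" "\<alpha> < 2" "0 < r"
    and u [measurable]: "u \<in> borel_measurable borel" and B: "\<And>x. \<bar>u x\<bar> \<le> B"
  shows "weak_lap \<alpha> u x0 r (\<integral>x. u x * sym_lap \<alpha> (bump x0 r) x \<partial>lborel)"
proof -
  let ?\<phi> = "bump x0 r" and ?b = "ball x0 (r + 1)"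
  have B0: "0 \<le> B" using B[of undefined] by linarith
  obtain \<omega> where \<omega>: "(\<omega> \<longlongrightarrow> 0) (at_right 0)"
    "\<And>\<delta> x. 0 < \<delta> \<Longrightarrow> \<delta> \<le> 1 \<Longrightarrow> \<bar>trunc_lap \<alpha> \<delta> ?\<phi> x - sym_lap \<alpha> ?\<phi> x\<bar> \<le> \<omega> \<delta> * indicator ?b x"
    using trunc_lap_bump_approx[OF assms(1-3)] by metis
  have b: "\<bar>?\<phi> y\<bar> \<le> 1" for y
    using bump_le_1[of x0 r y] by simp
  have intb: "integrable lborel (indicator ?b :: 'a \<Rightarrow> real)"
    by (rule integrable_real_indicator) (use emeasure_lborel_ball_finite in auto)
  have intd: "integrable lborel (\<lambda>x. trunc_lap \<alpha> \<delta> ?\<phi> x - sym_lap \<alpha> ?\<phi> x)" if "0 < \<delta>" "\<delta> \<le> 1" for \<delta>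
    by (rule Bochner_Integration.integrable_bound[OF integrable_mult_right[OF intb, of "\<omega> \<delta>"]])
       (auto intro!: AE_I2 intro: order_trans[OF \<omega>(2)[OF that] abs_ge_self] simp del: abs_mult)
  note intT = trunc_lap_duality(1)[OF assms(1,2) _ u B integrable_bump[OF assms(3)] b]
  \<comment> \<open>Integrability of the limit is read off at \<delta> = 1: the truncated function
    is integrable and differs from it by a bounded error supported in a ball.\<close>
  have intS: "integrable lborel (sym_lap \<alpha> ?\<phi>)"
    using Bochner_Integration.integrable_diff[OF intT[of 1] intd[of 1]] by simp
  have "\<bar>(\<integral>x. trunc_lap \<alpha> \<delta> u x * ?\<phi> x \<partial>lborel) - (\<integral>x. u x * sym_lap \<alpha> ?\<phi> x \<partial>lborel)\<bar>
      \<le> \<omega> \<delta> * (B * measure lborel ?b)" if \<delta>: "0 < \<delta>" "\<delta> \<le> 1" for \<delta>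
  proof -
    have "(\<integral>x. trunc_lap \<alpha> \<delta> u x * ?\<phi> x \<partial>lborel) - (\<integral>x. u x * sym_lap \<alpha> ?\<phi> x \<partial>lborel)
        = (\<integral>x. u x * trunc_lap \<alpha> \<delta> ?\<phi> x \<partial>lborel) - (\<integral>x. u x * sym_lap \<alpha> ?\<phi> x \<partial>lborel)"
      using trunc_lap_duality(2)[OF assms(1,2) \<delta>(1) u B integrable_bump[OF assms(3)] b] by simp
    also have "\<dots> = (\<integral>x. u x * trunc_lap \<alpha> \<delta> ?\<phi> x - u x * sym_lap \<alpha> ?\<phi> x \<partial>lborel)"
      using integrable_mult_bounded[OF intT[OF \<delta>(1)] _ B] integrable_mult_bounded[OF intS _ B]
      by (intro Bochner_Integration.integral_diff[symmetric]) (simp_all add: mult.commute)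
    also have "\<bar>\<dots>\<bar> \<le> (\<integral>x. \<bar>u x * trunc_lap \<alpha> \<delta> ?\<phi> x - u x * sym_lap \<alpha> ?\<phi> x\<bar> \<partial>lborel)"
      by (rule integral_abs_bound)
    also have "\<dots> \<le> (\<integral>x. B * (\<omega> \<delta> * indicator ?b x) \<partial>lborel)"
    proof (rule integral_mono)
      show "integrable lborel (\<lambda>x. \<bar>u x * trunc_lap \<alpha> \<delta> ?\<phi> x - u x * sym_lap \<alpha> ?\<phi> x\<bar>)"
        using integrable_mult_bounded[OF intd[OF \<delta>] _ B] by (simp add: algebra_simps)
      show "\<bar>u x * trunc_lap \<alpha> \<delta> ?\<phi> x - u x * sym_lap \<alpha> ?\<phi> x\<bar> \<le> B * (\<omega> \<delta> * indicator ?b x)" for x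
        using mult_mono[OF B[of x] \<omega>(2)[OF \<delta>, of x]] B0 by (simp add: abs_mult flip: right_diff_distrib)
    qed (use intb in simp)
    finally show ?thesis by (simp add: mult_ac)
  qed
  then have "\<forall>\<^sub>F \<delta> in at_right 0. norm ((\<integral>x. trunc_lap \<alpha> \<delta> u x * ?\<phi> x \<partial>lborel) - (\<integral>x. u x * sym_lap \<alpha> ?\<phi> x \<partial>lborel))
      \<le> \<omega> \<delta> * (B * measure lborel ?b)"
    by (auto simp: eventually_at_right_field intro!: exI[of _ 1])
  moreover have "((\<lambda>\<delta>. \<omega> \<delta> * (B * measure lborel ?b)) \<longlongrightarrow> 0) (at_right 0)"
    using tendsto_mult_left_zero[OF \<omega>(1)] by simp
  ultimately have "((\<lambda>\<delta>. (\<integral>x. trunc_lap \<alpha> \<delta> u x * ?\<phi> x \<partial>lborel) - (\<integral>x. u x * sym_lap \<alpha> ?\<phi> x \<partial>lborel)) \<longlongrightarrow> 0) (at_right 0)"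
    by (rule Lim_null_comparison)
  then show ?thesis
    unfolding weak_lap_def by (rule LIM_zero_cancel)
qed

text \<open>After substituting \<open>y = x + z\<close> the truncated integral of the definition is
  \<open>- trunc_lap\<close>, whose limit exists; hence the total \<open>Lim\<close> has its
  intended value on bumps.\<close>

lemma frac_laplacian_bump:
  fixes x0 :: "real^'n"
  assumes "0 < \<alpha>" "\<alpha> < 2" "0 < r"
  shows "frac_laplacian \<alpha> (bump x0 r) x = - frac_const CARD('n) \<alpha> * sym_lap \<alpha> (bump x0 r) x"
proof -
  obtain \<omega> where \<omega>: "(\<omega> \<longlongrightarrow> 0) (at_right 0)"
    "\<And>\<delta> x. 0 < \<delta> \<Longrightarrow> \<delta> \<le> 1 \<Longrightarrow> \<bar>trunc_lap \<alpha> \<delta> (bump x0 r) x - sym_lap \<alpha> (bump x0 r) x\<bar>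
       \<le> \<omega> \<delta> * indicator (ball x0 (r + 1)) x"
    using trunc_lap_bump_approx[OF assms] by metis
  have "\<forall>\<^sub>F \<delta> in at_right 0. norm (trunc_lap \<alpha> \<delta> (bump x0 r) x - sym_lap \<alpha> (bump x0 r) x)
      \<le> \<omega> \<delta> * indicator (ball x0 (r + 1)) x"
    using \<omega>(2) by (auto simp: eventually_at_right_field intro!: exI[of _ 1])
  moreover have "((\<lambda>\<delta>. \<omega> \<delta> * indicator (ball x0 (r + 1)) x) \<longlongrightarrow> 0) (at_right 0)"
    using tendsto_mult_left_zero[OF \<omega>(1)] by simp
  ultimately have "((\<lambda>\<delta>. trunc_lap \<alpha> \<delta> (bump x0 r) x - sym_lap \<alpha> (bump x0 r) x) \<longlongrightarrow> 0) (at_right 0)"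
    by (rule Lim_null_comparison)
  then have lim: "((\<lambda>\<delta>. - trunc_lap \<alpha> \<delta> (bump x0 r) x) \<longlongrightarrow> - sym_lap \<alpha> (bump x0 r) x) (at_right 0)"
    by (intro tendsto_minus) (rule LIM_zero_cancel)
  have eq: "(LINT y:{y. \<epsilon> < norm (x - y)}|lborel.
      (bump x0 r x - bump x0 r y) / norm (x - y) powr (real CARD('n) + \<alpha>)) = - trunc_lap \<alpha> \<epsilon> (bump x0 r) x" for \<epsilon>
  proof -
    have "(LINT y:{y. \<epsilon> < norm (x - y)}|lborel.
      (bump x0 r x - bump x0 r y) / norm (x - y) powr (real CARD('n) + \<alpha>))
      = (\<integral>z. indicator {y. \<epsilon> < norm (x - y)} (x + z) *
        ((bump x0 r x - bump x0 r (x + z)) / norm (x - (x + z)) powr (real CARD('n) + \<alpha>)) \<partial>lborel)"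
      unfolding set_lebesgue_integral_def real_scaleR_def
      by (rule lborel_integral_translate[symmetric]) measurable
    also have "\<dots> = (\<integral>z. - (tkern \<alpha> \<epsilon> z * (bump x0 r (x + z) - bump x0 r x)) \<partial>lborel)"
      by (intro Bochner_Integration.integral_cong) (auto simp: tkern_def kern_def indicator_def diff_divide_distrib)
    finally show ?thesis by (simp add: trunc_lap_def)
  qed
  show ?thesis
    unfolding frac_laplacian_def eq using tendsto_Lim[OF _ lim] by simp
qed

section \<open>Testing solutions, dilations and differences with bumps\<close>

lemma frac_const_pos:
  assumes "0 < \<alpha>" "\<alpha> < 2" shows "0 < frac_const N \<alpha>"
  using assms unfolding frac_const_def
  by (intro divide_pos_pos mult_pos_pos Gamma_real_pos) auto

lemma solution_weak_lap:
  fixes u :: "real^'n \<Rightarrow> real"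
  assumes "0 < \<alpha>" "\<alpha> < 2" "solution \<alpha> D0 D1 f b0 b1 u" "0 < r" "cball x0 r \<subseteq> D0 - closure D1"
  shows "weak_lap \<alpha> u x0 r
    ((LINT x:D0 - closure D1|lborel. f x (u x) * bump x0 r x) / frac_const CARD('n) \<alpha>)"
proof -
  let ?c = "frac_const CARD('n) \<alpha>"
  obtain B where B: "\<And>x. \<bar>u x\<bar> \<le> B"
    using assms(3) unfolding solution_def bounded_iff by auto
  have u: "u \<in> borel_measurable borel"
    using assms(3) by (auto simp: solution_def intro: borel_measurable_continuous_onI)
  have "- frac_laplacian_distr \<alpha> u (bump x0 r) = (LINT x:D0 - closure D1|lborel. f x (u x) * bump x0 r x)"
    using assms(3) bump_test_function[OF assms(4,5)] by (auto simp: solution_def)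
  moreover have "- frac_laplacian_distr \<alpha> u (bump x0 r) = ?c * (\<integral>x. u x * sym_lap \<alpha> (bump x0 r) x \<partial>lborel)"
  proof -
    have "(\<integral>x. u x * (- ?c * sym_lap \<alpha> (bump x0 r) x) \<partial>lborel) = (\<integral>x. - ?c * (u x * sym_lap \<alpha> (bump x0 r) x) \<partial>lborel)"
      by (simp only: mult.left_commute)
    then show ?thesis
      unfolding frac_laplacian_distr_def frac_laplacian_bump[OF assms(1,2,4)] by simp
  qed
  ultimately have "(\<integral>x. u x * sym_lap \<alpha> (bump x0 r) x \<partial>lborel)
      = (LINT x:D0 - closure D1|lborel. f x (u x) * bump x0 r x) / ?c"
    using frac_const_pos[OF assms(1,2), of "CARD('n)"] by (simp add: field_simps)
  with weak_lap_sym_lap[OF assms(1,2,4) u B, of x0] show ?thesis by simp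
qed

text \<open>The factor \<open>t powr \<alpha>\<close> comes from the operator and
  \<open>1 / t ^ DIM('a)\<close> from the substitution in the outer integral.\<close>

lemma weak_lap_scale:
  fixes v :: "'a::euclidean_space \<Rightarrow> real"
  assumes "0 < t" and [measurable]: "v \<in> borel_measurable borel"
    and "weak_lap \<alpha> v (t *\<^sub>R x0) (t * r) l"
  shows "weak_lap \<alpha> (\<lambda>x. v (t *\<^sub>R x)) x0 r (t powr \<alpha> / t ^ DIM('a) * l)"
proof -
  have eq: "(\<integral>x. trunc_lap \<alpha> \<delta> (\<lambda>x. v (t *\<^sub>R x)) x * bump x0 r x \<partial>lborel)
      = t powr \<alpha> / t ^ DIM('a) * (\<integral>x. trunc_lap \<alpha> (t * \<delta>) v x * bump (t *\<^sub>R x0) (t * r) x \<partial>lborel)" for \<delta>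
  proof -
    have "(\<integral>x. trunc_lap \<alpha> (t * \<delta>) v x * bump (t *\<^sub>R x0) (t * r) x \<partial>lborel)
        = \<bar>t\<bar> ^ DIM('a) * (\<integral>x. trunc_lap \<alpha> (t * \<delta>) v (0 + t *\<^sub>R x) * bump (t *\<^sub>R x0) (t * r) (0 + t *\<^sub>R x) \<partial>lborel)"
      using assms(1) by (intro lborel_integral_affine) auto
    then show ?thesis
      using assms(1) bump_scaleR[OF assms(1), of x0 r]
      by (simp add: trunc_lap_scale[OF assms(1,2)] mult.assoc)
  qed
  have "filterlim (\<lambda>\<delta>. t * \<delta>) (at_right 0) (at_right 0)"
    unfolding filterlim_at using assms(1)
    by (auto intro!: tendsto_eq_intros simp: eventually_at_right_field intro: exI[of _ 1])
  from filterlim_compose[OF assms(3)[unfolded weak_lap_def] this] show ?thesis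
    unfolding weak_lap_def eq by (intro tendsto_mult_left)
qed

lemma weak_lap_diff:
  fixes v w :: "'a::euclidean_space \<Rightarrow> real"
  assumes "0 < \<alpha>" "\<alpha> < 2" "0 < r"
    and v: "v \<in> borel_measurable borel" "\<And>x. \<bar>v x\<bar> \<le> B"
    and w: "w \<in> borel_measurable borel" "\<And>x. \<bar>w x\<bar> \<le> B'"
    and "weak_lap \<alpha> v x0 r l" "weak_lap \<alpha> w x0 r l'"
  shows "weak_lap \<alpha> (\<lambda>x. v x - w x) x0 r (l - l')"
proof -
  have eq: "(\<integral>x. trunc_lap \<alpha> \<delta> v x * bump x0 r x \<partial>lborel) - (\<integral>x. trunc_lap \<alpha> \<delta> w x * bump x0 r x \<partial>lborel)
      = (\<integral>x. trunc_lap \<alpha> \<delta> (\<lambda>x. v x - w x) x * bump x0 r x \<partial>lborel)" if "0 < \<delta>" for \<delta>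
  proof -
    have "trunc_lap \<alpha> \<delta> v x - trunc_lap \<alpha> \<delta> w x = trunc_lap \<alpha> \<delta> (\<lambda>x. v x - w x) x" for x
    proof -
      have "trunc_lap \<alpha> \<delta> v x - trunc_lap \<alpha> \<delta> w x
          = (\<integral>z. tkern \<alpha> \<delta> z * (v (x + z) - v x) - tkern \<alpha> \<delta> z * (w (x + z) - w x) \<partial>lborel)"
        unfolding trunc_lap_def
        by (rule Bochner_Integration.integral_diff[OF integrable_trunc_lap_integrand[OF assms(1,2) that v]
              integrable_trunc_lap_integrand[OF assms(1,2) that w], symmetric])
      also have "\<dots> = trunc_lap \<alpha> \<delta> (\<lambda>x. v x - w x) x"
        unfolding trunc_lap_def
        by (intro Bochner_Integration.integral_cong) (auto simp: algebra_simps)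
      finally show ?thesis .
    qed
    then show ?thesis
      using integrable_trunc_lap_bump[OF assms(1,2) that assms(3)] v w
      by (subst Bochner_Integration.integral_diff[symmetric]) (auto simp flip: left_diff_distrib)
  qed
  have "((\<lambda>\<delta>. (\<integral>x. trunc_lap \<alpha> \<delta> v x * bump x0 r x \<partial>lborel) - (\<integral>x. trunc_lap \<alpha> \<delta> w x * bump x0 r x \<partial>lborel))
      \<longlongrightarrow> l - l') (at_right 0)"
    using assms(8,9) unfolding weak_lap_def by (rule tendsto_diff)
  then show ?thesis
    unfolding weak_lap_def
    by (rule Lim_transform_eventually) (auto simp: eventually_at_right_field eq intro: exI[of _ 1])
qed

text \<open>The truncated operator commutes with translations. Testing it against a bump centred at
  \<open>x\<close> therefore evaluates it pointwise at \<open>x\<close> on the mollified function,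
  which is how a weak inequality becomes usable at a maximum point.\<close>

lemma trunc_lap_mollify:
  fixes v :: "'a::euclidean_space \<Rightarrow> real"
  assumes "0 < \<alpha>" "\<alpha> < 2" "0 < \<delta>" "0 < r"
    and [measurable]: "v \<in> borel_measurable borel" and B: "\<And>x. \<bar>v x\<bar> \<le> B"
  shows "(\<integral>y. trunc_lap \<alpha> \<delta> v y * bump x r y \<partial>lborel)
    = trunc_lap \<alpha> \<delta> (\<lambda>x. \<integral>y. v y * bump x r y \<partial>lborel) x"
proof -
  have B2: "\<bar>v (y + z) - v y\<bar> \<le> 2 * B" for y z
    using B[of y] B[of "y + z"] by linarith
  have int: "integrable lborel (\<lambda>y. bump x r y * v (y + z))" for z
    by (rule integrable_mult_bounded[OF integrable_bump[OF assms(4)] _ B]) measurable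
  have "(\<integral>y. trunc_lap \<alpha> \<delta> v y * bump x r y \<partial>lborel)
      = (\<integral>y. bump x r y * (\<integral>z. tkern \<alpha> \<delta> z * (v (y + z) - v y) \<partial>lborel) \<partial>lborel)"
    by (simp add: trunc_lap_def mult.commute)
  also have "\<dots> = (\<integral>z. tkern \<alpha> \<delta> z * (\<integral>y. bump x r y * (v (y + z) - v y) \<partial>lborel) \<partial>lborel)"
    by (rule Fubini_bounded_weight[OF integrable_bump[OF assms(4)] integrable_tkern[OF assms(1-3)] _ B2]) measurable
  also have "\<dots> = (\<integral>z. tkern \<alpha> \<delta> z * ((\<integral>y. v y * bump (x + z) r y \<partial>lborel) - (\<integral>y. v y * bump x r y \<partial>lborel)) \<partial>lborel)"
  proof (intro Bochner_Integration.integral_cong refl arg_cong2[where f="(*)"])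
    fix z :: 'a
    have "(\<integral>y. bump x r y * v (y + z) \<partial>lborel) = (\<integral>y. v (z + y) * bump (x + z) r (z + y) \<partial>lborel)"
      by (simp add: bump_def algebra_simps)
    also have "\<dots> = (\<integral>y. v y * bump (x + z) r y \<partial>lborel)"
      by (rule lborel_integral_translate) measurable
    finally show "(\<integral>y. bump x r y * (v (y + z) - v y) \<partial>lborel)
        = (\<integral>y. v y * bump (x + z) r y \<partial>lborel) - (\<integral>y. v y * bump x r y \<partial>lborel)"
      using int[of z] int[of 0] by (simp add: right_diff_distrib mult.commute)
  qed
  finally show ?thesis by (simp add: trunc_lap_def)
qed

subsection \<open>Mollification\<close>

lemma integral_bump_translate: "(\<integral>y. bump x r y \<partial>lborel) = (\<integral>y. bump (0::'a) r y \<partial>lborel)"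
  for x :: "'a::euclidean_space"
proof -
  have "bump x r (x + z) = bump 0 r z" for z
    by (simp add: bump_def)
  then have "(\<integral>y. bump (0::'a) r y \<partial>lborel) = (\<integral>y. bump x r y \<partial>lborel)"
    using lborel_integral_translate[of "bump x r" x] by simp
  then show ?thesis by (rule sym)
qed

lemma integral_bump_pos: "0 < (\<integral>y. bump x r y \<partial>lborel)" if "0 < r" for x :: "'a::euclidean_space"
proof -
  \<comment> \<open>The value of the bump at distance r/2, where its argument is 1 - 1/4 =
    3/4.\<close>
  define c :: real where "c = exp (- (4/3))"
  have "c * indicator (ball x (r/2)) y \<le> bump x r y" for y
  proof (cases "y \<in> ball x (r/2)")
    case True
    then have "norm (y - x) / r \<le> 1/2"
      using that by (simp add: dist_norm norm_minus_commute field_simps)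
    then have "(norm (y - x) / r)\<^sup>2 \<le> (1/2)\<^sup>2"
      using that by (intro power_mono) auto
    then have s: "3/4 \<le> 1 - (norm (y - x) / r)\<^sup>2"
      by (simp add: power2_eq_square)
    then have "1 / (1 - (norm (y - x) / r)\<^sup>2) \<le> 1 / (3/4)"
      by (intro divide_left_mono) auto
    with s True show ?thesis
      by (simp add: bump_def flat_exp_def c_def)
  qed simp
  then have "(\<integral>y. c * indicator (ball x (r/2)) y \<partial>lborel) \<le> (\<integral>y. bump x r y \<partial>lborel)"
    using integrable_bump[OF that, of x]
    by (intro integral_mono integrable_mult_right integrable_real_indicator)
       (use emeasure_lborel_ball_finite in auto)
  moreover have "0 < measure lborel (ball x (r/2))"
    using that by (simp add: content_ball)
  then have "0 < (\<integral>y. c * indicator (ball x (r/2)) y \<partial>lborel)"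
    by (simp add: c_def)
  ultimately show ?thesis
    by linarith
qed

definition mollify :: "real \<Rightarrow> ('a::euclidean_space \<Rightarrow> real) \<Rightarrow> 'a \<Rightarrow> real" where
  "mollify \<epsilon> v x = (\<integral>y. v y * bump x \<epsilon> y \<partial>lborel) / (\<integral>y. bump x \<epsilon> y \<partial>lborel)"

lemma integrable_mult_bump:
  fixes v :: "'a::euclidean_space \<Rightarrow> real"
  assumes "0 < \<epsilon>" "v \<in> borel_measurable borel" "\<And>x. \<bar>v x\<bar> \<le> B"
  shows "integrable lborel (\<lambda>y. v y * bump x \<epsilon> y)"
  using integrable_mult_bounded[OF integrable_bump[OF assms(1), of x], of v B] assms(2,3)
  by (simp add: mult.commute)

lemma mollify_le:
  fixes v :: "'a::euclidean_space \<Rightarrow> real"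
  assumes "0 < \<epsilon>" "v \<in> borel_measurable borel" "\<And>x. \<bar>v x\<bar> \<le> B"
    and c: "\<And>y. norm (y - x) < \<epsilon> \<Longrightarrow> v y \<le> c"
  shows "mollify \<epsilon> v x \<le> c"
proof -
  have "(\<integral>y. v y * bump x \<epsilon> y \<partial>lborel) \<le> (\<integral>y. c * bump x \<epsilon> y \<partial>lborel)"
  proof (rule integral_mono[OF integrable_mult_bump[OF assms(1-3)]])
    show "v y * bump x \<epsilon> y \<le> c * bump x \<epsilon> y" for y
      using c[of y] bump_eq_0[OF assms(1), of y x]
      by (cases "norm (y - x) < \<epsilon>") (auto intro: mult_right_mono)
  qed (use integrable_bump assms in auto)
  then show ?thesis
    using integral_bump_pos[OF assms(1), of x] by (simp add: mollify_def field_simps)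
qed

lemma mollify_uminus: "mollify \<epsilon> (\<lambda>x. - v x) x = - mollify \<epsilon> v x"
  by (simp add: mollify_def)

lemma mollify_ge:
  fixes v :: "'a::euclidean_space \<Rightarrow> real"
  assumes "0 < \<epsilon>" "v \<in> borel_measurable borel" "\<And>x. \<bar>v x\<bar> \<le> B"
    and "\<And>y. norm (y - x) < \<epsilon> \<Longrightarrow> c \<le> v y"
  shows "c \<le> mollify \<epsilon> v x"
  using mollify_le[of \<epsilon> "\<lambda>x. - v x" B x "- c"] assms by (simp add: mollify_uminus)

lemma mollify_bounded:
  fixes v :: "'a::euclidean_space \<Rightarrow> real"
  assumes "0 < \<epsilon>" "v \<in> borel_measurable borel" "\<And>x. \<bar>v x\<bar> \<le> B"
  shows "\<bar>mollify \<epsilon> v x\<bar> \<le> B"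
proof -
  have "- B \<le> v y" "v y \<le> B" for y
    using assms(3)[of y] by linarith+
  then show ?thesis
    using mollify_le[OF assms, of x B] mollify_ge[OF assms, of x "- B"] by (simp add: abs_le_iff)
qed

lemma mollify_add:
  fixes v :: "'a::euclidean_space \<Rightarrow> real"
  assumes "0 < \<epsilon>" "v \<in> borel_measurable borel" "\<And>x. \<bar>v x\<bar> \<le> B"
    and "w \<in> borel_measurable borel" "\<And>x. \<bar>w x\<bar> \<le> B'"
  shows "mollify \<epsilon> (\<lambda>x. v x + a * w x) x = mollify \<epsilon> v x + a * mollify \<epsilon> w x"
  using integrable_mult_bump[OF assms(1-3), of x] integrable_mult_bump[OF assms(1,4,5), of x]
  by (simp add: mollify_def distrib_right mult.assoc add_divide_distrib)

text \<open>Centring the weight at 0 moves \<open>x\<close> into the argument of \<open>v\<close>;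
  continuity of \<open>v\<close> and dominated convergence then suffice.\<close>

lemma continuous_on_mollify:
  fixes v :: "'a::euclidean_space \<Rightarrow> real"
  assumes "0 < \<epsilon>" "continuous_on UNIV v" and B: "\<And>x. \<bar>v x\<bar> \<le> B"
  shows "continuous_on A (mollify \<epsilon> v)"
proof -
  have [measurable]: "v \<in> borel_measurable borel"
    using assms(2) by (rule borel_measurable_continuous_onI)
  have "mollify \<epsilon> v = (\<lambda>x. (\<integral>z. v (x + z) * bump 0 \<epsilon> z \<partial>lborel) / (\<integral>y. bump (0::'a) \<epsilon> y \<partial>lborel))"
  proof
    fix x :: 'a
    have "bump x \<epsilon> (x + z) = bump 0 \<epsilon> z" for z
      by (simp add: bump_def)
    then show "mollify \<epsilon> v x = (\<integral>z. v (x + z) * bump 0 \<epsilon> z \<partial>lborel) / (\<integral>y. bump (0::'a) \<epsilon> y \<partial>lborel)"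
      unfolding mollify_def integral_bump_translate[of x]
      using lborel_integral_translate[of "\<lambda>y. v y * bump x \<epsilon> y" x] by simp
  qed
  moreover have "continuous_on A (\<lambda>x. \<integral>z. v (x + z) * bump 0 \<epsilon> z \<partial>lborel)"
    unfolding continuous_on_sequentially comp_def
  proof safe
    fix X and a :: 'a
    assume X: "X \<longlonglongrightarrow> a"
    show "(\<lambda>n. \<integral>z. v (X n + z) * bump 0 \<epsilon> z \<partial>lborel) \<longlonglongrightarrow> (\<integral>z. v (a + z) * bump 0 \<epsilon> z \<partial>lborel)"
    proof (rule integral_dominated_convergence[where w = "\<lambda>z. B * bump 0 \<epsilon> z"])
      show "AE z in lborel. (\<lambda>n. v (X n + z) * bump 0 \<epsilon> z) \<longlonglongrightarrow> v (a + z) * bump 0 \<epsilon> z"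
      proof (intro AE_I2 tendsto_mult tendsto_const)
        fix z
        have "(\<lambda>n. X n + z) \<longlonglongrightarrow> a + z"
          by (intro tendsto_add X tendsto_const)
        then show "(\<lambda>n. v (X n + z)) \<longlonglongrightarrow> v (a + z)"
          using assms(2) by (intro continuous_on_tendsto_compose[of UNIV v]) auto
      qed
      show "AE z in lborel. norm (v (X n + z) * bump 0 \<epsilon> z) \<le> B * bump 0 \<epsilon> z" for n
        using B by (intro AE_I2) (auto simp: abs_mult intro!: mult_right_mono)
    qed (use integrable_bump[OF assms(1)] in auto)
  qed
  ultimately show ?thesis
    using integral_bump_pos[OF assms(1), of "0::'a"]
    by (auto intro!: continuous_intros)
qed

lemma mollify_tendsto:
  fixes v :: "'a::euclidean_space \<Rightarrow> real"
  assumes "continuous_on UNIV v" and B: "\<And>x. \<bar>v x\<bar> \<le> B"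
  shows "((\<lambda>\<epsilon>. mollify \<epsilon> v x) \<longlongrightarrow> v x) (at_right 0)"
proof (rule tendstoI)
  fix e :: real assume "0 < e"
  have vb: "v \<in> borel_measurable borel"
    using assms(1) by (rule borel_measurable_continuous_onI)
  obtain d where d: "0 < d" "\<And>y. dist y x < d \<Longrightarrow> dist (v y) (v x) < e/2"
    using assms(1) \<open>0 < e\<close> unfolding continuous_on_iff by (meson UNIV_I half_gt_zero)
  have "dist (mollify \<epsilon> v x) (v x) < e" if "0 < \<epsilon>" "\<epsilon> < d" for \<epsilon>
  proof -
    have "v x - e/2 \<le> v y" "v y \<le> v x + e/2" if "norm (y - x) < \<epsilon>" for y
    proof -
      have "\<bar>v y - v x\<bar> < e/2"
        using d(2)[of y] that \<open>\<epsilon> < d\<close> by (auto simp: dist_norm)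
      then show "v x - e/2 \<le> v y" "v y \<le> v x + e/2" by linarith+
    qed
    then have "v x - e/2 \<le> mollify \<epsilon> v x" "mollify \<epsilon> v x \<le> v x + e/2"
      using mollify_le[OF that(1) vb B] mollify_ge[OF that(1) vb B] by blast+
    then show ?thesis
      using \<open>0 < e\<close> unfolding dist_real_def by linarith
  qed
  then show "\<forall>\<^sub>F \<epsilon> in at_right 0. dist (mollify \<epsilon> v x) (v x) < e"
    using d(1) by (auto simp: eventually_at_right_field)
qed

lemma trunc_lap_mollify_eq:
  fixes v :: "'a::euclidean_space \<Rightarrow> real"
  assumes "0 < \<alpha>" "\<alpha> < 2" "0 < \<delta>" "0 < \<epsilon>" "v \<in> borel_measurable borel" "\<And>x. \<bar>v x\<bar> \<le> B"
  shows "trunc_lap \<alpha> \<delta> (mollify \<epsilon> v) x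
    = (\<integral>y. trunc_lap \<alpha> \<delta> v y * bump x \<epsilon> y \<partial>lborel) / (\<integral>y. bump x \<epsilon> y \<partial>lborel)"
proof -
  define I where "I = (\<integral>y. bump (0::'a) \<epsilon> y \<partial>lborel)"
  have I: "(\<integral>y. bump x' \<epsilon> y \<partial>lborel) = I" for x' :: 'a
    unfolding I_def by (rule integral_bump_translate)
  have "trunc_lap \<alpha> \<delta> (mollify \<epsilon> v) x = trunc_lap \<alpha> \<delta> (\<lambda>x. \<integral>y. v y * bump x \<epsilon> y \<partial>lborel) x / I"
    unfolding trunc_lap_def mollify_def I by (simp flip: diff_divide_distrib)
  then show ?thesis
    unfolding trunc_lap_mollify[OF assms] I .
qed

subsection \<open>A quantitative maximum principle\<close>

lemma trunc_lap_bump_translate: "trunc_lap \<alpha> \<delta> (bump x1 r) x = trunc_lap \<alpha> \<delta> (bump 0 r) (x - x1)"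
  by (simp add: trunc_lap_def bump_def algebra_simps)

text \<open>
  Adding a small multiple of a bump to \<open>v\<close> creates an interior maximum near \<open>x1\<close>, at which
  the truncated Laplacian is bounded above by minus the weighted integral of \<open>M - v\<close>.
\<close>

lemma near_max_mollified:
  fixes v :: "'a::euclidean_space \<Rightarrow> real"
  assumes \<alpha>: "0 < \<alpha>" "\<alpha> < 2" and r0: "0 < r0"
    and v: "continuous_on UNIV v" and B: "\<And>x. \<bar>v x\<bar> \<le> B"
    and M: "\<And>x. v x \<le> M" and \<eta>: "0 < \<eta>" and x1: "M - \<eta> \<le> v x1"
    and K: "\<And>\<delta> x. 0 < \<delta> \<Longrightarrow> \<bar>trunc_lap \<alpha> \<delta> (bump x1 r0) x\<bar> \<le> K"
    and weak: "\<And>x0 r. 0 < r \<Longrightarrow> cball x0 r \<subseteq> ball x1 (6 * r0) \<inter> {x. M - 2 * \<eta> < v x} \<Longrightarrow>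
       \<exists>l. weak_lap \<alpha> v x0 r l \<and> - A * (\<integral>y. bump x0 r y \<partial>lborel) \<le> l"
  shows "\<forall>\<^sub>F \<epsilon> in at_right 0. (\<integral>y. tkern \<alpha> (6 * r0) (y - x1) * (M - mollify \<epsilon> v y) \<partial>lborel)
    \<le> 2 powr (real DIM('a) + \<alpha>) * (A + \<eta> + 2 * exp 1 * \<eta> * K)"
proof -
  \<comment> \<open>A bump has the value exp(-1) at its centre, so the perturbation peaks at exactly
    2\<eta>. This outweighs the defect \<eta> at \<open>x1\<close> and leaves a margin of \<eta>
    above \<open>M\<close>.\<close>
  define a where "a = 2 * exp 1 * \<eta>"
  define \<psi> where "\<psi> = bump x1 r0"
  define w where "w x = v x + a * \<psi> x" for x
  have a: "0 < a" using \<eta> by (simp add: a_def)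
  have vb: "v \<in> borel_measurable borel"
    using v by (rule borel_measurable_continuous_onI)
  have \<psi>b: "\<psi> \<in> borel_measurable borel" and \<psi>1: "\<bar>\<psi> x\<bar> \<le> 1" for x
    using bump_le_1[of x1 r0 x] by (auto simp: \<psi>_def)
  have ae: "a * exp (-1) = 2 * \<eta>"
    by (simp add: a_def exp_minus field_simps)
  have a\<psi>: "a * \<psi> x \<le> 2 * \<eta>" for x
  proof -
    have "a * \<psi> x \<le> a * exp (-1)"
      unfolding \<psi>_def using a by (intro mult_left_mono bump_le_center) auto
    also have "\<dots> = 2 * \<eta>" by (rule ae)
    finally show ?thesis .
  qed
  have w: "continuous_on UNIV w"
    unfolding w_def[abs_def] \<psi>_def by (intro continuous_intros v continuous_on_bump)
  then have wb: "w \<in> borel_measurable borel"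
    by (rule borel_measurable_continuous_onI)
  have wB: "\<bar>w x\<bar> \<le> B + a" for x
  proof -
    have "\<bar>a * \<psi> x\<bar> \<le> a"
      using mult_left_le[OF \<psi>1, of a x] a by (simp add: abs_mult)
    with B[of x] show ?thesis unfolding w_def by linarith
  qed
  \<comment> \<open>Needed to compare the mollified \<open>w\<close> at its maximum with the values
    of \<open>w\<close> itself on the ball used for testing.\<close>
  have "uniformly_continuous_on (cball x1 (4 * r0)) w"
    using w by (intro compact_uniformly_continuous) (auto intro: continuous_on_subset)
  then obtain d where d: "0 < d" "\<And>y y'. y \<in> cball x1 (4 * r0) \<Longrightarrow> y' \<in> cball x1 (4 * r0) \<Longrightarrow>
      dist y' y < d \<Longrightarrow> dist (w y') (w y) < \<eta> / 4"
    using \<eta> unfolding uniformly_continuous_on_def by (metis divide_pos_pos zero_less_numeral)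
  have main: "(\<integral>y. tkern \<alpha> (6 * r0) (y - x1) * (M - mollify \<epsilon> v y) \<partial>lborel)
    \<le> 2 powr (real DIM('a) + \<alpha>) * (A + \<eta> + a * K)" if \<epsilon>: "0 < \<epsilon>" "\<epsilon> < min r0 (d / 2)" for \<epsilon>
  proof -
    let ?V = "mollify \<epsilon> v" and ?W = "mollify \<epsilon> w" and ?\<Psi> = "mollify \<epsilon> \<psi>"
    have W: "?W x = ?V x + a * ?\<Psi> x" for x
      unfolding w_def[abs_def] by (rule mollify_add[OF \<epsilon>(1) vb B \<psi>b \<psi>1])
    have Vb: "?V \<in> borel_measurable borel" "?W \<in> borel_measurable borel" "?\<Psi> \<in> borel_measurable borel"
      using continuous_on_mollify[OF \<epsilon>(1) v B] continuous_on_mollify[OF \<epsilon>(1) w wB]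
        continuous_on_mollify[OF \<epsilon>(1), of \<psi> 1] \<psi>1 continuous_on_bump[of UNIV x1 r0]
      by (auto intro!: borel_measurable_continuous_onI simp: \<psi>_def)
    note [measurable] = Vb
    note VB = mollify_bounded[OF \<epsilon>(1) vb B] and WB = mollify_bounded[OF \<epsilon>(1) wb wB]
      and \<Psi>B = mollify_bounded[OF \<epsilon>(1) \<psi>b \<psi>1]
    have VM: "?V x \<le> M" for x
      by (rule mollify_le[OF \<epsilon>(1) vb B M])
    obtain x where x: "x \<in> cball x1 (2 * r0)" "\<And>y. y \<in> cball x1 (2 * r0) \<Longrightarrow> ?W y \<le> ?W x"
      using continuous_attains_sup[OF compact_cball _ continuous_on_mollify[OF \<epsilon>(1) w wB]] r0
      by (metis cball_eq_empty not_less mult_pos_pos zero_less_numeral less_imp_le)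
    have Wx1: "M + 3/4 * \<eta> \<le> ?W x"
    proof -
      have "M + 3/4 * \<eta> \<le> w y" if "norm (y - x1) < \<epsilon>" for y
      proof -
        have "dist (w y) (w x1) < \<eta> / 4"
          using that \<epsilon> r0 by (intro d(2)) (auto simp: dist_norm norm_minus_commute)
        moreover have "M + \<eta> \<le> w x1"
          using x1 ae by (simp add: w_def \<psi>_def)
        ultimately show ?thesis unfolding dist_real_def by linarith
      qed
      then have "M + 3/4 * \<eta> \<le> ?W x1"
        by (rule mollify_ge[OF \<epsilon>(1) wb wB])
      also have "\<dots> \<le> ?W x" using r0 by (intro x(2)) auto
      finally show ?thesis .
    qed
    \<comment> \<open>Mollification enlarges the support of the bump from radius r0 to r0 +
      \<epsilon>, still below 2 r0.\<close>
    have far: "?W y = ?V y" if "2 * r0 < norm (y - x1)" for y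
    proof -
      have "\<psi> y' = 0" if "norm (y' - y) < \<epsilon>" for y'
      proof -
        have "norm (y - x1) \<le> norm (y' - y) + norm (y' - x1)"
          using norm_triangle_ineq4[of "y' - x1" "y' - y"] by (simp add: algebra_simps)
        then show ?thesis
          unfolding \<psi>_def using \<open>2 * r0 < norm (y - x1)\<close> that \<epsilon> by (intro bump_eq_0[OF r0]) auto
      qed
      then have "?\<Psi> y \<le> 0" "0 \<le> ?\<Psi> y"
        by (intro mollify_le[OF \<epsilon>(1) \<psi>b \<psi>1] mollify_ge[OF \<epsilon>(1) \<psi>b \<psi>1]; simp)+
      then have "?\<Psi> y = 0" by linarith
      with W show ?thesis by simp
    qed
    \<comment> \<open>The maximum over the compact ball is global: elsewhere the perturbation is
      absent and the values are at most \<open>M\<close>, below the maximum.\<close>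
    have max: "?W y \<le> ?W x" for y
    proof (cases "y \<in> cball x1 (2 * r0)")
      case False
      then have "?W y = ?V y"
        by (intro far) (auto simp: dist_norm norm_minus_commute)
      with VM[of y] Wx1 \<eta> show ?thesis by simp
    qed (rule x)
    \<comment> \<open>On this ball \<open>w\<close> is at least M + 3\<eta>/4 - \<eta>/4, and the
      perturbation contributes at most 2\<eta>, so \<open>v\<close> is at least M - 3\<eta>/2. The
      testing hypothesis therefore applies.\<close>
    have sub: "cball x \<epsilon> \<subseteq> ball x1 (6 * r0) \<inter> {x. M - 2 * \<eta> < v x}"
    proof (intro subsetI IntI CollectI)
      fix y assume y: "y \<in> cball x \<epsilon>"
      have y4: "y' \<in> cball x1 (4 * r0)" if "norm (y' - x) \<le> \<epsilon>" for y'
        using that x(1) \<epsilon> r0 norm_triangle_ineq[of "y' - x" "x - x1"]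
        by (auto simp: dist_norm norm_minus_commute)
      show "y \<in> ball x1 (6 * r0)"
        using y4[of y] y r0 by (auto simp: dist_norm norm_minus_commute)
      have "w y' \<le> w y + \<eta> / 4" if "norm (y' - x) < \<epsilon>" for y'
      proof -
        have "dist y' y < d"
          using that y \<epsilon> dist_triangle[of y' y x] by (auto simp: dist_norm norm_minus_commute)
        then have "dist (w y') (w y) < \<eta> / 4"
          using that y by (intro d(2) y4) (auto simp: dist_norm norm_minus_commute)
        then show ?thesis unfolding dist_real_def by linarith
      qed
      then have "?W x \<le> w y + \<eta> / 4"
        by (rule mollify_le[OF \<epsilon>(1) wb wB])
      with Wx1 a\<psi>[of y] \<eta> show "M - 2 * \<eta> < v y"
        by (simp add: w_def)
    qed
    let ?I = "\<integral>y. bump x \<epsilon> y \<partial>lborel"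
    have I: "0 < ?I" using integral_bump_pos[OF \<epsilon>(1)] .
    obtain l where l: "weak_lap \<alpha> v x \<epsilon> l" "- A * ?I \<le> l"
      using weak[OF \<epsilon>(1) sub] by blast
    \<comment> \<open>Giving up \<eta> makes the inequality strict, so it already holds for some
      positive truncation radius.\<close>
    have "- (A + \<eta>) * ?I < l"
      using l(2) mult_pos_pos[OF \<eta> I] by (simp add: algebra_simps)
    with l(1) have "\<forall>\<^sub>F \<delta> in at_right 0. - (A + \<eta>) * ?I < (\<integral>y. trunc_lap \<alpha> \<delta> v y * bump x \<epsilon> y \<partial>lborel)"
      unfolding weak_lap_def by (rule order_tendstoD)
    moreover have "\<forall>\<^sub>F \<delta> in at_right (0::real). 0 < \<delta> \<and> \<delta> < 4 * r0"
      using r0 by (auto simp: eventually_at_right_field intro!: exI[of _ "4 * r0"])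
    ultimately have "\<forall>\<^sub>F \<delta> in at_right 0. - (A + \<eta>) * ?I < (\<integral>y. trunc_lap \<alpha> \<delta> v y * bump x \<epsilon> y \<partial>lborel)
        \<and> 0 < \<delta> \<and> \<delta> < 4 * r0"
      by eventually_elim auto
    then obtain \<delta> where \<delta>: "- (A + \<eta>) * ?I < (\<integral>y. trunc_lap \<alpha> \<delta> v y * bump x \<epsilon> y \<partial>lborel)"
        "0 < \<delta>" "\<delta> < 4 * r0"
      using eventually_happens'[OF trivial_limit_at_right_real] by blast
    have tV: "- (A + \<eta>) \<le> trunc_lap \<alpha> \<delta> ?V x"
      using \<delta>(1) I unfolding trunc_lap_mollify_eq[OF \<alpha> \<delta>(2) \<epsilon>(1) vb B] by (simp add: field_simps)
    have t\<Psi>: "- K \<le> trunc_lap \<alpha> \<delta> ?\<Psi> x"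
    proof -
      have "(\<integral>y. - K * bump x \<epsilon> y \<partial>lborel) \<le> (\<integral>y. trunc_lap \<alpha> \<delta> \<psi> y * bump x \<epsilon> y \<partial>lborel)"
      proof (rule integral_mono[OF _ integrable_trunc_lap_bump[OF \<alpha> \<delta>(2) \<epsilon>(1) \<psi>b \<psi>1]])
        show "- K * bump x \<epsilon> y \<le> trunc_lap \<alpha> \<delta> \<psi> y * bump x \<epsilon> y" for y
          using K[OF \<delta>(2), of y] by (intro mult_right_mono) (auto simp: \<psi>_def abs_le_iff)
      qed (use integrable_bump[OF \<epsilon>(1)] in auto)
      then show ?thesis
        using I unfolding trunc_lap_mollify_eq[OF \<alpha> \<delta>(2) \<epsilon>(1) \<psi>b \<psi>1] by (simp add: field_simps)
    qed
    have "trunc_lap \<alpha> \<delta> ?W x = trunc_lap \<alpha> \<delta> ?V x + a * trunc_lap \<alpha> \<delta> ?\<Psi> x"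
    proof -
      have "trunc_lap \<alpha> \<delta> ?W x = (\<integral>z. tkern \<alpha> \<delta> z * (?V (x + z) - ?V x) + a * (tkern \<alpha> \<delta> z * (?\<Psi> (x + z) - ?\<Psi> x)) \<partial>lborel)"
        unfolding trunc_lap_def W by (intro Bochner_Integration.integral_cong) (auto simp: algebra_simps)
      also have "\<dots> = trunc_lap \<alpha> \<delta> ?V x + a * trunc_lap \<alpha> \<delta> ?\<Psi> x"
        unfolding trunc_lap_def
        using integrable_trunc_lap_integrand[OF \<alpha> \<delta>(2) Vb(1) VB, of x]
          integrable_trunc_lap_integrand[OF \<alpha> \<delta>(2) Vb(3) \<Psi>B, of x] by simp
      finally show ?thesis .
    qed
    with tV t\<Psi> mult_left_mono[OF t\<Psi>, of a] a
    have tW: "- (A + \<eta> + a * K) \<le> trunc_lap \<alpha> \<delta> ?W x" by simp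
    \<comment> \<open>Radii: the maximum point \<open>x\<close> is within 2 r0 of \<open>x1\<close>,
      so |z| > 4 r0 puts \<open>x + z\<close> outside the mollified bump. Likewise |y - x1| > 6 r0
      forces |y - x| > 4 r0, which explains the radius in the conclusion.\<close>
    let ?k = "tkern \<alpha> (4 * r0) :: 'a \<Rightarrow> real"
    have k: "integrable lborel ?k" using r0 by (intro integrable_tkern \<alpha>) auto
    have kV: "integrable lborel (\<lambda>z. ?k z * (?V (x + z) - M))"
    proof (rule integrable_mult_bounded[OF k])
      show "\<bar>?V (x + z) - M\<bar> \<le> B + \<bar>M\<bar>" for z
        using VB[of "x + z"] by linarith
    qed measurable
    \<comment> \<open>For |z| \<le> 4 r0 the integrand is nonpositive by maximality and is dropped.
      Farther out the perturbation is gone, and the value at the maximum is at least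
      \<open>M\<close>.\<close>
    have "trunc_lap \<alpha> \<delta> ?W x \<le> (\<integral>z. ?k z * (?V (x + z) - M) \<partial>lborel)"
      unfolding trunc_lap_def
    proof (rule integral_mono[OF integrable_trunc_lap_integrand[OF \<alpha> \<delta>(2) Vb(2) WB] kV])
      fix z :: 'a
      show "tkern \<alpha> \<delta> z * (?W (x + z) - ?W x) \<le> ?k z * (?V (x + z) - M)"
      proof (cases "4 * r0 < norm z")
        case True
        have "norm z \<le> norm (x + z - x1) + norm (x - x1)"
          using norm_triangle_ineq4[of "x + z - x1" "x - x1"] by simp
        then have "?W (x + z) = ?V (x + z)"
          using True x(1) by (intro far) (auto simp: dist_norm norm_minus_commute)
        then have "?W (x + z) - ?W x \<le> ?V (x + z) - M"
          using Wx1 \<eta> by simp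
        moreover have "tkern \<alpha> \<delta> z = ?k z"
          using True \<delta>(3) by (simp add: tkern_def)
        ultimately show ?thesis by (simp add: mult_left_mono)
      next
        case False
        then have "?k z = 0" by (simp add: tkern_def)
        then show ?thesis
          using max[of "x + z"] by (simp add: mult_nonneg_nonpos)
      qed
    qed
    with tW have "- (\<integral>z. ?k z * (?V (x + z) - M) \<partial>lborel) \<le> A + \<eta> + a * K" by linarith
    also have "- (\<integral>z. ?k z * (?V (x + z) - M) \<partial>lborel) = (\<integral>z. ?k (x + z - x) * (M - ?V (x + z)) \<partial>lborel)"
      by (subst integral_minus[symmetric]) (simp add: algebra_simps)
    also have "\<dots> = (\<integral>y. ?k (y - x) * (M - ?V y) \<partial>lborel)"
      by (rule lborel_integral_translate) measurable
    finally have fin: "(\<integral>y. ?k (y - x) * (M - ?V y) \<partial>lborel) \<le> A + \<eta> + a * K" .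
    have int: "integrable lborel (\<lambda>y. tkern \<alpha> s (y - x') * (M - ?V y))" if "0 < s" for s and x' :: 'a
    proof (rule integrable_mult_bounded)
      show "integrable lborel (\<lambda>y. tkern \<alpha> s (y - x'))"
        using lborel_integrable_translate[OF integrable_tkern[OF \<alpha> that], of "- x'"] by simp
      show "\<bar>M - ?V y\<bar> \<le> B + \<bar>M\<bar>" for y
        using VB[of y] by linarith
    qed measurable
    have "(\<integral>y. tkern \<alpha> (6 * r0) (y - x1) * (M - ?V y) \<partial>lborel)
        \<le> (\<integral>y. 2 powr (real DIM('a) + \<alpha>) * (?k (y - x) * (M - ?V y)) \<partial>lborel)"
    proof (rule integral_mono)
      fix y
      have "tkern \<alpha> (6 * r0) (y - x1) \<le> 2 powr (real DIM('a) + \<alpha>) * ?k (y - x)"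
      proof (cases "6 * r0 < norm (y - x1)")
        case True
        have n: "norm (y - x1) \<le> norm (y - x) + 2 * r0" "norm (y - x) \<le> norm (y - x1) + 2 * r0"
          using norm_triangle_ineq[of "y - x" "x - x1"] norm_triangle_ineq[of "y - x1" "x1 - x"] x(1)
          by (auto simp: dist_norm norm_minus_commute)
        \<comment> \<open>Beyond 6 r0 one has |y - x| \<le> 2 |y - x1|. Changing the centre of the
          kernel thus costs the factor 2^(N + \<alpha>).\<close>
        have "kern \<alpha> (2 *\<^sub>R (y - x1)) \<le> kern \<alpha> (y - x)"
          using n True r0 \<alpha> by (intro kern_antimono) auto
        then have "kern \<alpha> (y - x1) \<le> 2 powr (real DIM('a) + \<alpha>) * kern \<alpha> (y - x)"
          by (simp add: kern_scaleR powr_add powr_realpow divide_le_eq mult.commute)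
        with True n show ?thesis by (simp add: tkern_def)
      qed (simp add: tkern_def)
      from mult_right_mono[OF this, of "M - ?V y"] VM[of y]
      show "tkern \<alpha> (6 * r0) (y - x1) * (M - ?V y) \<le> 2 powr (real DIM('a) + \<alpha>) * (?k (y - x) * (M - ?V y))"
        by (simp add: mult.assoc)
    qed (use int r0 in auto)
    also have "\<dots> \<le> 2 powr (real DIM('a) + \<alpha>) * (A + \<eta> + a * K)"
      using fin by (simp add: mult_left_mono)
    finally show ?thesis .
  qed
  show ?thesis
    unfolding a_def[symmetric] using r0 d(1) main
    by (auto simp: eventually_at_right_field intro!: exI[of _ "min r0 (d / 2)"])
qed

text \<open>The order of quantifiers matters: \<open>C\<close> depends on the dimension, \<alpha>
  and \<rho> only, by translation invariance of the bump estimate, and serves all \<open>v\<close>,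
  \<open>x1\<close>, \<eta> and \<open>A\<close> at once. The inequality is assumed only where
  \<open>v\<close> is within 2\<eta> of \<open>M\<close>. The bound for mollified functions passes
  to the limit by dominated convergence.\<close>

proposition near_max_integral_bound:
  assumes \<alpha>: "0 < \<alpha>" "\<alpha> < 2" and \<rho>: "0 < \<rho>"
  obtains C where "0 < C" "\<And>(v::'a::euclidean_space \<Rightarrow> real) B M \<eta> A x1.
    \<lbrakk>continuous_on UNIV v; \<And>x. \<bar>v x\<bar> \<le> B; \<And>x. v x \<le> M; 0 < \<eta>; 0 \<le> A; M - \<eta> \<le> v x1;
     \<And>x0 r. 0 < r \<Longrightarrow> cball x0 r \<subseteq> ball x1 \<rho> \<inter> {x. M - 2 * \<eta> < v x} \<Longrightarrow>
       \<exists>l. weak_lap \<alpha> v x0 r l \<and> - A * (\<integral>y. bump x0 r y \<partial>lborel) \<le> l\<rbrakk>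
    \<Longrightarrow> (\<integral>y. tkern \<alpha> \<rho> (y - x1) * (M - v y) \<partial>lborel) \<le> C * (\<eta> + A)"
proof -
  define r0 where "r0 = \<rho> / 6"
  have r0: "0 < r0" "6 * r0 = \<rho>" using \<rho> by (auto simp: r0_def)
  obtain K where K: "K > 0" "\<And>\<delta> x::'a. 0 < \<delta> \<Longrightarrow> \<bar>trunc_lap \<alpha> \<delta> (bump 0 r0) x\<bar> \<le> K"
    using trunc_lap_bump_bounded[OF \<alpha> r0(1), of "0::'a"] by blast
  define C where "C = 2 powr (real DIM('a) + \<alpha>) * (1 + 2 * exp 1 * K)"
  have "0 < C"
    using K(1) unfolding C_def by (intro mult_pos_pos add_pos_pos) auto
  moreover have "(\<integral>y. tkern \<alpha> \<rho> (y - x1) * (M - v y) \<partial>lborel) \<le> C * (\<eta> + A)"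
    if v: "continuous_on UNIV v" and B: "\<And>x. \<bar>v x\<bar> \<le> B" and M: "\<And>x. v x \<le> M" and "0 < \<eta>" "0 \<le> A" "M - \<eta> \<le> v x1"
      and weak: "\<And>x0 r. 0 < r \<Longrightarrow> cball x0 r \<subseteq> ball x1 \<rho> \<inter> {x. M - 2 * \<eta> < v x} \<Longrightarrow>
       \<exists>l. weak_lap \<alpha> v x0 r l \<and> - A * (\<integral>y. bump x0 r y \<partial>lborel) \<le> l"
    for v :: "'a \<Rightarrow> real" and B M \<eta> A x1
  proof (rule tendsto_upperbound[of _ _ "at_right 0"])
    have K': "\<bar>trunc_lap \<alpha> \<delta> (bump x1 r0) x\<bar> \<le> K" if "0 < \<delta>" for \<delta> x
      by (subst trunc_lap_bump_translate) (rule K(2)[OF that])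
    have "\<forall>\<^sub>F \<epsilon> in at_right 0. (\<integral>y. tkern \<alpha> (6 * r0) (y - x1) * (M - mollify \<epsilon> v y) \<partial>lborel)
      \<le> 2 powr (real DIM('a) + \<alpha>) * (A + \<eta> + 2 * exp 1 * \<eta> * K)"
      by (rule near_max_mollified[OF \<alpha> r0(1) v B M \<open>0 < \<eta>\<close> \<open>M - \<eta> \<le> v x1\<close> K'])
         (use weak r0(2) in simp_all)
    moreover have "A + \<eta> + 2 * exp 1 * \<eta> * K \<le> (1 + 2 * exp 1 * K) * (\<eta> + A)"
      using K(1) \<open>0 \<le> A\<close> by (simp add: algebra_simps)
    then have "2 powr (real DIM('a) + \<alpha>) * (A + \<eta> + 2 * exp 1 * \<eta> * K) \<le> C * (\<eta> + A)"
      unfolding C_def mult.assoc by (rule mult_left_mono) simp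
    ultimately show "\<forall>\<^sub>F \<epsilon> in at_right 0. (\<integral>y. tkern \<alpha> \<rho> (y - x1) * (M - mollify \<epsilon> v y) \<partial>lborel) \<le> C * (\<eta> + A)"
      unfolding r0(2) by (auto elim: eventually_mono order_trans)
    have vb [measurable]: "v \<in> borel_measurable borel"
      using v by (rule borel_measurable_continuous_onI)
    have k: "integrable lborel (\<lambda>y. tkern \<alpha> \<rho> (y - x1))"
      using lborel_integrable_translate[OF integrable_tkern[OF \<alpha> \<rho>], of "- x1"] by simp
    show "((\<lambda>\<epsilon>. \<integral>y. tkern \<alpha> \<rho> (y - x1) * (M - mollify \<epsilon> v y) \<partial>lborel)
        \<longlongrightarrow> (\<integral>y. tkern \<alpha> \<rho> (y - x1) * (M - v y) \<partial>lborel)) (at_right 0)"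
      unfolding tendsto_at_iff_sequentially comp_def
    proof (intro allI impI)
      fix X :: "nat \<Rightarrow> real"
      assume X: "\<forall>i. X i \<in> {0<..} - {0}" "X \<longlonglongrightarrow> 0"
      have Xf: "filterlim X (at_right 0) sequentially"
        using X by (auto simp: filterlim_at less_imp_neq[symmetric])
      have mb: "mollify (X n) v \<in> borel_measurable borel" for n
        using X by (intro borel_measurable_continuous_onI continuous_on_mollify[OF _ v B]) auto
      note [measurable] = mb
      show "(\<lambda>n. \<integral>y. tkern \<alpha> \<rho> (y - x1) * (M - mollify (X n) v y) \<partial>lborel)
        \<longlonglongrightarrow> (\<integral>y. tkern \<alpha> \<rho> (y - x1) * (M - v y) \<partial>lborel)"
      proof (rule integral_dominated_convergence[where w = "\<lambda>y. tkern \<alpha> \<rho> (y - x1) * (\<bar>M\<bar> + B)"])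
        show "AE y in lborel. (\<lambda>n. tkern \<alpha> \<rho> (y - x1) * (M - mollify (X n) v y))
            \<longlonglongrightarrow> tkern \<alpha> \<rho> (y - x1) * (M - v y)"
          by (intro AE_I2 tendsto_intros filterlim_compose[OF mollify_tendsto[OF v B] Xf])
        show "AE y in lborel. norm (tkern \<alpha> \<rho> (y - x1) * (M - mollify (X n) v y)) \<le> tkern \<alpha> \<rho> (y - x1) * (\<bar>M\<bar> + B)" for n
        proof (intro AE_I2)
          fix y
          have "\<bar>M - mollify (X n) v y\<bar> \<le> \<bar>M\<bar> + B"
            using mollify_bounded[OF _ vb B, of "X n" y] X(1) abs_triangle_ineq4[of M "mollify (X n) v y"]
            by (force intro: order_trans)
          then show "norm (tkern \<alpha> \<rho> (y - x1) * (M - mollify (X n) v y)) \<le> tkern \<alpha> \<rho> (y - x1) * (\<bar>M\<bar> + B)"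
            by (simp add: abs_mult mult_left_mono)
        qed
      qed (use k in auto)
    qed
  qed simp
  ultimately show ?thesis by (rule that)
qed

subsection \<open>Starshaped sets\<close>

lemma starshapedD: "starshaped A \<Longrightarrow> x \<in> A \<Longrightarrow> 0 \<le> s \<Longrightarrow> s \<le> 1 \<Longrightarrow> s *\<^sub>R x \<in> A"
  by (force simp: starshaped_def)

lemma starshaped_closure:
  fixes A :: "'a::real_normed_vector set"
  assumes "starshaped A"
  shows "starshaped (closure A)"
  unfolding starshaped_def
proof
  fix s :: real assume s: "s \<in> {0..1}"
  have "(\<lambda>x. s *\<^sub>R x) ` closure A \<subseteq> closure ((\<lambda>x. s *\<^sub>R x) ` A)"
    by (simp add: closure_scaleR)
  also have "\<dots> \<subseteq> closure A"
    using assms s unfolding starshaped_def by (intro closure_mono) auto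
  finally show "(\<lambda>x. s *\<^sub>R x) ` closure A \<subseteq> closure A" .
qed

text \<open>Apply starshapedness at the level \<open>b (t x)\<close>: that superlevel set contains
  \<open>t x\<close>, hence also \<open>x\<close>.\<close>

lemma starshaped_superlevel_scaleR_le:
  assumes "\<forall>l. starshaped (superlevel b l)" "1 \<le> t"
  shows "b (t *\<^sub>R x) \<le> b x"
proof -
  have "(1 / t) *\<^sub>R (t *\<^sub>R x) \<in> superlevel b (b (t *\<^sub>R x))"
    using assms by (intro starshapedD[of "superlevel b (b (t *\<^sub>R x))" "t *\<^sub>R x"]) (auto simp: superlevel_def)
  then show ?thesis
    using assms(2) by (simp add: superlevel_def)
qed

section \<open>Rays and frontiers\<close>

lemma scaleR_crosses_frontier:
  fixes x :: "'a::real_normed_vector"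
  assumes "a \<le> b" "(a *\<^sub>R x \<in> A) \<noteq> (b *\<^sub>R x \<in> A)"
  obtains t where "a \<le> t" "t \<le> b" "t *\<^sub>R x \<in> frontier A"
proof -
  have "connected ((\<lambda>t. t *\<^sub>R x) ` {a..b})"
    by (intro connected_continuous_image continuous_intros) auto
  moreover have "a *\<^sub>R x \<in> (\<lambda>t. t *\<^sub>R x) ` {a..b}" "b *\<^sub>R x \<in> (\<lambda>t. t *\<^sub>R x) ` {a..b}"
    using assms(1) by auto
  ultimately have "(\<lambda>t. t *\<^sub>R x) ` {a..b} \<inter> frontier A \<noteq> {}"
    using assms(2) by (intro connected_Int_frontier) blast+
  then show ?thesis using that by auto
qed

lemma bounded_scaleR_notin:
  fixes x :: "'a::real_normed_vector"
  assumes "bounded A" "x \<noteq> 0"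
  obtains T where "s \<le> T" "T *\<^sub>R x \<notin> A"
proof -
  obtain B where B: "\<And>y. y \<in> A \<Longrightarrow> norm y \<le> B"
    using assms(1) unfolding bounded_iff by blast
  define T where "T = max \<bar>s\<bar> ((\<bar>B\<bar> + 1) / norm x)"
  have "\<bar>B\<bar> + 1 \<le> T * norm x"
    using assms(2) by (simp add: T_def max_mult_distrib_right)
  moreover have "0 \<le> T" by (simp add: T_def)
  ultimately have "T *\<^sub>R x \<notin> A"
    using B[of "T *\<^sub>R x"] by auto
  moreover have "s \<le> T" by (simp add: T_def)
  ultimately show ?thesis using that by blast
qed

text \<open>Otherwise the ray through \<open>x\<close> meets the frontier twice: at a parameter at
  most \<open>s\<close>, on leaving the neighbourhood of 0, and at a parameter at least 1, since
  \<open>D\<close> is bounded or \<open>x\<close> is itself a frontier point.\<close>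

lemma strictly_starshaped_scaleR_mem:
  fixes D :: "'a::real_normed_vector set"
  assumes D: "strictly_starshaped D" "bounded D" "open D" and x: "x \<in> closure D" and s: "0 \<le> s" "s < 1"
  shows "s *\<^sub>R x \<in> D"
proof (rule ccontr)
  assume n: "s *\<^sub>R x \<notin> D"
  have 0: "0 \<in> D"
    using D(1) interior_subset by (auto simp: strictly_starshaped_def)
  with n have x0: "x \<noteq> 0" by auto
  obtain a where a: "0 \<le> a" "a \<le> s" "a *\<^sub>R x \<in> frontier D"
    using scaleR_crosses_frontier[of 0 s x D] s(1) n 0 by auto
  obtain b where b: "1 \<le> b" "b *\<^sub>R x \<in> frontier D"
  proof (cases "x \<in> D")
    case True
    obtain T where T: "1 \<le> T" "T *\<^sub>R x \<notin> D"
      using bounded_scaleR_notin[OF D(2) x0] by blast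
    with True show ?thesis
      using scaleR_crosses_frontier[of 1 T x D] that by auto
  next
    case False
    with x D(3) have "x \<in> frontier D"
      by (simp add: frontier_def interior_open)
    then show ?thesis using that[of 1] by simp
  qed
  have "\<exists>!y. y \<in> {t *\<^sub>R x |t. 0 \<le> t} \<and> y \<in> frontier D"
    using D(1) x0 by (simp add: strictly_starshaped_def)
  moreover have "a *\<^sub>R x \<in> {t *\<^sub>R x |t. 0 \<le> t}" "b *\<^sub>R x \<in> {t *\<^sub>R x |t. 0 \<le> t}"
    using a b by auto
  ultimately have "a *\<^sub>R x = b *\<^sub>R x"
    using a b by blast
  with x0 a b s show False by simp
qed

lemma strictly_starshaped_imp_starshaped:
  fixes D :: "'a::real_normed_vector set"
  assumes "strictly_starshaped D" "bounded D" "open D"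
  shows "starshaped D"
  unfolding starshaped_def
proof safe
  fix s :: real and x assume "s \<in> {0..1}" "x \<in> D"
  then show "s *\<^sub>R x \<in> D"
    using strictly_starshaped_scaleR_mem[OF assms, of x s] closure_subset[of D] by (cases "s = 1") auto
qed

subsection \<open>Comparison of a solution with its dilations\<close>

text \<open>The common ground of the three parts: the whole space is starshaped with empty frontier,
  and bounded open strictly starshaped sets are starshaped. (F2), (F3) and strictness enter lemma by
  lemma.\<close>

locale ring_solution =
  fixes \<alpha> :: real and D0 D1 :: "(real^'n) set"
    and f :: "real^'n \<Rightarrow> real \<Rightarrow> real" and b0 b1 u :: "real^'n \<Rightarrow> real"
  assumes alpha: "0 < \<alpha>" "\<alpha> < 2"
    and D: "open D0" "open D1" "0 \<in> D1" "closure D1 \<subseteq> D0" "bounded D1"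
    and star_D: "starshaped D0" "starshaped D1"
    and frontier_b: "\<forall>x\<in>frontier D1. b1 x = 1" "\<forall>x\<in>frontier D0. b0 x = 0"
    and star_b: "\<forall>l. starshaped (superlevel b0 l)" "\<forall>l. starshaped (superlevel b1 l)"
    and F0: "F0 (D0 - closure D1) f" and F1: "F1 \<alpha> (D0 - closure D1) f"
    and sol: "solution \<alpha> D0 D1 f b0 b1 u"
    and u01: "\<forall>x\<in>D0 - closure D1. 0 \<le> u x \<and> u x \<le> 1"
begin

abbreviation "\<Omega> \<equiv> D0 - closure D1"

section \<open>Boundary data and comparison outside the ring\<close>

lemma open_\<Omega>: "open \<Omega>"
  using D(1) by (intro open_Diff) auto

lemma cont_u: "continuous_on A u"
  using sol continuous_on_subset unfolding solution_def by blast

lemma cont_u_scale: "continuous_on A (\<lambda>x. u (t *\<^sub>R x))"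
  by (rule continuous_on_compose2[OF cont_u[of UNIV]]) (auto intro!: continuous_intros)

lemma u_measurable [measurable]: "u \<in> borel_measurable borel"
  by (rule borel_measurable_continuous_onI[OF cont_u])

lemma u_bounded: obtains B where "\<And>x. \<bar>u x\<bar> \<le> B"
  using sol unfolding solution_def bounded_iff by auto

lemma zero_in_D0: "0 \<in> D0"
  using D(3,4) closure_subset[of D1] by blast

text \<open>Follow the ray through \<open>x\<close> outward to the frontier of \<open>D1\<close>,
  where \<open>b1 = 1\<close>; starshapedness of the superlevel set at level 1 carries the bound
  back. The origin determines no ray, so an arbitrary direction is chosen for it.\<close>

lemma u_ge_1:
  assumes "x \<in> closure D1" shows "1 \<le> u x"
proof -
  have "1 \<le> b1 x"
  proof (cases "x = 0")
    case True
    obtain e :: "real^'n" where "e \<noteq> 0"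
      by (metis one_neq_zero zero_index one_index)
    then obtain T where T: "0 \<le> T" "T *\<^sub>R e \<notin> D1"
      using bounded_scaleR_notin[OF D(5)] by blast
    then obtain t where "0 \<le> t" "t *\<^sub>R e \<in> frontier D1"
      using scaleR_crosses_frontier[of 0 T e D1] D(3) by auto
    then have "t *\<^sub>R e \<in> superlevel b1 1"
      using frontier_b by (auto simp: superlevel_def)
    then have "0 *\<^sub>R (t *\<^sub>R e) \<in> superlevel b1 1"
      using star_b(2) by (intro starshapedD[of _ "t *\<^sub>R e"]) auto
    with True show ?thesis by (simp add: superlevel_def)
  next
    case False
    have "\<exists>t\<ge>1. t *\<^sub>R x \<in> frontier D1"
    proof (cases "x \<in> D1")
      case True
      obtain T where "1 \<le> T" "T *\<^sub>R x \<notin> D1"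
        using bounded_scaleR_notin[OF D(5) False] by blast
      with True show ?thesis
        using scaleR_crosses_frontier[of 1 T x D1] by (metis scaleR_one)
    next
      case False
      with assms D(2) have "x \<in> frontier D1"
        by (simp add: frontier_def interior_open)
      then show ?thesis by (intro exI[of _ 1]) simp
    qed
    then obtain t where "1 \<le> t" "t *\<^sub>R x \<in> frontier D1" by blast
    then show ?thesis
      using starshaped_superlevel_scaleR_le[OF star_b(2), of t x] frontier_b(1) by simp
  qed
  with assms sol show ?thesis by (simp add: solution_def)
qed

text \<open>If \<open>b0 x\<close> were positive, the superlevel set at level \<open>b0 x\<close>
  would contain the segment from 0 to \<open>x\<close>; this segment crosses the frontier of
  \<open>D0\<close>, where \<open>b0 = 0\<close>.\<close>

lemma u_le_0:
  assumes "x \<notin> D0" shows "u x \<le> 0"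
proof (rule ccontr)
  assume "\<not> u x \<le> 0"
  then have pos: "0 < b0 x"
    using assms sol by (simp add: solution_def)
  obtain t where t: "0 \<le> t" "t \<le> 1" "t *\<^sub>R x \<in> frontier D0"
    using scaleR_crosses_frontier[of 0 1 x D0] assms zero_in_D0 by auto
  have "t *\<^sub>R x \<in> superlevel b0 (b0 x)"
    using t star_b(1) by (intro starshapedD) (auto simp: superlevel_def)
  with pos t(3) frontier_b(2) show False by (simp add: superlevel_def)
qed

text \<open>If both points lie in the closure of \<open>D1\<close>, or both outside
  \<open>D0\<close>, the data are compared with themselves. In the mixed cases the values are
  separated by 1 or by 0. Hence a positive difference forces both points into the ring, where the
  equation is available.\<close>

lemma u_scaleR_le_outside:
  assumes "1 \<le> t" "\<not> (x \<in> \<Omega> \<and> t *\<^sub>R x \<in> \<Omega>)"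
  shows "u (t *\<^sub>R x) \<le> u x"
proof -
  have pull: "x \<in> A" if "starshaped A" "t *\<^sub>R x \<in> A" for A
    using starshapedD[OF that, of "1 / t"] assms(1) by simp
  have ub0: "u y = b0 y" if "y \<notin> D0" for y
    using sol that by (simp add: solution_def)
  have ub1: "u y = b1 y" if "y \<in> closure D1" for y
    using sol that by (simp add: solution_def)
  consider "t *\<^sub>R x \<in> closure D1" | "x \<in> closure D1" "t *\<^sub>R x \<notin> closure D1" | "x \<notin> D0" | "x \<in> \<Omega>" "t *\<^sub>R x \<notin> D0"
    using assms(2) by blast
  then show ?thesis
  proof cases
    case 1
    with pull[OF starshaped_closure[OF star_D(2)]] have "x \<in> closure D1" by blast
    with 1 show ?thesis
      using starshaped_superlevel_scaleR_le[OF star_b(2) assms(1), of x] by (simp add: ub1)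
  next
    case 2
    have "u (t *\<^sub>R x) \<le> 1"
      using 2(2) u01 u_le_0[of "t *\<^sub>R x"] by (cases "t *\<^sub>R x \<in> D0") auto
    with u_ge_1[OF 2(1)] show ?thesis by simp
  next
    case 3
    with pull[OF star_D(1)] have "t *\<^sub>R x \<notin> D0" by blast
    with 3 show ?thesis
      using starshaped_superlevel_scaleR_le[OF star_b(1) assms(1), of x] by (simp add: ub0)
  next
    case 4
    with u_le_0[OF 4(2)] u01 show ?thesis by force
  qed
qed

section \<open>The nonlinearity and the equation for dilation differences\<close>

lemma nonlinearity_measurable:
  "(\<lambda>x. indicator \<Omega> x * f x (u x)) \<in> borel_measurable borel"
proof -
  have "(\<lambda>x. (x, u x)) \<in> restrict_space borel \<Omega> \<rightarrow>\<^sub>M restrict_space borel (\<Omega> \<times> {0..1})"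
    using u01 by (intro measurable_restrict_space2 measurable_restrict_space1)
      (auto simp: space_restrict_space simp flip: borel_prod)
  moreover have "(\<lambda>(x, v). f x v) \<in> borel_measurable (restrict_space borel (\<Omega> \<times> {0..1}))"
    using F0 by (simp add: F0_def)
  ultimately have "(\<lambda>x. (\<lambda>(x, v). f x v) (x, u x)) \<in> borel_measurable (restrict_space borel \<Omega>)"
    by (rule measurable_compose)
  then have "(\<lambda>x. f x (u x)) \<in> borel_measurable (restrict_space borel \<Omega>)"
    by simp
  then show ?thesis
    using open_\<Omega> by (subst (asm) borel_measurable_restrict_space_iff) auto
qed

lemma nonlinearity_bounded:
  obtains K where "\<And>x. \<bar>indicator \<Omega> x * f x (u x)\<bar> \<le> K"
proof -
  obtain K where K: "\<And>x v. x \<in> \<Omega> \<Longrightarrow> v \<in> {0..1} \<Longrightarrow> \<bar>f x v\<bar> \<le> K"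
    using F0 unfolding F0_def bounded_iff by fastforce
  have "\<bar>indicator \<Omega> x * f x (u x)\<bar> \<le> max K 0" for x
    using K[of x "u x"] u01 by (auto simp: indicator_def)
  then show ?thesis by (rule that)
qed

text \<open>(F1) reduces the right-hand side to a difference of \<open>f\<close> at one point
  \<open>x\<close> and two values of \<open>u\<close>. The bound \<open>A\<close> leaves open how
  that difference is estimated: it will be 0 under (F3) and a multiple of \<eta> under (F2).\<close>

lemma weak_lap_dilation_difference:
  assumes t: "1 \<le> t" and r: "0 < r" and sub: "cball x0 r \<subseteq> {x \<in> \<Omega>. t *\<^sub>R x \<in> \<Omega>}"
    and A: "\<And>x. x \<in> cball x0 r \<Longrightarrow> - A \<le> f x (u (t *\<^sub>R x)) - f x (u x)"
  obtains l where "weak_lap \<alpha> (\<lambda>x. u (t *\<^sub>R x) - u x) x0 r l"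
    "- (A / frac_const CARD('n) \<alpha>) * (\<integral>x. bump x0 r x \<partial>lborel) \<le> l"
proof -
  let ?c = "frac_const CARD('n) \<alpha>"
  have c: "0 < ?c" by (rule frac_const_pos[OF alpha])
  \<comment> \<open>Extension by zero makes the right-hand side globally measurable and bounded, so
    it can be dilated without tracking domains.\<close>
  define g where "g x = indicator \<Omega> x * f x (u x)" for x
  have g [measurable]: "g \<in> borel_measurable borel"
    unfolding g_def by (rule nonlinearity_measurable)
  obtain K where K: "\<And>x. \<bar>g x\<bar> \<le> K"
    unfolding g_def using nonlinearity_bounded by blast
  obtain B where B: "\<And>x. \<bar>u x\<bar> \<le> B" using u_bounded by blast
  have eq: "(LINT x:\<Omega>|lborel. f x (u x) * bump y s x) = (\<integral>x. g x * bump y s x \<partial>lborel)" for y s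
    by (simp add: set_lebesgue_integral_def g_def mult.assoc)
  have sub': "cball (t *\<^sub>R x0) (t * r) \<subseteq> \<Omega>"
  proof
    fix y assume y: "y \<in> cball (t *\<^sub>R x0) (t * r)"
    have "t * dist x0 ((1 / t) *\<^sub>R y) = dist (t *\<^sub>R x0) y"
    proof -
      have "t *\<^sub>R x0 - y = t *\<^sub>R (x0 - (1 / t) *\<^sub>R y)"
        using t by (simp add: scaleR_diff_right)
      then show ?thesis using t by (simp add: dist_norm)
    qed
    with y have "t * dist x0 ((1 / t) *\<^sub>R y) \<le> t * r"
      by simp
    with t have "(1 / t) *\<^sub>R y \<in> cball x0 r"
      by (simp del: dist_commute)
    with sub t show "y \<in> \<Omega>" by force
  qed
  have sub0: "cball x0 r \<subseteq> \<Omega>" using sub by blast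
  have w1: "weak_lap \<alpha> (\<lambda>x. u (t *\<^sub>R x)) x0 r (t powr \<alpha> / t ^ DIM(real^'n) *
      ((\<integral>x. g x * bump (t *\<^sub>R x0) (t * r) x \<partial>lborel) / ?c))"
    using t r solution_weak_lap[OF alpha sol _ sub'] by (intro weak_lap_scale) (auto simp: eq)
  have w2: "weak_lap \<alpha> u x0 r ((\<integral>x. g x * bump x0 r x \<partial>lborel) / ?c)"
    using solution_weak_lap[OF alpha sol r sub0] by (simp add: eq)
  \<comment> \<open>This Jacobian cancels the denominator in \<open>w1\<close> and leaves exactly
    the factor \<open>t powr \<alpha>\<close> of (F1).\<close>
  have scaled: "(\<integral>x. g x * bump (t *\<^sub>R x0) (t * r) x \<partial>lborel)
      = t ^ DIM(real^'n) * (\<integral>x. g (t *\<^sub>R x) * bump x0 r x \<partial>lborel)"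
    using lborel_integral_affine[of t "\<lambda>x. g x * bump (t *\<^sub>R x0) (t * r) x" 0] t
    by (simp add: bump_scaleR[of t x0 r, symmetric])
  define l where "l = (t powr \<alpha> * (\<integral>x. g (t *\<^sub>R x) * bump x0 r x \<partial>lborel) - (\<integral>x. g x * bump x0 r x \<partial>lborel)) / ?c"
  have "weak_lap \<alpha> (\<lambda>x. u (t *\<^sub>R x) - u x) x0 r l"
    using weak_lap_diff[OF alpha r _ _ _ _ w1 w2, of B B] B t
    by (simp add: scaled l_def diff_divide_distrib)
  moreover have "- (A / ?c) * (\<integral>x. bump x0 r x \<partial>lborel) \<le> l"
  proof -
    have int1: "integrable lborel (\<lambda>x. g (t *\<^sub>R x) * bump x0 r x)"
      by (rule integrable_mult_bump[OF r _ K]) measurable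
    have "(\<integral>x. - A * bump x0 r x \<partial>lborel)
        \<le> (\<integral>x. t powr \<alpha> * (g (t *\<^sub>R x) * bump x0 r x) - g x * bump x0 r x \<partial>lborel)"
    proof (rule integral_mono)
      fix x
      show "- A * bump x0 r x \<le> t powr \<alpha> * (g (t *\<^sub>R x) * bump x0 r x) - g x * bump x0 r x"
      proof (cases "x \<in> cball x0 r")
        case True
        then have x: "x \<in> \<Omega>" "t *\<^sub>R x \<in> \<Omega>" using sub by auto
        then have "f x (u (t *\<^sub>R x)) \<le> t powr \<alpha> * f (t *\<^sub>R x) (u (t *\<^sub>R x))"
          using F1 t u01 unfolding F1_def by auto
        with A[OF True] x have "- A \<le> t powr \<alpha> * g (t *\<^sub>R x) - g x"
          by (simp add: g_def)
        then have "- A * bump x0 r x \<le> (t powr \<alpha> * g (t *\<^sub>R x) - g x) * bump x0 r x"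
          by (rule mult_right_mono) simp
        then show ?thesis by (simp add: algebra_simps)
      next
        case False
        then show ?thesis
          using bump_eq_0[OF r, of x x0] by (simp add: dist_norm norm_minus_commute)
      qed
    qed (use int1 integrable_mult_bump[OF r g K, of x0] integrable_bump[OF r, of x0] in auto)
    also have "\<dots> = t powr \<alpha> * (\<integral>x. g (t *\<^sub>R x) * bump x0 r x \<partial>lborel) - (\<integral>x. g x * bump x0 r x \<partial>lborel)"
      using int1 integrable_mult_bump[OF r g K, of x0] by simp
    finally have "(\<integral>x. - A * bump x0 r x \<partial>lborel) / ?c \<le> l"
      unfolding l_def using c by (intro divide_right_mono) auto
    then show ?thesis by simp
  qed
  ultimately show ?thesis by (rule that)
qed

text \<open>
  If \<open>u (t x) - u x\<close> had a positive supremum \<open>M\<close>, then by the maximum principle it would be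
  close to \<open>M\<close> on most of an annulus around a near-maximum point, at the scale of that point. Along
  a geometric progression with ratio \<open>t\<close> the differences telescope, so \<open>u\<close> would be unbounded.
\<close>

lemma u_scaleR_le:
  assumes F3: "F3 \<Omega> f" and t: "1 \<le> t"
  shows "u (t *\<^sub>R x) \<le> u x"
proof (rule ccontr)
  assume neg: "\<not> u (t *\<^sub>R x) \<le> u x"
  let ?N = "real DIM(real^'n)"
  obtain B where B: "\<And>x. \<bar>u x\<bar> \<le> B" using u_bounded by blast
  have B0: "0 \<le> B" using B[of 0] by linarith
  define v where "v x = u (t *\<^sub>R x) - u x" for x
  have vB: "\<bar>v x\<bar> \<le> 2 * B" for x
    using B[of x] B[of "t *\<^sub>R x"] unfolding v_def by linarith
  have v_cont: "continuous_on A v" for A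
    unfolding v_def[abs_def] by (intro continuous_intros cont_u cont_u_scale)
  define M where "M = (SUP x. v x)"
  have bdd: "bdd_above (range v)"
    using vB by (intro bdd_aboveI[of _ "2 * B"]) (auto simp: abs_le_iff)
  have M: "v x \<le> M" for x
    unfolding M_def by (rule cSUP_upper[OF UNIV_I bdd])
  have M0: "0 < M" using neg M[of x] by (simp add: v_def)
  \<comment> \<open>The sum of \<open>k\<close> consecutive differences telescopes to at most 2B,
    whereas \<open>k\<close> values close to \<open>M\<close> would add up to nearly 2B + 1 or
    more.\<close>
  obtain k :: nat where k: "2 * B + 1 \<le> k * M"
    using reals_Archimedean3[OF M0, rule_format, of "2 * B + 1"] less_imp_le by blast
  then have k0: "0 < k" using B0 by (intro Nat.gr0I) auto
  \<comment> \<open>Points \<open>t ^ j y\<close> with |y| < 4 and j < k lie within 4 t^k + 1 \<le>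
    R of a unit vector; \<kappa> bounds the kernel from below there.\<close>
  define R where "R = 5 * t ^ k"
  define \<kappa> where "\<kappa> = 1 / R powr (?N + \<alpha>)"
  have R: "0 < R" and \<kappa>: "0 < \<kappa>" using t by (auto simp: R_def \<kappa>_def)
  define V where "V = unit_ball_vol ?N"
  have V: "0 < V" by (simp add: V_def)
  obtain C where C: "0 < C" "\<And>(v::real^'n \<Rightarrow> real) B M \<eta> A x1.
    \<lbrakk>continuous_on UNIV v; \<And>x. \<bar>v x\<bar> \<le> B; \<And>x. v x \<le> M; 0 < \<eta>; 0 \<le> A; M - \<eta> \<le> v x1;
     \<And>x0 r. 0 < r \<Longrightarrow> cball x0 r \<subseteq> ball x1 1 \<inter> {x. M - 2 * \<eta> < v x} \<Longrightarrow>
       \<exists>l. weak_lap \<alpha> v x0 r l \<and> - A * (\<integral>y. bump x0 r y \<partial>lborel) \<le> l\<rbrakk>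
    \<Longrightarrow> (\<integral>y. tkern \<alpha> 1 (y - x1) * (M - v y) \<partial>lborel) \<le> C * (\<eta> + A)"
    by (rule near_max_integral_bound[OF alpha zero_less_one]) blast
  \<comment> \<open>The first bound keeps M - 2\<eta> positive; the second makes the sum of
    \<open>k\<close> annulus estimates at most half the volume of the unit ball.\<close>
  define \<eta> where "\<eta> = min (M / 4) (V * \<kappa> / (2 * k * C))"
  have \<eta>: "0 < \<eta>" using M0 V \<kappa> k0 C(1) by (simp add: \<eta>_def)
  have \<eta>M: "4 * \<eta> \<le> M" by (simp add: \<eta>_def)
  have \<eta>V: "k * (C * \<eta> / \<kappa>) \<le> V / 2"
  proof -
    have "\<eta> \<le> V * \<kappa> / (2 * k * C)" by (simp add: \<eta>_def)
    then show ?thesis using k0 C(1) \<kappa> by (simp add: field_simps)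
  qed
  obtain x1 where x1: "M - \<eta> < v x1"
    using less_cSUP_iff[OF _ bdd, of "M - \<eta>"] \<eta> by (auto simp: M_def)
  have "x1 \<noteq> 0"
    using x1 \<eta>M M0 by (auto simp: v_def)
  \<comment> \<open>The position of \<open>x1\<close> is not controlled. Rescaling by its norm lets
    the constant \<open>C\<close> for radius 1, fixed beforehand, apply in all cases.\<close>
  define s where "s = norm x1"
  have s: "0 < s" using \<open>x1 \<noteq> 0\<close> by (simp add: s_def)
  define e where "e = (1 / s) *\<^sub>R x1"
  have e: "norm e = 1" "s *\<^sub>R e = x1" using s by (auto simp: e_def s_def)
  define w where "w y = v (s *\<^sub>R y)" for y
  have w_cont: "continuous_on UNIV w"
    unfolding w_def[abs_def]
    by (rule continuous_on_compose2[OF v_cont[of UNIV]]) (auto intro!: continuous_intros)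
  have [measurable]: "w \<in> borel_measurable borel" "v \<in> borel_measurable borel"
    using w_cont v_cont by (auto intro: borel_measurable_continuous_onI)
  have wB: "\<bar>w y\<bar> \<le> 2 * B" and wM: "w y \<le> M" for y
    unfolding w_def by (rule vB M)+
  have weak: "\<exists>l. weak_lap \<alpha> w x0 r l \<and> - 0 * (\<integral>y. bump x0 r y \<partial>lborel) \<le> l"
    if r: "0 < r" "cball x0 r \<subseteq> ball e 1 \<inter> {x. M - 2 * \<eta> < w x}" for x0 r
  proof -
    \<comment> \<open>The testing region of the maximum principle thus lies where \<open>v\<close>
      is positive. There both points belong to the ring, and (F3) makes the difference of
      \<open>f\<close> nonnegative.\<close>
    have vpos: "0 < v y" if y: "y \<in> cball (s *\<^sub>R x0) (s * r)" for y
    proof -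
      have "s *\<^sub>R x0 - y = s *\<^sub>R (x0 - (1 / s) *\<^sub>R y)"
        using s by (simp add: scaleR_diff_right)
      then have "s * dist x0 ((1 / s) *\<^sub>R y) \<le> s * r"
        using y s by (simp add: dist_norm)
      then have "(1 / s) *\<^sub>R y \<in> cball x0 r" using s by simp
      then have "M - 2 * \<eta> < w ((1 / s) *\<^sub>R y)" using r(2) by blast
      then show ?thesis using \<eta>M M0 s by (simp add: w_def)
    qed
    have mem: "y \<in> \<Omega>" "t *\<^sub>R y \<in> \<Omega>" if "y \<in> cball (s *\<^sub>R x0) (s * r)" for y
      using vpos[OF that] u_scaleR_le_outside[OF t, of y] by (auto simp: v_def)
    then have sub: "cball (s *\<^sub>R x0) (s * r) \<subseteq> {y \<in> \<Omega>. t *\<^sub>R y \<in> \<Omega>}"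
      by blast
    have ge: "- 0 \<le> f y (u (t *\<^sub>R y)) - f y (u y)" if y: "y \<in> cball (s *\<^sub>R x0) (s * r)" for y
      using F3 mem[OF y] vpos[OF y] u01 unfolding F3_def v_def by auto
    obtain l where l: "weak_lap \<alpha> v (s *\<^sub>R x0) (s * r) l"
        "- (0 / frac_const CARD('n) \<alpha>) * (\<integral>x. bump (s *\<^sub>R x0) (s * r) x \<partial>lborel) \<le> l"
      using weak_lap_dilation_difference[OF t mult_pos_pos[OF s r(1)] sub ge]
      unfolding v_def[abs_def] by blast
    have "weak_lap \<alpha> w x0 r (s powr \<alpha> / s ^ DIM(real^'n) * l)"
      unfolding w_def[abs_def] by (rule weak_lap_scale[OF s _ l(1)]) measurable
    with l(2) s show ?thesis by auto
  qed
  have "M - \<eta> \<le> w e" using x1 e by (simp add: w_def)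
  from C(2)[OF w_cont wB wM \<eta> order_refl this weak]
  have key: "(\<integral>y. tkern \<alpha> 1 (y - e) * (M - w y) \<partial>lborel) \<le> C * \<eta>" by simp
  \<comment> \<open>Points of \<open>E\<close> have norm between 2 and 4, so their multiples by
    factors at least 1 stay at distance more than 1 from \<open>e\<close>, where the truncated
    kernel is positive.\<close>
  define E where "E = ball (3 *\<^sub>R e) 1"
  have E_int: "integrable lborel (indicator E :: _ \<Rightarrow> real)"
    unfolding E_def by (rule integrable_real_indicator) (use emeasure_lborel_ball_finite in auto)
  have MwB: "\<bar>M - w y\<bar> \<le> M + 2 * B" for y
    using wB[of y] M0 by linarith
  have E_int': "integrable lborel (\<lambda>y. indicator E y * (M - w (a *\<^sub>R y)))" for a
    by (rule integrable_mult_bounded[OF E_int _ MwB]) measurable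
  have k_int: "integrable lborel (\<lambda>y. tkern \<alpha> 1 (y - e) * (M - w y))"
  proof (rule integrable_mult_bounded[OF _ _ MwB])
    show "integrable lborel (\<lambda>y. tkern \<alpha> 1 (y - e))"
      using lborel_integrable_translate[OF integrable_tkern[OF alpha zero_less_one], of "- e"] by simp
  qed measurable
  have part: "(\<integral>y. indicator E y * (M - w (t ^ j *\<^sub>R y)) \<partial>lborel) \<le> C * \<eta> / \<kappa>" if j: "j < k" for j
  proof -
    let ?T = "t ^ j"
    have T: "1 \<le> ?T" "?T \<le> t ^ k" "0 < ?T"
      using t j by (auto intro: power_increasing)
    have pos: "0 \<le> tkern \<alpha> 1 (y - e) * (M - w y)" for y
      using wM[of y] by simp
    have k_int': "integrable lborel (\<lambda>y. tkern \<alpha> 1 (?T *\<^sub>R y - e) * (M - w (?T *\<^sub>R y)))"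
      using lborel_integrable_affine[OF less_imp_neq[OF T(3), symmetric] k_int, of 0] by simp
    have "\<kappa> * (\<integral>y. indicator E y * (M - w (?T *\<^sub>R y)) \<partial>lborel)
        = (\<integral>y. \<kappa> * (indicator E y * (M - w (?T *\<^sub>R y))) \<partial>lborel)"
      by simp
    also have "\<dots> \<le> (\<integral>y. tkern \<alpha> 1 (?T *\<^sub>R y - e) * (M - w (?T *\<^sub>R y)) \<partial>lborel)"
    proof (rule integral_mono[OF integrable_mult_right[OF E_int'] k_int'])
      fix y
      show "\<kappa> * (indicator E y * (M - w (?T *\<^sub>R y))) \<le> tkern \<alpha> 1 (?T *\<^sub>R y - e) * (M - w (?T *\<^sub>R y))"
      proof (cases "y \<in> E")
        case True
        have "norm (3 *\<^sub>R e - y) < 1" using True by (simp add: E_def dist_norm)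
        then have y: "2 < norm y" "norm y < 4"
          using norm_triangle_ineq2[of "3 *\<^sub>R e" y] norm_triangle_ineq2[of y "3 *\<^sub>R e"] e(1)
          by (auto simp: norm_minus_commute)
        have n: "norm (?T *\<^sub>R y) = ?T * norm y" using T by simp
        have "1 * norm y \<le> ?T * norm y" using T by (intro mult_right_mono) auto
        then have lower: "1 < norm (?T *\<^sub>R y - e)"
          using norm_triangle_ineq2[of "?T *\<^sub>R y" e] y e(1) n by linarith
        have "?T * norm y \<le> t ^ k * 4" using T y by (intro mult_mono) auto
        then have upper: "norm (?T *\<^sub>R y - e) \<le> R"
          using norm_triangle_ineq4[of "?T *\<^sub>R y" e] e(1) n T by (simp add: R_def)
        have "\<kappa> \<le> kern \<alpha> (?T *\<^sub>R y - e)"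
          unfolding \<kappa>_def kern_def using lower upper alpha
          by (intro divide_left_mono powr_mono2 mult_pos_pos) auto
        with True lower wM[of "?T *\<^sub>R y"] show ?thesis
          by (simp add: tkern_def mult_right_mono)
      next
        case False
        then show ?thesis using wM[of "?T *\<^sub>R y"] by simp
      qed
    qed
    also have "\<dots> = 1 * (\<integral>y. tkern \<alpha> 1 (?T *\<^sub>R y - e) * (M - w (?T *\<^sub>R y)) \<partial>lborel)" by simp
    \<comment> \<open>The factor is at least 1 and the integral nonnegative; it is inserted to match
      the Jacobian of the dilation by \<open>?T\<close>.\<close>
    also have "\<dots> \<le> ?T ^ DIM(real^'n) * (\<integral>y. tkern \<alpha> 1 (?T *\<^sub>R y - e) * (M - w (?T *\<^sub>R y)) \<partial>lborel)"
      using T t wM by (intro mult_right_mono Bochner_Integration.integral_nonneg one_le_power) auto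
    also have "\<dots> = (\<integral>y. tkern \<alpha> 1 (y - e) * (M - w y) \<partial>lborel)"
      using lborel_integral_affine[of ?T "\<lambda>y. tkern \<alpha> 1 (y - e) * (M - w y)" 0]
        less_imp_neq[OF T(3), symmetric] T by simp
    also note key
    finally show ?thesis
      using \<kappa> by (simp add: field_simps)
  qed
  \<comment> \<open>This pointwise lower bound, integrated over \<open>E\<close>, contradicts the
    sum of the estimates \<open>part\<close>, which is at most half the volume of
    \<open>E\<close>.\<close>
  have sum_ge: "1 \<le> (\<Sum>j<k. M - w (t ^ j *\<^sub>R y))" for y
  proof -
    have "(\<Sum>j<k. w (t ^ j *\<^sub>R y)) = (\<Sum>j<k. u ((s * t ^ Suc j) *\<^sub>R y) - u ((s * t ^ j) *\<^sub>R y))"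
      by (simp add: w_def v_def mult_ac)
    also have "\<dots> = u ((s * t ^ k) *\<^sub>R y) - u ((s * t ^ 0) *\<^sub>R y)"
      by (rule sum_lessThan_telescope)
    also have "\<dots> \<le> 2 * B"
      using B[of "(s * t ^ k) *\<^sub>R y"] B[of "(s * t ^ 0) *\<^sub>R y"] by linarith
    finally show ?thesis using k by (simp add: sum_subtractf)
  qed
  have "V = (\<integral>y. indicator E y \<partial>lborel)"
    by (simp add: V_def E_def content_ball)
  also have "\<dots> \<le> (\<integral>y. (\<Sum>j<k. indicator E y * (M - w (t ^ j *\<^sub>R y))) \<partial>lborel)"
  proof (rule integral_mono[OF E_int])
    show "indicator E y \<le> (\<Sum>j<k. indicator E y * (M - w (t ^ j *\<^sub>R y)))" for y
      using sum_ge[of y] by (auto simp: indicator_def)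
    show "integrable lborel (\<lambda>y. \<Sum>j<k. indicator E y * (M - w (t ^ j *\<^sub>R y)))"
      by (intro Bochner_Integration.integrable_sum E_int')
  qed
  also have "\<dots> = (\<Sum>j<k. \<integral>y. indicator E y * (M - w (t ^ j *\<^sub>R y)) \<partial>lborel)"
    using E_int' by (rule Bochner_Integration.integral_sum)
  also have "\<dots> \<le> (\<Sum>j<k. C * \<eta> / \<kappa>)"
    by (intro sum_mono part) auto
  also have "\<dots> \<le> V / 2"
    using \<eta>V by simp
  finally show False using V by simp
qed

lemma starshaped_superlevel_u:
  assumes "F3 \<Omega> f" "l < 1"
  shows "starshaped (superlevel u l)"
  unfolding starshaped_def
proof safe
  fix s :: real and x assume s: "s \<in> {0..1}" and x: "x \<in> superlevel u l"
  show "s *\<^sub>R x \<in> superlevel u l"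
  proof (cases "s = 0")
    case True
    have "0 \<in> closure D1" using D(3) closure_subset[of D1] by blast
    with u_ge_1[of 0] assms(2) True show ?thesis by (simp add: superlevel_def)
  next
    case False
    with s have "u ((1 / s) *\<^sub>R (s *\<^sub>R x)) \<le> u (s *\<^sub>R x)"
      by (intro u_scaleR_le[OF assms(1)]) auto
    with x False show ?thesis by (simp add: superlevel_def)
  qed
qed

text \<open>
  The largest \<open>t\<close> for which the strict inequality fails gives a touching point of \<open>u (t x)\<close> and
  \<open>u x\<close>. Strict starshapedness puts it inside the ring, where the maximum principle forces
  \<open>u (t x) = u x\<close> away from that point.
\<close>

lemma u_scaleR_less:
  assumes bdd: "bounded D0" and strict: "strictly_starshaped D0" "strictly_starshaped D1"
    and F2: "F2 \<Omega> f" and u01': "\<forall>x\<in>\<Omega>. 0 < u x \<and> u x < 1"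
    and t: "1 < t" and x: "x \<in> closure \<Omega>" "t *\<^sub>R x \<in> closure \<Omega>"
  shows "u (t *\<^sub>R x) < u x"
proof (rule ccontr)
  assume neg: "\<not> u (t *\<^sub>R x) < u x"
  \<comment> \<open>Closures of the ring and a non-strict inequality make the set of failures
    closed, so a largest dilation factor is attained.\<close>
  define P where "P = {p. t \<le> fst p \<and> snd p \<in> closure \<Omega> \<and> fst p *\<^sub>R snd p \<in> closure \<Omega>
    \<and> u (snd p) \<le> u (fst p *\<^sub>R snd p)}"
  have disj: "closure \<Omega> \<inter> D1 = {}"
  proof -
    have "\<Omega> \<inter> D1 = {}" using closure_subset[of D1] by blast
    then show ?thesis using D(2) open_Int_closure_eq_empty[of D1 \<Omega>] by blast
  qed
  have cl_sub: "closure \<Omega> \<subseteq> closure D0" by (rule closure_mono) blast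
  have "closed P"
  proof -
    have "P = {p. t \<le> fst p} \<inter> (snd -` closure \<Omega>) \<inter> ((\<lambda>p. fst p *\<^sub>R snd p) -` closure \<Omega>)
        \<inter> {p. u (snd p) \<le> u (fst p *\<^sub>R snd p)}"
      by (auto simp: P_def)
    moreover have "closed {p :: real \<times> (real^'n). t \<le> fst p}"
      by (intro closed_Collect_le continuous_intros)
    moreover have "closed (snd -` closure \<Omega> :: (real \<times> (real^'n)) set)"
      by (intro closed_vimage continuous_intros) auto
    moreover have "closed ((\<lambda>p. fst p *\<^sub>R snd p) -` closure \<Omega>)"
      by (intro closed_vimage continuous_intros) auto
    moreover have "closed {p. u (snd p) \<le> u (fst p *\<^sub>R snd p)}"
      by (intro closed_Collect_le continuous_on_compose2[OF cont_u[of UNIV]] continuous_intros) auto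
    ultimately show ?thesis by (simp add: closed_Int)
  qed
  moreover have "bounded P"
  proof -
    have "bounded (closure \<Omega>)"
      using bdd by (intro bounded_closure bounded_subset[OF bdd]) auto
    then obtain B where B: "\<And>y. y \<in> closure \<Omega> \<Longrightarrow> norm y \<le> B"
      unfolding bounded_iff by blast
    obtain d where d: "0 < d" "ball 0 d \<subseteq> D1"
      using D(2,3) open_contains_ball by blast
    \<comment> \<open>The dilation factor is bounded because the closure of the ring is bounded and
      stays outside a ball around 0.\<close>
    have "P \<subseteq> {t..B / d} \<times> closure \<Omega>"
    proof
      fix p assume p: "p \<in> P"
      then have "snd p \<notin> ball 0 d" using disj d(2) by (auto simp: P_def)
      then have n: "d \<le> norm (snd p)" by simp
      have fp: "0 \<le> fst p" using p t by (simp add: P_def)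
      have "fst p * d \<le> fst p * norm (snd p)" using n fp by (rule mult_left_mono)
      also have "\<dots> = norm (fst p *\<^sub>R snd p)" using fp by simp
      also have "\<dots> \<le> B" using p by (intro B) (simp add: P_def)
      finally have "fst p \<le> B / d" using d(1) by (simp add: field_simps)
      with p show "p \<in> {t..B / d} \<times> closure \<Omega>"
        by (auto simp: P_def mem_Times_iff)
    qed
    moreover have "bounded ({t..B / d} \<times> closure \<Omega>)"
      by (intro bounded_Times bounded_closed_interval \<open>bounded (closure \<Omega>)\<close>)
    ultimately show ?thesis by (rule bounded_subset[rotated])
  qed
  ultimately have "compact P" by (simp add: compact_eq_bounded_closed)
  moreover have "(t, x) \<in> P" using x neg by (auto simp: P_def)
  ultimately obtain p where p: "p \<in> P" "\<And>q. q \<in> P \<Longrightarrow> fst q \<le> fst p"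
    using continuous_attains_sup[of P fst] continuous_on_fst[OF continuous_on_id] by blast
  obtain T x1 where [simp]: "p = (T, x1)" by (cases p)
  have T: "1 < T" and x1: "x1 \<in> closure \<Omega>" "T *\<^sub>R x1 \<in> closure \<Omega>" "u x1 \<le> u (T *\<^sub>R x1)"
    using p(1) t by (auto simp: P_def)
  \<comment> \<open>For \<open>s > T\<close> the inequality holds by maximality of \<open>T\<close>
    or by comparison outside the ring; continuity transfers it to \<open>T\<close>.\<close>
  have le: "u (T *\<^sub>R y) \<le> u y" for y
  proof (rule tendsto_upperbound[of _ _ "at_right T"])
    have "continuous_on UNIV (\<lambda>s. u (s *\<^sub>R y))"
      by (rule continuous_on_compose2[OF cont_u[of UNIV]]) (auto intro!: continuous_intros)
    then have "isCont (\<lambda>s. u (s *\<^sub>R y)) T"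
      by (simp add: continuous_on_eq_continuous_at)
    then show "((\<lambda>s. u (s *\<^sub>R y)) \<longlongrightarrow> u (T *\<^sub>R y)) (at_right T)"
      by (simp add: isCont_def filterlim_at_split)
    have "u (s *\<^sub>R y) \<le> u y" if s: "T < s" for s
    proof (cases "y \<in> \<Omega> \<and> s *\<^sub>R y \<in> \<Omega>")
      case True
      then have "y \<in> closure \<Omega>" "s *\<^sub>R y \<in> closure \<Omega>"
        using closure_subset[of \<Omega>] by auto
      moreover have "(s, y) \<notin> P" using p(2)[of "(s, y)"] s by auto
      moreover have "t \<le> s" using p(1) s by (simp add: P_def)
      ultimately show ?thesis by (simp add: P_def)
    next
      case False
      then show ?thesis using s T by (intro u_scaleR_le_outside) auto
    qed
    then show "\<forall>\<^sub>F s in at_right T. u (s *\<^sub>R y) \<le> u y"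
      by (auto simp: eventually_at_right_field intro: exI[of _ "T + 1"])
  qed simp
  have eq: "u (T *\<^sub>R x1) = u x1" using le[of x1] x1(3) by simp
  have inv: "(1 / T) *\<^sub>R (T *\<^sub>R x1) = x1" using T by simp
  \<comment> \<open>Here strict starshapedness acts: shrinking \<open>T x1\<close> by the factor 1/T
    < 1 moves it from a closure into the open set itself. So \<open>x1\<close> is in
    \<open>D0\<close>, and \<open>T x1\<close> in the closure of \<open>D1\<close> would put
    \<open>x1\<close> into \<open>D1\<close>.\<close>
  have x1_D0: "x1 \<in> D0"
    using strictly_starshaped_scaleR_mem[OF strict(1) bdd D(1), of "T *\<^sub>R x1" "1 / T"] x1 cl_sub T
    unfolding inv by auto
  have Tx1_D1: "T *\<^sub>R x1 \<notin> closure D1"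
    using strictly_starshaped_scaleR_mem[OF strict(2) D(5) D(2), of "T *\<^sub>R x1" "1 / T"] x1 disj T
    unfolding inv by auto
  have Tx1_D0: "T *\<^sub>R x1 \<in> D0"
  proof (rule ccontr)
    assume "T *\<^sub>R x1 \<notin> D0"
    then have "u x1 \<le> 0" using u_le_0 eq by metis
    then show False
      using u_ge_1[of x1] u01' x1_D0 by (cases "x1 \<in> closure D1") force+
  qed
  have Tx1: "T *\<^sub>R x1 \<in> \<Omega>" using Tx1_D0 Tx1_D1 by blast
  have x1_\<Omega>: "x1 \<in> \<Omega>"
  proof -
    have "u x1 < 1" using bspec[OF u01' Tx1] eq by simp
    with u_ge_1[of x1] x1_D0 show ?thesis by force
  qed
  define v where "v y = u (T *\<^sub>R y) - u y" for y
  have v_cont: "continuous_on A v" for A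
    unfolding v_def[abs_def] by (intro continuous_intros cont_u cont_u_scale)
  have v_le: "v y \<le> 0" for y using le[of y] by (simp add: v_def)
  have v_x1: "v x1 = 0" by (simp add: v_def eq)
  obtain B where B: "\<And>x. \<bar>u x\<bar> \<le> B" using u_bounded by blast
  have vB: "\<bar>v y\<bar> \<le> 2 * B" for y
    using B[of y] B[of "T *\<^sub>R y"] unfolding v_def by linarith
  have "open {y \<in> \<Omega>. T *\<^sub>R y \<in> \<Omega>}"
  proof -
    have "open ((\<lambda>y. T *\<^sub>R y) -` \<Omega>)"
      by (intro open_vimage open_\<Omega> continuous_intros)
    then have "open (\<Omega> \<inter> (\<lambda>y. T *\<^sub>R y) -` \<Omega>)" using open_\<Omega> by (rule open_Int[rotated])
    moreover have "\<Omega> \<inter> (\<lambda>y. T *\<^sub>R y) -` \<Omega> = {y \<in> \<Omega>. T *\<^sub>R y \<in> \<Omega>}" by blast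
    ultimately show ?thesis by simp
  qed
  \<comment> \<open>The maximum principle is used with radius \<rho>/2, so every point outside the
    ball of radius \<rho> is strictly beyond the truncation.\<close>
  then obtain \<rho> where \<rho>: "0 < \<rho>" "ball x1 \<rho> \<subseteq> {y \<in> \<Omega>. T *\<^sub>R y \<in> \<Omega>}"
    using x1_\<Omega> Tx1 open_contains_ball by (metis (mono_tags, lifting) mem_Collect_eq)
  obtain C where C: "0 < C" "\<And>(v::real^'n \<Rightarrow> real) B M \<eta> A x1.
    \<lbrakk>continuous_on UNIV v; \<And>x. \<bar>v x\<bar> \<le> B; \<And>x. v x \<le> M; 0 < \<eta>; 0 \<le> A; M - \<eta> \<le> v x1;
     \<And>x0 r. 0 < r \<Longrightarrow> cball x0 r \<subseteq> ball x1 (\<rho> / 2) \<inter> {x. M - 2 * \<eta> < v x} \<Longrightarrow>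
       \<exists>l. weak_lap \<alpha> v x0 r l \<and> - A * (\<integral>y. bump x0 r y \<partial>lborel) \<le> l\<rbrakk>
    \<Longrightarrow> (\<integral>y. tkern \<alpha> (\<rho> / 2) (y - x1) * (M - v y) \<partial>lborel) \<le> C * (\<eta> + A)"
    by (rule near_max_integral_bound[OF alpha, of "\<rho> / 2"]) (use \<rho>(1) in \<open>simp, blast\<close>)
  obtain L where L: "0 < L" "\<And>y a b. y \<in> \<Omega> \<Longrightarrow> a \<in> {0..1} \<Longrightarrow> b \<in> {0..1} \<Longrightarrow> \<bar>f y a - f y b\<bar> \<le> L * \<bar>a - b\<bar>"
    using F2 unfolding F2_def by blast
  let ?c = "frac_const CARD('n) \<alpha>"
  have c: "0 < ?c" by (rule frac_const_pos[OF alpha])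
  let ?J = "\<integral>y. tkern \<alpha> (\<rho> / 2) (y - x1) * (0 - v y) \<partial>lborel"
  \<comment> \<open>The maximum 0 is attained at \<open>x1\<close>, so every \<eta> > 0 is
    admissible. On the testing region |v| < 2\<eta>, and the Lipschitz constant \<open>L\<close>
    turns this into an error linear in \<eta>; the whole bound vanishes with \<eta>.\<close>
  have J: "?J \<le> \<eta> * (C * (1 + 2 * L / ?c))" if \<eta>: "0 < \<eta>" for \<eta>
  proof -
    have "\<exists>l. weak_lap \<alpha> v x0 r l \<and> - (L * (2 * \<eta>) / ?c) * (\<integral>y. bump x0 r y \<partial>lborel) \<le> l"
      if r: "0 < r" "cball x0 r \<subseteq> ball x1 (\<rho> / 2) \<inter> {x. 0 - 2 * \<eta> < v x}" for x0 r
    proof -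
      have sub: "cball x0 r \<subseteq> {y \<in> \<Omega>. T *\<^sub>R y \<in> \<Omega>}"
        using r(2) \<rho> by (force simp: subset_iff)
      have ge: "- (L * (2 * \<eta>)) \<le> f y (u (T *\<^sub>R y)) - f y (u y)" if y: "y \<in> cball x0 r" for y
      proof -
        have "\<bar>f y (u (T *\<^sub>R y)) - f y (u y)\<bar> \<le> L * \<bar>u (T *\<^sub>R y) - u y\<bar>"
          using sub y u01 by (intro L(2)) auto
        also have "\<dots> \<le> L * (2 * \<eta>)"
        proof (intro mult_left_mono)
          have "0 - 2 * \<eta> < v y" using r(2) y by blast
          with v_le[of y] show "\<bar>u (T *\<^sub>R y) - u y\<bar> \<le> 2 * \<eta>"
            unfolding v_def by linarith
        qed (use L in simp)
        finally show ?thesis by linarith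
      qed
      show ?thesis
        using weak_lap_dilation_difference[OF less_imp_le[OF T] r(1) sub ge]
        unfolding v_def[abs_def] by blast
    qed
    then have "?J \<le> C * (\<eta> + L * (2 * \<eta>) / ?c)"
      using \<eta> L(1) c v_x1 by (intro C(2)[OF v_cont vB v_le]) auto
    then show ?thesis by (simp add: algebra_simps)
  qed
  have J0: "?J \<le> 0"
  proof (rule field_le_epsilon)
    fix \<epsilon> :: real assume \<epsilon>: "0 < \<epsilon>"
    define Q where "Q = C * (1 + 2 * L / ?c)"
    have Q: "0 < Q"
      unfolding Q_def using C(1) L(1) c by (intro mult_pos_pos add_pos_pos) auto
    then have "?J \<le> \<epsilon> / Q * Q"
      using \<epsilon> unfolding Q_def by (intro J divide_pos_pos)
    also have "\<dots> = 0 + \<epsilon>" using Q by simp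
    finally show "?J \<le> 0 + \<epsilon>" .
  qed
  have [measurable]: "v \<in> borel_measurable borel"
    by (rule borel_measurable_continuous_onI[OF v_cont])
  have nonneg: "0 \<le> tkern \<alpha> (\<rho> / 2) (y - x1) * (0 - v y)" for y
    using v_le[of y] by (intro mult_nonneg_nonneg) auto
  have int: "integrable lborel (\<lambda>y. tkern \<alpha> (\<rho> / 2) (y - x1) * (0 - v y))"
  proof (rule integrable_mult_bounded)
    show "integrable lborel (\<lambda>y. tkern \<alpha> (\<rho> / 2) (y - x1))"
      using lborel_integrable_translate[OF integrable_tkern[OF alpha, of "\<rho> / 2"], of "- x1"] \<rho>(1) by simp
    show "\<bar>0 - v y\<bar> \<le> 2 * B" for y using vB[of y] by simp
  qed measurable
  have "?J = 0"
    by (rule antisym[OF J0 Bochner_Integration.integral_nonneg[OF nonneg]])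
  then have AE0: "AE y in lborel. tkern \<alpha> (\<rho> / 2) (y - x1) * (0 - v y) = 0"
    using integral_nonneg_eq_0_iff_AE[OF int AE_I2[OF nonneg]] by (rule iffD1[rotated])
  \<comment> \<open>The integral is zero and its integrand nonnegative, so \<open>G\<close> is a
    null set; being open, it is empty.\<close>
  define G where "G = {y. \<rho> / 2 < norm (y - x1)} \<inter> {y. v y < 0}"
  have "open G"
    unfolding G_def by (intro open_Int open_Collect_less continuous_intros v_cont)
  have "AE y in lborel. y \<notin> G"
    using AE0
  proof eventually_elim
    case (elim y)
    show ?case
    proof
      assume "y \<in> G"
      then have y: "\<rho> / 2 < norm (y - x1)" "v y < 0" by (auto simp: G_def)
      with \<rho>(1) have "0 < kern \<alpha> (y - x1)" by (intro kern_pos) auto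
      with y elim show False by (simp add: tkern_def)
    qed
  qed
  then have "G \<in> null_sets lborel"
    using \<open>open G\<close> by (subst (asm) AE_iff_null_sets[symmetric]) auto
  then have "negligible G"
    by (simp add: negligible_iff_null_sets null_sets_completionI)
  with \<open>open G\<close> have "G = {}" using open_not_negligible by blast
  \<comment> \<open>A frontier point \<open>q\<close> of \<open>D1\<close> contradicts this:
    \<open>u q\<close> is at least 1, while \<open>T q\<close> has left the closure of
    \<open>D1\<close>, where \<open>u\<close> is below 1.\<close>
  moreover have "\<exists>q. q \<in> G"
  proof -
    obtain e :: "real^'n" where "e \<noteq> 0"
      by (metis one_neq_zero zero_index one_index)
    then obtain S where "0 \<le> S" "S *\<^sub>R e \<notin> D1"
      using bounded_scaleR_notin[OF D(5)] by blast
    then obtain s where "s *\<^sub>R e \<in> frontier D1"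
      using scaleR_crosses_frontier[of 0 S e D1] D(3) by auto
    then obtain q where q: "q \<in> frontier D1" by blast
    then have qcl: "q \<in> closure D1" "q \<notin> D1"
      using D(2) by (auto simp: frontier_def interior_open)
    have Tq: "T *\<^sub>R q \<notin> closure D1"
      using strictly_starshaped_scaleR_mem[OF strict(2) D(5) D(2), of "T *\<^sub>R q" "1 / T"] qcl(2) T by auto
    have "u (T *\<^sub>R q) < 1"
      using Tq u01' u_le_0[of "T *\<^sub>R q"] by (cases "T *\<^sub>R q \<in> D0") auto
    then have "v q < 0" using u_ge_1[OF qcl(1)] by (simp add: v_def)
    moreover have "q \<notin> ball x1 \<rho>" using \<rho>(2) qcl(1) by blast
    then have "\<rho> / 2 < norm (q - x1)" using \<rho>(1) by (simp add: dist_norm norm_minus_commute)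
    ultimately show ?thesis by (auto simp: G_def)
  qed
  ultimately show False by blast
qed

text \<open>Continuity gives \<open>u = l\<close> on the frontier, and 0 < l < 1 places the frontier
  inside the ring. Every ray crosses it because \<open>u\<close> is at least 1 at the origin and
  nonpositive off the bounded set \<open>D0\<close>; two crossings would contradict strict decrease
  along the ray.\<close>

lemma strictly_starshaped_superlevel_u:
  assumes bdd: "bounded D0" and strict: "strictly_starshaped D0" "strictly_starshaped D1"
    and F2: "F2 \<Omega> f" and u01': "\<forall>x\<in>\<Omega>. 0 < u x \<and> u x < 1" and l: "0 < l" "l < 1"
  shows "strictly_starshaped (superlevel u l)"
proof -
  let ?U = "superlevel u l"
  have "D1 \<subseteq> ?U"
    using u_ge_1 l closure_subset[of D1] by (fastforce simp: superlevel_def)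
  then have "0 \<in> interior ?U"
    using D(2,3) interior_maximal by blast
  moreover have "\<exists>!y. y \<in> {s *\<^sub>R w |s. 0 \<le> s} \<and> y \<in> frontier ?U" if w: "w \<noteq> 0" for w
  proof -
    have fr: "u y = l" if "y \<in> frontier ?U" for y
    proof -
      have "closed ?U"
        unfolding superlevel_def by (intro closed_Collect_le continuous_intros cont_u)
      moreover have "{y. l < u y} \<subseteq> interior ?U"
        by (intro interior_maximal open_Collect_less continuous_intros cont_u) (auto simp: superlevel_def)
      ultimately show ?thesis
        using that by (force simp: frontier_def superlevel_def)
    qed
    have ring: "y \<in> \<Omega>" if "y \<in> frontier ?U" for y
      using fr[OF that] l u_ge_1[of y] u_le_0[of y] by force
    obtain S where S: "0 \<le> S" "S *\<^sub>R w \<notin> D0"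
      using bounded_scaleR_notin[OF bdd w] by blast
    have "S *\<^sub>R w \<notin> ?U"
      using u_le_0[OF S(2)] l by (simp add: superlevel_def)
    moreover have "0 *\<^sub>R w \<in> ?U"
      using \<open>D1 \<subseteq> ?U\<close> D(3) by auto
    ultimately obtain a where a: "0 \<le> a" "a *\<^sub>R w \<in> frontier ?U"
      using scaleR_crosses_frontier[OF S(1), of w ?U] by blast
    have less: False if "0 \<le> s" "s < s'" "s *\<^sub>R w \<in> frontier ?U" "s' *\<^sub>R w \<in> frontier ?U" for s s'
    proof -
      have "s \<noteq> 0"
        using ring[OF that(3)] D(3) closure_subset[of D1] by auto
      with that have s: "0 < s" by simp
      have "u ((s' / s) *\<^sub>R (s *\<^sub>R w)) < u (s *\<^sub>R w)"
        using s that ring closure_subset[of \<Omega>]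
        by (intro u_scaleR_less[OF bdd strict F2 u01']) auto
      with s fr that show False by simp
    qed
    show ?thesis
    proof (rule ex1I[of _ "a *\<^sub>R w"])
      fix y assume "y \<in> {s *\<^sub>R w |s. 0 \<le> s} \<and> y \<in> frontier ?U"
      then obtain s where "0 \<le> s" "y = s *\<^sub>R w" "s *\<^sub>R w \<in> frontier ?U" by blast
      with less[of s a] less[of a s] a show "y = a *\<^sub>R w"
        by (metis linorder_neqE_linordered_idom)
    qed (use a in auto)
  qed
  ultimately show ?thesis by (simp add: strictly_starshaped_def)
qed

end

theorem theorem1p8:
  fixes \<alpha> :: real and D0 D1 :: "(real^'n) set"
    and f :: "real^'n \<Rightarrow> real \<Rightarrow> real" and b0 b1 :: "real^'n \<Rightarrow> real"
  assumes "0 < \<alpha>" "\<alpha> < 2"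
    and "open D0" "open D1" "0 \<in> D1" "closure D1 \<subseteq> D0"
    and "uniform_exterior_cone (D0 - closure D1)"
    and "continuous_on UNIV b0" "bounded (range b0)"
    and "continuous_on UNIV b1" "bounded (range b1)"
    and "\<forall>x\<in>frontier D1. b1 x = 1" "\<forall>x\<in>frontier D0. b0 x = 0"
    and "\<forall>l. starshaped (superlevel b0 l)" "\<forall>l. starshaped (superlevel b1 l)"
  shows
    "(bounded D0 \<and> starshaped D0 \<and> bounded D1 \<and> starshaped D1 \<and>
      F0 (D0 - closure D1) f \<and> F1 \<alpha> (D0 - closure D1) f \<and>
      F2 (D0 - closure D1) f \<and> F3 (D0 - closure D1) f \<longrightarrow>
        (\<forall>u. solution \<alpha> D0 D1 f b0 b1 u \<and> (\<forall>x\<in>D0 - closure D1. 0 \<le> u x \<and> u x \<le> 1) \<longrightarrow>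
          (\<forall>l. 0 < l \<and> l < 1 \<longrightarrow> starshaped (superlevel u l)))) \<and>
     (bounded D0 \<and> strictly_starshaped D0 \<and> bounded D1 \<and> strictly_starshaped D1 \<and>
      F0 (D0 - closure D1) f \<and> F1 \<alpha> (D0 - closure D1) f \<and> F2 (D0 - closure D1) f \<longrightarrow>
        (\<forall>u. solution \<alpha> D0 D1 f b0 b1 u \<and> (\<forall>x\<in>D0 - closure D1. 0 < u x \<and> u x < 1) \<longrightarrow>
          (\<forall>l. 0 < l \<and> l < 1 \<longrightarrow> strictly_starshaped (superlevel u l)))) \<and>
     (D0 = UNIV \<and> bounded D1 \<and> starshaped D1 \<and>
      F0 (D0 - closure D1) f \<and> F1 \<alpha> (D0 - closure D1) f \<and>
      F2 (D0 - closure D1) f \<and> F3 (D0 - closure D1) f \<longrightarrow>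
        (\<forall>u. solution \<alpha> D0 D1 f b0 b1 u \<and> (\<forall>x\<in>D0 - closure D1. 0 \<le> u x \<and> u x \<le> 1) \<longrightarrow>
          (\<forall>l. 0 < l \<and> l < 1 \<longrightarrow> starshaped (superlevel u l))))"
proof -
  have ring: "ring_solution \<alpha> D0 D1 f b0 b1 u"
    if "bounded D1" "starshaped D0" "starshaped D1" "F0 (D0 - closure D1) f" "F1 \<alpha> (D0 - closure D1) f"
      "solution \<alpha> D0 D1 f b0 b1 u" "\<forall>x\<in>D0 - closure D1. 0 \<le> u x \<and> u x \<le> 1" for u
    using assms that by unfold_locales auto
  have weak: "starshaped (superlevel u l)"
    if "bounded D1" "starshaped D0" "starshaped D1" "F0 (D0 - closure D1) f" "F1 \<alpha> (D0 - closure D1) f"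
      "F3 (D0 - closure D1) f"
      "solution \<alpha> D0 D1 f b0 b1 u" "\<forall>x\<in>D0 - closure D1. 0 \<le> u x \<and> u x \<le> 1" "l < 1" for u l
    by (rule ring_solution.starshaped_superlevel_u[OF ring]) (use that in auto)
  have strict: "strictly_starshaped (superlevel u l)"
    if "bounded D0" "strictly_starshaped D0" "bounded D1" "strictly_starshaped D1"
      "F0 (D0 - closure D1) f" "F1 \<alpha> (D0 - closure D1) f" "F2 (D0 - closure D1) f"
      "solution \<alpha> D0 D1 f b0 b1 u" "\<forall>x\<in>D0 - closure D1. 0 < u x \<and> u x < 1" "0 < l" "l < 1" for u l
  proof -
    have "\<forall>x\<in>D0 - closure D1. 0 \<le> u x \<and> u x \<le> 1"
      using that(9) by (simp add: less_imp_le)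
    then have "ring_solution \<alpha> D0 D1 f b0 b1 u"
      by (intro ring) (use that assms strictly_starshaped_imp_starshaped in auto)
    then show ?thesis
      by (rule ring_solution.strictly_starshaped_superlevel_u) (use that in auto)
  qed
  show ?thesis
  proof (intro conjI impI allI)
    fix u and l :: real
    assume "bounded D0 \<and> starshaped D0 \<and> bounded D1 \<and> starshaped D1 \<and>
      F0 (D0 - closure D1) f \<and> F1 \<alpha> (D0 - closure D1) f \<and>
      F2 (D0 - closure D1) f \<and> F3 (D0 - closure D1) f"
      and "solution \<alpha> D0 D1 f b0 b1 u \<and> (\<forall>x\<in>D0 - closure D1. 0 \<le> u x \<and> u x \<le> 1)"
      and "0 < l \<and> l < 1"
    then show "starshaped (superlevel u l)"
      by (intro weak) blast+
  next
    fix u and l :: real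
    assume "bounded D0 \<and> strictly_starshaped D0 \<and> bounded D1 \<and> strictly_starshaped D1 \<and>
      F0 (D0 - closure D1) f \<and> F1 \<alpha> (D0 - closure D1) f \<and> F2 (D0 - closure D1) f"
      and "solution \<alpha> D0 D1 f b0 b1 u \<and> (\<forall>x\<in>D0 - closure D1. 0 < u x \<and> u x < 1)"
      and "0 < l \<and> l < 1"
    then show "strictly_starshaped (superlevel u l)"
      by (intro strict) blast+
  next
    fix u and l :: real
    assume "D0 = UNIV \<and> bounded D1 \<and> starshaped D1 \<and>
      F0 (D0 - closure D1) f \<and> F1 \<alpha> (D0 - closure D1) f \<and>
      F2 (D0 - closure D1) f \<and> F3 (D0 - closure D1) f"
      and "solution \<alpha> D0 D1 f b0 b1 u \<and> (\<forall>x\<in>D0 - closure D1. 0 \<le> u x \<and> u x \<le> 1)"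
      and "0 < l \<and> l < 1"
    \<comment> \<open>This brings part (iii) under the same comparison statement as part
      (i).\<close>
    moreover from this have "starshaped D0" by (simp add: starshaped_def)
    ultimately show "starshaped (superlevel u l)"
      by (intro weak) blast+
  qed
qed

end
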